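(* Let $Tx=x+\alpha$ on $\mathbb T=[0,1)$, where $\alpha$ is irrational with bounded partial quotients, and let $\varphi(x)=\{x\}-\frac12$. Let $\mathcal S=(S_t)_{t\in\mathbb R}$ be an ergodic measure-preserving flow on a standard probability space $(Y,\mathcal C,\nu)$ such that no rational number is an eigenvalue of $\mathcal S$ on $L^2_0(Y,\nu)$ (i.e. there is no $t\in\mathbb Q$ and $0\ne h\in L^2_0(Y,\nu)$ with $h\circ S_u=e^{2\pi i tu}h$ for all $u\in\mathbb R$). Then the automorphism $T_{\varphi,\mathcal S}(x,y)=(x+\alpha,S_{\varphi(x)}y)$ of $(\mathbb T\times Y,\lambda_{\mathbb T}\otimes\nu)$ has the AOP property.
   Context: AOP: for all zero-mean $L^2$ functions $F,G$, $\limsup_{r\ne s \text{ prime},\ r,s\to\infty}\sup_{\kappa\in J^e(R^r,R^s)}|\int F\otimes G\,d\kappa|=0$, where $J^e(R^r,R^s)$ is the set of ergodic $R^r\times R^s$-invariant probability measures on the product with both marginals equal to the invariant measure. *)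

theory Defs
  imports "HOL-Probability.Probability" "HOL-Computational_Algebra.Primes"
begin

primrec cf_complete_quotient :: "real \<Rightarrow> nat \<Rightarrow> real" where
  "cf_complete_quotient x 0 = x"
| "cf_complete_quotient x (Suc n) = 1 / frac (cf_complete_quotient x n)"

definition cf_partial_quotient :: "real \<Rightarrow> nat \<Rightarrow> int" where
  "cf_partial_quotient x n = \<lfloor>cf_complete_quotient x n\<rfloor>"

definition bounded_partial_quotients :: "real \<Rightarrow> bool" where
  "bounded_partial_quotients x \<longleftrightarrow> (\<exists>B. \<forall>n. cf_partial_quotient x n \<le> B)"

definition standard_borel :: "'a measure \<Rightarrow> bool" where
  "standard_borel M \<longleftrightarrow> (\<exists>(f :: 'a \<Rightarrow> real) B. B \<in> sets borel \<and> bij_betw f (space M) B \<and>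
      f \<in> measurable M borel \<and> (\<forall>A\<in>sets M. f ` A \<in> sets borel))"

definition standard_prob_space :: "'a measure \<Rightarrow> bool" where
  "standard_prob_space M \<longleftrightarrow> prob_space M \<and> standard_borel M"

definition mp_flow :: "'a measure \<Rightarrow> (real \<Rightarrow> 'a \<Rightarrow> 'a) \<Rightarrow> bool" where
  "mp_flow M S \<longleftrightarrow>
     (\<lambda>(t, y). S t y) \<in> measurable (borel \<Otimes>\<^sub>M M) M \<and>
     (\<forall>y\<in>space M. S 0 y = y) \<and>
     (\<forall>t u. \<forall>y\<in>space M. S (t + u) y = S t (S u y)) \<and>
     (\<forall>t. distr M M (S t) = M)"

definition ergodic_flow :: "'a measure \<Rightarrow> (real \<Rightarrow> 'a \<Rightarrow> 'a) \<Rightarrow> bool" where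
  "ergodic_flow M S \<longleftrightarrow> mp_flow M S \<and>
     (\<forall>A\<in>sets M. (\<forall>t. S t -` A \<inter> space M = A) \<longrightarrow> measure M A = 0 \<or> measure M A = 1)"

definition L2_0 :: "'a measure \<Rightarrow> ('a \<Rightarrow> complex) set" where
  "L2_0 M = {h. h \<in> borel_measurable M \<and> integrable M (\<lambda>x. (cmod (h x))\<^sup>2) \<and>
                (\<integral>x. h x \<partial>M) = 0}"

definition flow_eigenvalue_L2_0 :: "'a measure \<Rightarrow> (real \<Rightarrow> 'a \<Rightarrow> 'a) \<Rightarrow> real \<Rightarrow> bool" where
  "flow_eigenvalue_L2_0 M S t \<longleftrightarrow>
     (\<exists>h\<in>L2_0 M. \<not> (AE y in M. h y = 0) \<and>
        (\<forall>u. AE y in M. h (S u y) = exp (2 * pi * \<i> * complex_of_real (t * u)) * h y))"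

definition ergodic_joinings ::
  "'a measure \<Rightarrow> ('a \<Rightarrow> 'a) \<Rightarrow> nat \<Rightarrow> nat \<Rightarrow> ('a \<times> 'a) measure set" where
  "ergodic_joinings M R r s = {\<kappa>.
     sets \<kappa> = sets (M \<Otimes>\<^sub>M M) \<and> prob_space \<kappa> \<and>
     distr \<kappa> M fst = M \<and> distr \<kappa> M snd = M \<and>
     distr \<kappa> \<kappa> (\<lambda>(p, q). ((R ^^ r) p, (R ^^ s) q)) = \<kappa> \<and>
     (\<forall>A\<in>sets \<kappa>. (\<lambda>(p, q). ((R ^^ r) p, (R ^^ s) q)) -` A \<inter> space \<kappa> = A \<longrightarrow>
        measure \<kappa> A = 0 \<or> measure \<kappa> A = 1)}"

text \<open>AOP: for all zero-mean L^2 functions F, G,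
  limsup over distinct primes r, s tending to infinity of
  sup over ergodic joinings kappa of |int F (x) G dkappa| equals 0
  (the quantity being nonnegative, this is written in epsilon-N form).\<close>
definition AOP :: "'a measure \<Rightarrow> ('a \<Rightarrow> 'a) \<Rightarrow> bool" where
  "AOP M R \<longleftrightarrow>
     (\<forall>F\<in>L2_0 M. \<forall>G\<in>L2_0 M. \<forall>\<epsilon>>0. \<exists>N. \<forall>r s.
        prime r \<and> prime s \<and> r \<noteq> s \<and> N \<le> r \<and> N \<le> s \<longrightarrow>
        (\<forall>\<kappa>\<in>ergodic_joinings M R r s.
           cmod (\<integral>z. F (fst z) * G (snd z) \<partial>\<kappa>) \<le> \<epsilon>))"

definition circle_measure :: "real measure" where
  "circle_measure = restrict_space lborel {0..<1}"

end

theory Submission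
  imports Defs
begin

text \<open>
  Let \<open>\<kappa>\<close> be an ergodic joining of the powers \<open>r\<close> and \<open>s\<close> with \<open>s < r\<close>. Its fibre motion is driven by the
  Birkhoff sums of the sawtooth along both coordinates. For \<open>q\<close> with \<open>\<parallel>q\<alpha>\<parallel> \<le> 1/q\<close> the sums of lengths
  \<open>rq\<close> and \<open>sq\<close> stay bounded (Denjoy and Koksma). Move the base point by \<open>(r\<delta>, s\<delta>)\<close> with \<open>\<delta>\<close> close to \<open>\<epsilon>/q\<close>.
  The first sum changes by \<open>r\<^sup>2q\<delta>\<close> minus the number of its \<open>r\<^sup>2q\<close> jumps that are crossed, the second by
  \<open>s\<^sup>2q\<delta>\<close> minus the number of its \<open>s\<^sup>2q\<close> jumps that are crossed.
  Since \<open>\<alpha>\<close> is badly approximable, jumps of the first kind are separated, and as they outnumber those of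
  the second kind, on a set of base measure at least about \<open>(r\<^sup>2 - s\<^sup>2)\<epsilon>\<close> exactly one jump of the first
  kind and none of the second is crossed. On this set the conditional measures of \<open>\<kappa>\<close> at two nearby
  base points are moved by \<open>q\<close> steps in ways that differ by the time vector \<open>(r\<^sup>2\<epsilon> - 1, s\<^sup>2\<epsilon>)\<close>. As conditional
  measures are almost unchanged under small base shifts, ergodicity makes \<open>\<kappa>\<close> invariant under
  that fibre motion, for all small \<open>\<epsilon>\<close>, hence under the time vectors \<open>(-1, 0)\<close> and \<open>(0, s\<^sup>2/r\<^sup>2)\<close>.
  Rational time maps of the flow are ergodic because no rational number is an eigenvalue, so both fibre
  coordinates are independent of everything else. What remains is a joining of two rotations,
  where characters of degree below \<open>r\<close> and \<open>s\<close> are uncorrelated.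
\<close>

section \<open>Diophantine properties of the rotation and its sawtooth cocycle\<close>

text \<open>\<open>\<kappa>\<close> is known only through its marginals, its invariance and its
  ergodicity, so every estimate must survive an arbitrary coupling of the two base points. The shift
  \<delta> has the form k \<alpha> mod 1, because invariance of the base measure is available only
  along the orbit of \<alpha>. The good set is bounded below by subtracting one marginal probability
  from another, which works only if the jumps of the first kind have the larger total mass: hence s
  < r, the other order being reduced to it by exchanging the coordinates. The good sets change with
  q, so the continuity of the conditional measures must be uniform over all base sets; conditional
  expectations and an L1 modulus of continuity provide this without a disintegration. On a good set
  the cocycle is bounded but not constant. The set is therefore cut into finitely many cells, and
  the observables are smoothed along the flow so that they tolerate the error within a cell.\<close>

text \<open>
  One continued fraction step replaces \<open>(q, p, x, y)\<close> by \<open>(p - aq, q, 1/(x - a), 1/(y - a))\<close> and leaves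
  \<open>\<bar>qx - p\<bar> (p - qy) / (x - y)\<close> unchanged, which allows a descent on \<open>q\<close>.
\<close>

lemma indefinite_form_lower_bound:
  fixes X :: "nat \<Rightarrow> real" and B :: real
  assumes gt1: "\<And>n. 1 < X n" and le: "\<And>n. X n \<le> B"
    and rec: "\<And>n. X (Suc n) = 1 / frac (X n)"
    and fr: "\<And>n. 0 < frac (X n)"
  shows "1 \<le> p \<Longrightarrow> 1 \<le> q \<Longrightarrow> -1 \<le> y \<Longrightarrow> y \<le> 0 \<Longrightarrow>
    1 / (B ^ 2 * (B + 1)) * (X n - y) \<le> \<bar>of_int q * X n - of_int p\<bar> * (of_int p - of_int q * y)"
proof (induction "nat q" arbitrary: q p y n rule: less_induct)
  case less
  define a where "a = \<lfloor>X n\<rfloor>"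
  define x' where "x' = X (Suc n)"
  \<comment> \<open>With this constant c (X n - y) \<le> 1/B^2 whenever y \<ge> -1. As the factor p
    - q y is at least 1, every case outside the descent only needs |q X n - p| \<ge> 1/B^2.\<close>
  define c where "c = 1 / (B ^ 2 * (B + 1))"
  have B: "1 < B" using gt1 le by (meson less_le_trans)
  have c: "0 < c" using B by (simp add: c_def)
  have cB: "c * (B + 1) = 1 / B ^ 2" using B by (simp add: c_def)
  have B1: "1 / B ^ 2 \<le> 1 / B" using B by (simp add: divide_simps power2_eq_square)
  have x': "1 < x'" "x' \<le> B" using gt1 le by (auto simp: x'_def)
  have Xn: "X n = of_int a + 1 / x'"
    using rec[of n] fr[of n] by (simp add: a_def x'_def frac_def)
  have a: "1 \<le> a" using gt1[of n] by (simp add: a_def)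
  have XB: "X n - y \<le> B + 1" using le[of n] less.prems by simp
  have cX: "c * (X n - y) \<le> 1 / B ^ 2" 
    using mult_left_mono[OF XB, of c] c cB by simp
  have py: "1 \<le> of_int p - of_int q * y"
  proof -
    have "of_int q * y \<le> 0" using less.prems by (intro mult_nonneg_nonpos) auto
    then show ?thesis using less.prems by linarith
  qed
  have suff: "c * (X n - y) \<le> \<bar>of_int q * X n - of_int p\<bar> * (of_int p - of_int q * y)"
    if "1 / B ^ 2 \<le> \<bar>of_int q * X n - of_int p\<bar>"
  proof -
    have "1 / B ^ 2 * 1 \<le> \<bar>of_int q * X n - of_int p\<bar> * (of_int p - of_int q * y)"
      using that py B by (intro mult_mono) auto
    then show ?thesis using cX by linarith
  qed
  define p' where "p' = p - a * q"
  have qx: "of_int q * X n - of_int p = of_int q / x' - of_int p'"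
    by (simp add: Xn p'_def algebra_simps)
  \<comment> \<open>Here q X n - p = q/x' - p' with x' > 1. For p' \<le> 0 the two terms do not
    cancel; for p' \<ge> q the gap is at least 1 - 1/x', and x' stays at least 1/B above 1; only 1
    \<le> p' < q calls for the descent.\<close>
  consider "p' \<le> 0" | "q \<le> p'" | "1 \<le> p'" "p' < q" by linarith
  then have "c * (X n - y) \<le> \<bar>of_int q * X n - of_int p\<bar> * (of_int p - of_int q * y)"
  proof cases
    case 1
    have "1 / B \<le> of_int q / x'" using x' less.prems B by (intro frac_le) auto
    moreover have "(of_int p' :: real) \<le> 0" using 1 by simp
    ultimately have "1 / B \<le> \<bar>of_int q * X n - of_int p\<bar>" unfolding qx by linarith
    then show ?thesis using suff B1 by linarith
  next
    case 2
    have fx': "1 / B \<le> frac x'"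
    proof -
      have "1 / frac x' \<le> B" using le[of "Suc (Suc n)"] rec[of "Suc n"] by (simp add: x'_def)
      then show ?thesis using fr[of "Suc n"] B by (simp add: x'_def field_simps)
    qed
    have "1 \<le> (of_int \<lfloor>x'\<rfloor>::real)" using x' by simp
    then have "1 / B \<le> x' - 1" using fx' unfolding frac_def by linarith
    then have "1 / B / B \<le> (x' - 1) / x'" using x' B by (intro frac_le) auto
    also have "\<dots> = 1 * (1 - 1 / x')" using x' by (simp add: field_simps)
    also have "\<dots> \<le> of_int q * (1 - 1 / x')" using x' less.prems by (intro mult_right_mono) auto
    also have "\<dots> \<le> of_int p' - of_int q / x'" using 2 by (simp add: algebra_simps)
    finally have "1 / B ^ 2 \<le> \<bar>of_int q * X n - of_int p\<bar>"
      unfolding qx by (simp add: power2_eq_square)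
    then show ?thesis using suff by blast
  next
    case 3
    \<comment> \<open>The variable y plays the part of a conjugate root: it undergoes the same
      continued fraction step, and a \<ge> 1 keeps it in [-1, 0).\<close>
    define y' where "y' = 1 / (y - of_int a)"
    have ya: "y - of_int a \<le> -1" using less.prems a by (simp add: algebra_simps add_increasing)
    have y': "-1 \<le> y'" "y' < 0" using ya by (auto simp: y'_def divide_simps)
    have yy: "y = of_int a + 1 / y'" by (simp add: y'_def)
    have IH: "c * (x' - y') \<le> \<bar>of_int p' * x' - of_int q\<bar> * (of_int q - of_int p' * y')"
      using less.hyps[of p' q y' "Suc n"] 3 less.prems y' by (simp add: c_def x'_def)
    have e1: "\<bar>of_int q * X n - of_int p\<bar> = \<bar>of_int p' * x' - of_int q\<bar> / x'"
    proof -
      have "of_int q * X n - of_int p = - (of_int p' * x' - of_int q) / x'"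
        using x' by (simp add: qx field_simps)
      then show ?thesis using x' by simp
    qed
    have e2: "of_int p - of_int q * y = (of_int q - of_int p' * y') / (- y')"
      using y' by (simp add: yy p'_def field_simps)
    have e3: "X n - y = (x' - y') / (x' * (- y'))"
      using y' x' by (simp add: yy Xn field_simps)
    have "c * (X n - y) = c * (x' - y') / (x' * (- y'))" by (simp add: e3)
    also have "\<dots> \<le> \<bar>of_int p' * x' - of_int q\<bar> * (of_int q - of_int p' * y') / (x' * (- y'))"
      using IH y' x' by (intro divide_right_mono) (auto simp: mult_nonneg_nonpos)
    also have "\<dots> = \<bar>of_int q * X n - of_int p\<bar> * (of_int p - of_int q * y)"
      by (simp add: e1 e2)
    finally show ?thesis .
  qed
  then show ?case by (simp add: c_def)
qed

text \<open>The complete quotients from index 1 on lie in (1, B], so the bound for the indefinite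
  form applies to them with y = -1. The quotient of index 0 is \<alpha> itself, which may be
  negative or less than 1; this one step is undone by hand, again with the three positions of
  p'.\<close>

lemma bounded_partial_quotients_badly_approximable:
  assumes irr: "\<alpha> \<notin> \<rat>" and bd: "bounded_partial_quotients \<alpha>"
  obtains c where "0 < c" "\<And>(q::int) p::int. 1 \<le> q \<Longrightarrow> c / of_int q \<le> \<bar>of_int q * \<alpha> - of_int p\<bar>"
proof -
  define X where "X n = cf_complete_quotient \<alpha> (Suc n)" for n
  have irrX: "cf_complete_quotient \<alpha> n \<notin> \<rat>" for n
  proof (induction n)
    case (Suc n)
    have "frac (cf_complete_quotient \<alpha> n) \<notin> \<rat>"
      using Suc by (simp add: frac_def Rats_diff_iff)
    moreover have "frac (cf_complete_quotient \<alpha> n) \<in> \<rat>"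
      if "1 / frac (cf_complete_quotient \<alpha> n) \<in> \<rat>"
      using Rats_divide[OF Rats_1 that] by simp
    ultimately show ?case by auto
  qed (use irr in simp)
  have frp: "0 < frac (cf_complete_quotient \<alpha> n)" for n
    using irrX[of n] Ints_subset_Rats by (auto simp: frac_gt_0_iff)
  obtain B0 where B0: "\<And>n. cf_partial_quotient \<alpha> n \<le> B0"
    using bd unfolding bounded_partial_quotients_def by blast
  define B :: real where "B = of_int B0 + 1"
  have gt1: "1 < X n" for n
    using frp[of n] frac_lt_1[of "cf_complete_quotient \<alpha> n"]
    unfolding X_def cf_complete_quotient.simps by (simp only: less_divide_eq_1_pos)
  have le: "X n \<le> B" for n
    using B0[of "Suc n"] unfolding X_def cf_partial_quotient_def B_def by linarith
  have rec: "X (Suc n) = 1 / frac (X n)" for n by (simp only: X_def cf_complete_quotient.simps)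
  have fr: "0 < frac (X n)" for n using frp by (simp only: X_def)
  define c where "c = 1 / (B ^ 2 * (B + 1))"
  have B: "1 < B" using gt1 le by (meson less_le_trans)
  have c: "0 < c" using B by (simp add: c_def)
  have c1: "c \<le> 1" 
  proof -
    have "1 * 1 \<le> B ^ 2 * (B + 1)" using B by (intro mult_mono) auto
    then show ?thesis by (simp add: c_def)
  qed
  define x where "x = X 0"
  have x: "1 < x" "x \<le> B" using gt1 le by (auto simp: x_def)
  have al: "\<alpha> = of_int \<lfloor>\<alpha>\<rfloor> + 1 / x" using frp[of 0] by (simp add: x_def X_def frac_def)
  \<comment> \<open>The 2 pays for q + p' \<le> 2 q, and B pays for |p' x - q| = x |q \<alpha> - p|
    \<le> B |q \<alpha> - p|.\<close>
  define d where "d = c / (2 * B)"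
  have main: "d / of_int q \<le> \<bar>of_int q * \<alpha> - of_int p\<bar>" if q: "1 \<le> q" for q p :: int
  proof -
    define p' where "p' = p - \<lfloor>\<alpha>\<rfloor> * q"
    have qx: "of_int q * \<alpha> - of_int p = of_int q / x - of_int p'"
      by (subst al) (simp add: p'_def algebra_simps)
    have d1: "d / of_int q \<le> d"
      using q c B by (simp add: d_def divide_simps)
    have dB: "d \<le> 1 / B" using c1 c B by (simp add: d_def divide_simps)
    have B1: "1 / B \<le> 1" using B by simp
    consider "p' \<le> 0" | "q < p'" | "1 \<le> p'" "p' \<le> q" by linarith
    then show ?thesis
    proof cases
      case 1
      have "1 / B \<le> of_int q / x" using x q B by (intro frac_le) auto
      moreover have "(of_int p' :: real) \<le> 0" using 1 by simp
      ultimately show ?thesis unfolding qx using d1 dB by linarith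
    next
      case 2
      have "of_int q / x \<le> of_int q" using x q by (simp add: divide_simps)
      moreover have "of_int q + 1 \<le> (of_int p' :: real)" using 2 by linarith
      ultimately show ?thesis unfolding qx using d1 dB B1 by linarith
    next
      case 3
      have "c * (x - (-1)) \<le> \<bar>of_int p' * x - of_int q\<bar> * (of_int q - of_int p' * (-1))"
        using indefinite_form_lower_bound[of X B q p' "-1" 0] gt1 le rec fr q 3
        by (simp add: c_def x_def)
      also have "\<dots> \<le> \<bar>of_int p' * x - of_int q\<bar> * (2 * of_int q)"
        using 3 by (intro mult_left_mono) auto
      finally have *: "c * (x + 1) \<le> \<bar>of_int p' * x - of_int q\<bar> * (2 * of_int q)" by simp
      have e: "\<bar>of_int p' * x - of_int q\<bar> = x * \<bar>of_int q * \<alpha> - of_int p\<bar>"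
      proof -
        have "of_int p' * x - of_int q = - x * (of_int q * \<alpha> - of_int p)"
          unfolding qx using x by (simp add: algebra_simps)
        then show ?thesis using x by (simp add: abs_mult)
      qed
      have "c * 1 \<le> c * (x + 1)" using c x by (intro mult_left_mono) auto
      also note *
      also have "\<bar>of_int p' * x - of_int q\<bar> * (2 * of_int q) \<le> B * \<bar>of_int q * \<alpha> - of_int p\<bar> * (2 * of_int q)"
        unfolding e using x q by (intro mult_right_mono) auto
      finally show ?thesis using B q by (simp add: d_def field_simps)
    qed
  qed
  show ?thesis
    by (rule that[of d]) (use main c B in \<open>auto simp: d_def\<close>)
qed


section \<open>Birkhoff sums of the sawtooth: uniform bounds and jumps\<close>

definition birkhoff :: "real \<Rightarrow> nat \<Rightarrow> real \<Rightarrow> real" where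
  "birkhoff \<alpha> n x = (\<Sum>i<n. frac (x + real i * \<alpha>) - 1 / 2)"

lemma birkhoff_0 [simp]: "birkhoff \<alpha> 0 x = 0"
  by (simp add: birkhoff_def)

lemma birkhoff_add: "birkhoff \<alpha> (m + n) x = birkhoff \<alpha> m x + birkhoff \<alpha> n (x + real m * \<alpha>)"
proof (induction n)
  case (Suc n)
  then show ?case by (simp add: birkhoff_def algebra_simps)
qed (simp add: birkhoff_def)

lemma frac_cong_int: "x - y \<in> \<int> \<Longrightarrow> frac x = frac (y::real)"
  by (metis add.commute diff_add_cancel frac_add_int_right)

lemma birkhoff_cong_int:
  assumes "x - y \<in> \<int>" shows "birkhoff \<alpha> n x = birkhoff \<alpha> n y"
  unfolding birkhoff_def
  by (intro sum.cong refl arg_cong2[where f="(-)"] frac_cong_int) (use assms in simp)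

lemma birkhoff_measurable [measurable]: "birkhoff \<alpha> n \<in> borel_measurable borel"
  unfolding birkhoff_def frac_def by measurable

text \<open>For the rational rotation by p/q the q orbit points are equally spaced and the sum is
  exactly \<theta> - 1/2. Passing to \<alpha> moves each point by less than 1/q: the total drift is
  at most 1, and at most two points wrap around an integer. This gives 2 + 1 + 1/2, rounded up to
  4.\<close>

lemma Denjoy_Koksma_sawtooth:
  fixes p :: int and q :: nat
  assumes cop: "coprime p (int q)" and q: "0 < q" and close: "\<bar>real q * \<alpha> - of_int p\<bar> \<le> 1 / real q"
  shows "\<bar>birkhoff \<alpha> q x\<bar> \<le> 4"
proof -
  define \<theta> where "\<theta> = frac (real q * x)"
  define a where "a i = x + real i * of_int p / real q" for i :: nat
  define e where "e i = real i * (\<alpha> - of_int p / real q)" for i :: nat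
  \<comment> \<open>The points \<open>a i\<close> are equally spaced modulo 1, and \<open>l\<close> enumerates them in order.\<close>
  define l where "l i = \<lfloor>real q * frac (a i)\<rfloor>" for i
  have fa: "real q * frac (a i) = \<theta> + of_int (l i)" for i
  proof -
    have "real q * frac (a i) = real q * x + of_int (int i * p - int q * \<lfloor>a i\<rfloor>)"
      using q by (simp add: frac_def a_def algebra_simps)
    then have "frac (real q * frac (a i)) = \<theta>"
      unfolding \<theta>_def by (metis frac_add_of_int_right)
    then show ?thesis unfolding l_def frac_def by linarith
  qed
  have lr: "l i \<in> {0..<int q}" for i
  proof -
    have "real q * frac (a i) < real q * 1" using q frac_lt_1 by (intro mult_strict_left_mono) auto
    moreover have "0 \<le> real q * frac (a i)" by (simp add: frac_ge_0)
    ultimately show ?thesis by (simp add: l_def floor_less_iff)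
  qed
  have inj: "inj_on l {..<q}"
  proof (rule inj_onI)
    fix i j assume ij: "i \<in> {..<q}" "j \<in> {..<q}" "l i = l j"
    then have "real q * frac (a i) = real q * frac (a j)" by (simp only: fa)
    then have "frac (a i) = frac (a j)" using q by simp
    then have "a i - a j = of_int (\<lfloor>a i\<rfloor> - \<lfloor>a j\<rfloor>)" by (simp add: frac_def)
    then obtain z where "a i - a j = of_int z" by blast
    then have "(real i - real j) * of_int p / real q = of_int z"
      by (simp add: a_def diff_divide_distrib left_diff_distrib)
    then have "of_int ((int i - int j) * p) = (of_int (z * int q) :: real)"
      using q by (simp add: divide_eq_eq)
    then have "(int i - int j) * p = z * int q" by (simp only: of_int_eq_iff)
    then have "int q dvd (int i - int j) * p" by simp
    then have dvd: "int q dvd int i - int j" using cop by (simp add: coprime_commute coprime_dvd_mult_left_iff)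
    have "\<bar>int i - int j\<bar> < int q" using ij by auto
    then show "i = j" using dvd_imp_le_int[OF _ dvd] by auto
  qed
  have img: "l ` {..<q} = {0..<int q}"
    by (intro card_subset_eq) (use lr inj in \<open>auto simp: card_image\<close>)
  have suml: "(\<Sum>i<q. f (l i)) = (\<Sum>k\<in>{0..<int q}. f k)" for f :: "int \<Rightarrow> real"
    using sum.reindex[OF inj, of f] img by simp
  have sumk: "(\<Sum>k\<in>{0..<int q}. (of_int k :: real)) = real q * (real q - 1) / 2"
  proof -
    have "(\<Sum>k\<in>{0..<int q}. (of_int k :: real)) = (\<Sum>k\<in>{0..<q}. real k)"
      by (subst image_int_atLeastLessThan[of 0 q, simplified, symmetric], subst sum.reindex) auto
    also have "\<dots> = real q * (real q - 1) / 2"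
      by (induction q) (auto simp: field_simps)
    finally show ?thesis .
  qed
  have S1: "(\<Sum>i<q. frac (a i)) = \<theta> + (real q - 1) / 2"
  proof -
    have "real q * (\<Sum>i<q. frac (a i)) = (\<Sum>i<q. \<theta> + of_int (l i))"
      by (simp add: sum_distrib_left fa)
    also have "\<dots> = real q * \<theta> + real q * (real q - 1) / 2"
      by (simp add: sum.distrib suml[of of_int] sumk)
    also have "\<dots> = real q * (\<theta> + (real q - 1) / 2)" by (simp add: algebra_simps)
    finally show ?thesis using q by (simp only: mult_cancel_left) simp
  qed
  have ee: "\<bar>e i\<bar> < 1 / real q" if "i < q" for i
  proof -
    have "\<bar>\<alpha> - of_int p / real q\<bar> = \<bar>real q * \<alpha> - of_int p\<bar> / real q"
    proof -
      have "\<alpha> - of_int p / real q = (real q * \<alpha> - of_int p) / real q"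
        using q by (simp add: field_simps)
      then show ?thesis using q by (simp add: abs_divide)
    qed
    also have "\<dots> \<le> 1 / real q / real q" using close by (intro divide_right_mono) auto
    finally have "\<bar>e i\<bar> \<le> real i * (1 / real q / real q)"
      unfolding e_def abs_mult abs_of_nat by (rule mult_left_mono) simp
    also have "\<dots> < real q * (1 / real q / real q)"
      using that q by (intro mult_strict_right_mono) auto
    finally show ?thesis using q by simp
  qed
  \<comment> \<open>A displacement below 1/q can carry a point across an integer only from the first
    or the last of the q cells. The two indicators are added, so the total is 2 even for q = 1,
    where both cells coincide.\<close>
  define w where "w k = (if k = 0 then 1 else 0) + (if k = int q - 1 then 1 else (0::real))" for k
  have wrap: "\<bar>frac (a i + e i) - frac (a i) - e i\<bar> \<le> w (l i)" if i: "i < q" for i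
  proof -
    define u where "u = frac (a i)"
    have u: "0 \<le> u" "u < 1" by (auto simp: u_def frac_ge_0 frac_lt_1)
    have e1: "1 / real q \<le> 1" using q by simp
    have ei: "\<bar>e i\<bar> < 1 / real q" using ee[OF i] .
    have fu: "frac (a i + e i) = frac (u + e i)"
      by (rule frac_cong_int) (simp add: u_def frac_def)
    have lu: "l i = \<lfloor>real q * u\<rfloor>" by (simp add: l_def u_def)
    consider "u + e i < 0" | "0 \<le> u + e i" "u + e i < 1" | "1 \<le> u + e i" by linarith
    then show ?thesis
    proof cases
      case 1
      have "frac (u + e i) = u + e i + 1"
        using 1 u ei e1 by (subst frac_unique_iff) auto
      moreover have "u < 1 / real q" using 1 ei by linarith
      then have "real q * u < 1" using q by (simp add: field_simps)
      then have "l i = 0" using u unfolding lu by (simp add: floor_eq_iff)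
      ultimately show ?thesis by (simp add: fu w_def flip: u_def)
    next
      case 2
      then have "frac (u + e i) = u + e i" by (simp add: frac_eq)
      then show ?thesis by (simp add: fu w_def flip: u_def)
    next
      case 3
      have "frac (u + e i) = u + e i - 1"
        using 3 u ei e1 by (subst frac_unique_iff) auto
      moreover have "1 - 1 / real q < u" using 3 ei by linarith
      then have "real q - 1 < real q * u" using q by (simp add: field_simps)
      moreover have "real q * u < real q" using u q by simp
      ultimately have "l i = int q - 1" unfolding lu by (subst floor_eq_iff) auto
      then show ?thesis using \<open>frac (u + e i) = u + e i - 1\<close> by (simp add: fu w_def flip: u_def)
    qed
  qed
  have x: "x + real i * \<alpha> = a i + e i" for i
    using q by (simp add: a_def e_def field_simps)
  have "birkhoff \<alpha> q x = (\<Sum>i<q. (frac (a i + e i) - frac (a i) - e i) + frac (a i) + e i - 1 / 2)"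
    unfolding birkhoff_def x by simp
  also have "\<dots> = (\<Sum>i<q. frac (a i + e i) - frac (a i) - e i) + (\<theta> + (real q - 1) / 2) + (\<Sum>i<q. e i) - real q / 2"
    by (simp only: sum.distrib sum_subtractf S1) simp
  finally have eq: "birkhoff \<alpha> q x = (\<Sum>i<q. frac (a i + e i) - frac (a i) - e i) + (\<Sum>i<q. e i) + (\<theta> - 1 / 2)"
    by (simp add: field_simps)
  have "\<bar>\<Sum>i<q. frac (a i + e i) - frac (a i) - e i\<bar> \<le> (\<Sum>i<q. w (l i))"
    by (rule order.trans[OF sum_abs]) (auto intro!: sum_mono wrap)
  also have "\<dots> = (\<Sum>k\<in>{0..<int q}. w k)" by (rule suml)
  also have "\<dots> = 2" using q by (simp add: w_def sum.distrib)
  finally have 1: "\<bar>\<Sum>i<q. frac (a i + e i) - frac (a i) - e i\<bar> \<le> 2" .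
  have "\<bar>\<Sum>i<q. e i\<bar> \<le> (\<Sum>i<q. \<bar>e i\<bar>)" by (rule sum_abs)
  also have "\<dots> \<le> (\<Sum>i<q. 1 / real q)" by (intro sum_mono less_imp_le ee) simp
  also have "\<dots> = 1" using q by simp
  finally have 2: "\<bar>\<Sum>i<q. e i\<bar> \<le> 1" .
  have "0 \<le> \<theta>" "\<theta> < 1" by (auto simp: \<theta>_def frac_ge_0 frac_lt_1)
  then show ?thesis unfolding eq using 1 2 by (auto simp: abs_le_iff)
qed

lemma birkhoff_mult_bound:
  assumes "\<And>x. \<bar>birkhoff \<alpha> q x\<bar> \<le> C"
  shows "\<bar>birkhoff \<alpha> (r * q) x\<bar> \<le> real r * C"
proof (induction r arbitrary: x)
  case (Suc r)
  have "birkhoff \<alpha> (Suc r * q) x = birkhoff \<alpha> q x + birkhoff \<alpha> (r * q) (x + real q * \<alpha>)"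
    by (simp add: birkhoff_add)
  then show ?case using assms[of x] Suc[of "x + real q * \<alpha>"] by (simp add: algebra_simps)
qed simp

text \<open>The sawtooth has slope 1 and drops by 1 at the integers, so each summand gains d and
  loses 1 exactly when its point passes an integer. The change is thus an explicit number minus a
  count, with no error term.\<close>

lemma birkhoff_shift:
  assumes d: "0 \<le> d" "d < 1"
  shows "birkhoff \<alpha> n (x + d) - birkhoff \<alpha> n x
    = real n * d - real (card {i. i < n \<and> 1 - d \<le> frac (x + real i * \<alpha>)})"
proof -
  have *: "frac (y + d) - frac y = d - (if 1 - d \<le> frac y then 1 else 0)" for y
  proof -
    have "frac (y + d) = frac (frac y + d)"
      by (rule frac_cong_int) (simp add: frac_def)
    also have "\<dots> = frac y + d - (if 1 - d \<le> frac y then 1 else 0)"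
      using d frac_ge_0[of y] frac_lt_1[of y] by (subst frac_unique_iff) auto
    finally show ?thesis by simp
  qed
  have "birkhoff \<alpha> n (x + d) - birkhoff \<alpha> n x
      = (\<Sum>i<n. frac ((x + real i * \<alpha>) + d) - frac (x + real i * \<alpha>))"
    unfolding birkhoff_def by (simp add: sum_subtractf[symmetric] algebra_simps)
  also have "\<dots> = real n * d - (\<Sum>i<n. if 1 - d \<le> frac (x + real i * \<alpha>) then 1 else 0)"
    by (simp add: * sum_subtractf)
  also have "(\<Sum>i<n. if 1 - d \<le> frac (x + real i * \<alpha>) then 1 else (0::real))
      = real (card {i. i < n \<and> 1 - d \<le> frac (x + real i * \<alpha>)})"
    by (simp add: sum.If_cases Int_def)
  finally show ?thesis .
qed

text \<open>Two visits to an arc of length d at times i < j would bring (j - i) \<alpha> closer than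
  d to an integer, although bad approximability keeps it at distance c / (j - i) \<ge> c /
  n.\<close>

lemma badly_approximable_single_visit:
  fixes n :: nat
  assumes bad: "\<And>(q::int) p::int. 1 \<le> q \<Longrightarrow> c / of_int q \<le> \<bar>of_int q * \<alpha> - of_int p\<bar>"
    and c: "0 < c" and d: "d \<le> c / real n"
    and i: "i < n" "1 - d \<le> frac (x + real i * \<alpha>)" and j: "j < n" "1 - d \<le> frac (x + real j * \<alpha>)"
  shows "i = j"
proof -
  have *: False if "i < j" "i < n" "1 - d \<le> frac (x + real i * \<alpha>)" "j < n" "1 - d \<le> frac (x + real j * \<alpha>)" for i j
  proof -
    define p where "p = \<lfloor>x + real j * \<alpha>\<rfloor> - \<lfloor>x + real i * \<alpha>\<rfloor>"
    have "of_int (int j - int i) * \<alpha> - of_int p = frac (x + real j * \<alpha>) - frac (x + real i * \<alpha>)"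
      by (simp add: p_def frac_def algebra_simps)
    moreover have "\<bar>frac (x + real j * \<alpha>) - frac (x + real i * \<alpha>)\<bar> < d"
      using that frac_lt_1[of "x + real i * \<alpha>"] frac_lt_1[of "x + real j * \<alpha>"] by linarith
    moreover have "c / of_int (int j - int i) \<le> \<bar>of_int (int j - int i) * \<alpha> - of_int p\<bar>"
      using that by (intro bad) auto
    moreover have "c / real n \<le> c / of_int (int j - int i)"
      using that c by (intro divide_left_mono) auto
    ultimately show False using d by linarith
  qed
  show ?thesis using *[of i j] *[of j i] i j by (meson linorder_neqE_nat)
qed

lemma large_coprime_approximants:
  assumes "\<alpha> \<notin> \<rat>"
  obtains p :: int and q :: nat
  where "n < q" "coprime p (int q)" "\<bar>real q * \<alpha> - of_int p\<bar> \<le> 1 / real q"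
proof -
  have "infinite (approx_set \<alpha>)" using assms rational_iff_finite_approx_set by blast
  then obtain h k where hk: "(h, k) \<in> approx_set \<alpha>" "k > int n"
    using infinite_approx_set by blast
  then have k: "k > 0" "coprime h k" "\<bar>\<alpha> - of_int h / of_int k\<bar> < 1 / (of_int k)\<^sup>2"
    by (auto simp: approx_set_def)
  have "\<bar>of_int k * \<alpha> - of_int h\<bar> = of_int k * \<bar>\<alpha> - of_int h / of_int k\<bar>"
    using k(1) by (simp add: abs_mult_pos' right_diff_distrib)
  also have "\<dots> \<le> of_int k * (1 / (of_int k)\<^sup>2)" using k by (intro mult_left_mono) auto
  also have "\<dots> = 1 / of_int k" using k by (simp add: power2_eq_square)
  finally have "\<bar>of_int k * \<alpha> - of_int h\<bar> \<le> 1 / of_int k" .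
  then show ?thesis using that[of "nat k" h] k hk by simp
qed

section \<open>Invariant and almost invariant measures\<close>

lemma distr_funpow:
  assumes T: "T \<in> measurable M M" and inv: "distr M M T = M"
  shows "T ^^ n \<in> measurable M M" "distr M M (T ^^ n) = M"
proof -
  show m: "T ^^ n \<in> measurable M M" for n
    by (induction n) (use T in \<open>auto intro: measurable_comp simp: id_def\<close>)
  show "distr M M (T ^^ n) = M"
  proof (induction n)
    case 0
    then show ?case by (simp add: id_def distr_id2)
  next
    case (Suc n)
    have "distr M M (T ^^ Suc n) = distr (distr M M (T ^^ n)) M T"
      by (simp add: distr_distr[OF T m])
    then show ?case by (simp only: Suc inv)
  qed
qed

lemma measure_vimage_invariant:
  assumes T: "T \<in> measurable M M" and inv: "distr M M T = M" and B: "B \<in> sets M"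
  shows "measure M (T -` B \<inter> space M) = measure M B"
  using measure_distr[OF T B] inv by simp

text \<open>The positive set of a Hahn decomposition of M - N maximizes M - N, and by invariance so
  do its preimages under T, but it is invariant only up to null sets. Exact invariance is required
  because ergodicity is tested on exactly invariant sets; passing to the limes superior of the
  preimages achieves it.\<close>

lemma distinct_invariant_measures_invariant_set:
  assumes fM: "finite_measure M" and fN: "finite_measure N" and s: "sets N = sets M"
    and T: "T \<in> measurable M M" and iM: "distr M M T = M" and iN: "distr N N T = N"
    and mass: "measure M (space M) = measure N (space M)" and ne: "M \<noteq> N"
  obtains P where "P \<in> sets M" "T -` P \<inter> space M = P" "measure N P < measure M P"
proof -
  interpret M: finite_measure M by fact
  interpret N: finite_measure N by fact
  note [simp] = s
  have sp: "space N = space M" using s by (rule sets_eq_imp_space_eq)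
  have TN: "T \<in> measurable N N" using T by (simp add: measurable_def sp)
  define d where "d X = measure M X - measure N X" for X
  obtain Y where Y: "Y \<in> sets M"
    and Hahn: "(\<forall>X\<in>sets M. X \<subseteq> Y \<longrightarrow> emeasure N X \<le> emeasure M X) \<and>
      (\<forall>X\<in>sets M. X \<inter> Y = {} \<longrightarrow> emeasure M X \<le> emeasure N X)"
    by (rule bexE[OF finite_unsigned_Hahn_decomposition[OF fM fN s]])
  have Y1: "emeasure N X \<le> emeasure M X" if "X \<in> sets M" "X \<subseteq> Y" for X using Hahn that by simp
  have Y2: "emeasure M X \<le> emeasure N X" if "X \<in> sets M" "X \<inter> Y = {}" for X using Hahn that by simp
  have dadd: "d (A \<union> B) + d (A \<inter> B) = d A + d B" if "A \<in> sets M" "B \<in> sets M" for A B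
    using M.finite_measure_Union'[of A B] M.finite_measure_Diff'[of B A]
      N.finite_measure_Union'[of A B] N.finite_measure_Diff'[of B A] that
    by (simp add: d_def Int_commute)
  have pos: "0 \<le> d X" if "X \<in> sets M" "X \<subseteq> Y" for X
    using Y1[OF that] that by (simp add: d_def M.emeasure_eq_measure N.emeasure_eq_measure)
  have neg: "d X \<le> 0" if "X \<in> sets M" "X \<inter> Y = {}" for X
    using Y2[OF that] that by (simp add: d_def M.emeasure_eq_measure N.emeasure_eq_measure)
  have d0: "d {} = 0" by (simp add: d_def)
  have max: "d X \<le> d Y" if X: "X \<in> sets M" for X
  proof -
    have "d (X \<inter> Y \<union> (X - Y)) + d ((X \<inter> Y) \<inter> (X - Y)) = d (X \<inter> Y) + d (X - Y)"
      using X Y by (intro dadd) auto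
    moreover have "X \<inter> Y \<union> (X - Y) = X" "(X \<inter> Y) \<inter> (X - Y) = {}" by auto
    moreover have "d (X - Y) \<le> 0" using X Y by (intro neg) auto
    moreover have "d ((X \<inter> Y) \<union> (Y - X)) + d ((X \<inter> Y) \<inter> (Y - X)) = d (X \<inter> Y) + d (Y - X)"
      using X Y by (intro dadd) auto
    moreover have "(X \<inter> Y) \<union> (Y - X) = Y" "(X \<inter> Y) \<inter> (Y - X) = {}" by auto
    moreover have "0 \<le> d (Y - X)" using X Y by (intro pos) auto
    ultimately show ?thesis using d0 by simp
  qed
  \<comment> \<open>Equal total masses make d of a complement the negative of d, so a maximum \<le>
    0 would force d = 0 everywhere and thus M = N.\<close>
  have dY: "0 < d Y"
  proof (rule ccontr)
    assume n: "\<not> 0 < d Y"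
    have le: "d X \<le> 0" if "X \<in> sets M" for X using max[OF that] n by linarith
    have "d X = 0" if X: "X \<in> sets M" for X
    proof -
      have "d (space M - X) = - d X"
        using X mass by (simp add: d_def M.finite_measure_compl N.finite_measure_compl[unfolded sp])
      then show ?thesis using le[OF X] le[of "space M - X"] X by auto
    qed
    then have "M = N"
      by (intro measure_eqI) (auto simp: d_def M.emeasure_eq_measure N.emeasure_eq_measure)
    with ne show False by simp
  qed
  \<comment> \<open>Sets maximizing \<open>d\<close> are closed under union and intersection, so the limes superior of the preimages of \<open>Y\<close> is one.\<close>
  define Z where "Z k = (T ^^ k) -` Y \<inter> space M" for k
  have Zs [measurable]: "Z k \<in> sets M" for k
    unfolding Z_def using distr_funpow(1)[OF T iM] Y by (rule measurable_sets)
  have dZ: "d (Z k) = d Y" for k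
    unfolding d_def Z_def
    using measure_vimage_invariant[OF distr_funpow[OF T iM], of Y k]
      measure_vimage_invariant[OF distr_funpow[OF TN iN], of Y k] Y by (simp add: sp)
  have un: "d (A \<union> B) = d Y" "d (A \<inter> B) = d Y" if "A \<in> sets M" "B \<in> sets M" "d A = d Y" "d B = d Y" for A B
    using dadd[of A B] max[of "A \<union> B"] max[of "A \<inter> B"] that by auto
  define U where "U n = (\<Union>k\<in>{n..}. Z k)" for n
  have Us [measurable]: "U n \<in> sets M" for n unfolding U_def by measurable
  have dU: "d (U n) = d Y" for n
  proof -
    define W where "W j = (\<Union>k\<in>{n..n+j}. Z k)" for j
    have Ws: "W j \<in> sets M" for j unfolding W_def by measurable
    have dW: "d (W j) = d Y" for j
    proof (induction j)
      case (Suc j)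
      have "W (Suc j) = W j \<union> Z (n + Suc j)"
        by (auto simp: W_def atLeastAtMostSuc_conv)
      then show ?case using un(1)[OF Ws Zs Suc dZ] by simp
    qed (simp add: W_def dZ)
    have inc: "incseq W" unfolding incseq_def W_def by (intro allI impI UN_mono) auto
    have UW: "(\<Union>j. W j) = U n"
    proof -
      have "z \<in> (\<Union>j. W j)" if "k \<ge> n" "z \<in> Z k" for z k
        using that by (auto simp: W_def intro!: exI[of _ "k - n"] bexI[of _ k])
      then show ?thesis by (auto simp: U_def W_def)
    qed
    have "(\<lambda>j. d (W j)) \<longlonglongrightarrow> d (U n)"
      unfolding d_def UW[symmetric] using inc Ws
      by (intro tendsto_diff M.finite_Lim_measure_incseq N.finite_Lim_measure_incseq) auto
    then show ?thesis using dW by (simp add: LIMSEQ_const_iff)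
  qed
  define P where "P = (\<Inter>n. U n)"
  have dec: "decseq U" unfolding decseq_def U_def by (intro allI impI UN_mono) auto
  have Ps: "P \<in> sets M" unfolding P_def by measurable
  have "(\<lambda>n. d (U n)) \<longlonglongrightarrow> d P"
    unfolding d_def P_def using dec Us
    by (intro tendsto_diff M.finite_Lim_measure_decseq N.finite_Lim_measure_decseq) auto
  then have dP: "d P = d Y" using dU by (simp add: LIMSEQ_const_iff)
  have TZ: "T -` Z k \<inter> space M = Z (Suc k)" for k
    using measurable_space[OF T] by (auto simp: Z_def funpow_Suc_right simp del: funpow.simps)
  have TU: "T -` U n \<inter> space M = U (Suc n)" for n
  proof -
    have "T -` U n \<inter> space M = (\<Union>k\<in>{n..}. Z (Suc k))"
      using TZ by (auto simp: U_def)
    also have "\<dots> = U (Suc n)"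
    proof -
      have "{Suc n..} = Suc ` {n..}"
      proof -
        have "x \<in> Suc ` {n..}" if "Suc n \<le> x" for x using that by (cases x) auto
        then show ?thesis by auto
      qed
      then show ?thesis by (simp add: U_def)
    qed
    finally show ?thesis .
  qed
  have "T -` P \<inter> space M = (\<Inter>n. T -` U n \<inter> space M)"
    by (auto simp: P_def)
  also have "\<dots> = (\<Inter>n. U (Suc n))" by (simp add: TU)
  also have "\<dots> = P" using dec unfolding P_def by (fastforce simp: decseq_Suc_iff)
  finally have "T -` P \<inter> space M = P" .
  then show ?thesis using that[OF Ps] dP dY by (auto simp: d_def)
qed

text \<open>The sets whose mismatch tends to 0 form a sigma-algebra. The only delicate case is a
  countable union: its tail R contributes at most the measures of R and of its preimage, which are
  equal because the maps preserve the measure, so the tail is small uniformly in n.\<close>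

lemma mismatch_tendsto_0_sigma:
  fixes \<rho> :: "'a measure"
  assumes "finite_measure \<rho>" and \<sigma>: "\<And>n::nat. \<sigma> n \<in> measurable \<rho> \<rho>" and inv: "\<And>n. distr \<rho> \<rho> (\<sigma> n) = \<rho>"
    and gen: "sets \<rho> = sigma_sets (space \<rho>) G"
    and G: "\<And>B. B \<in> G \<Longrightarrow> (\<lambda>n. measure \<rho> {x \<in> space \<rho>. (\<sigma> n x \<in> B) \<noteq> (x \<in> B)}) \<longlonglongrightarrow> 0"
    and B: "B \<in> sets \<rho>"
  shows "(\<lambda>n. measure \<rho> {x \<in> space \<rho>. (\<sigma> n x \<in> B) \<noteq> (x \<in> B)}) \<longlonglongrightarrow> 0"
proof -
  interpret finite_measure \<rho> by fact
  note [measurable] = \<sigma>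
  from B[unfolded gen] show ?thesis
  proof (induction rule: sigma_sets.induct)
    case (Basic B)
    then show ?case by (rule G)
  next
    case Empty
    then show ?case by simp
  next
    case (Compl B)
    have "{x \<in> space \<rho>. (\<sigma> n x \<in> space \<rho> - B) \<noteq> (x \<in> space \<rho> - B)} = {x \<in> space \<rho>. (\<sigma> n x \<in> B) \<noteq> (x \<in> B)}" for n
      using measurable_space[OF \<sigma>[of n]] by auto
    then show ?case using Compl by simp
  next
    case (Union A)
    have As [measurable]: "A i \<in> sets \<rho>" for i using Union(1) by (simp add: gen)
    show ?case
    proof (rule LIMSEQ_I)
      fix e :: real assume e: "0 < e"
      define C where "C k = (\<Union>i<k. A i)" for k
      have Cs [measurable]: "C k \<in> sets \<rho>" for k unfolding C_def by measurable
      have UC: "(\<Union>k. C k) = (\<Union>i. A i)" unfolding C_def by (metis UN_UN_flatten UN_lessThan_UNIV)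
      have "(\<lambda>k. measure \<rho> (C k)) \<longlonglongrightarrow> measure \<rho> (\<Union>k. C k)"
        by (intro finite_Lim_measure_incseq) (auto simp: incseq_def C_def intro: less_le_trans)
      then have "eventually (\<lambda>k. measure \<rho> (\<Union>i. A i) - e / 4 < measure \<rho> (C k)) sequentially"
        unfolding UC using e by (intro order_tendstoD) auto
      then obtain k where k: "measure \<rho> (\<Union>i. A i) - e / 4 < measure \<rho> (C k)"
        by (auto simp: eventually_sequentially)
      define R where "R = (\<Union>i. A i) - C k"
      have Rs [measurable]: "R \<in> sets \<rho>" unfolding R_def by measurable
      have "measure \<rho> R = measure \<rho> (\<Union>i. A i) - measure \<rho> (C k)"
        unfolding R_def by (intro finite_measure_Diff) (auto simp: C_def)
      then have R: "measure \<rho> R < e / 4" using k by linarith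
      let ?D = "\<lambda>n B. {x \<in> space \<rho>. (\<sigma> n x \<in> B) \<noteq> (x \<in> B)}"
      have Dm [measurable]: "?D n B \<in> sets \<rho>" if [measurable]: "B \<in> sets \<rho>" for n B by measurable
      have bound: "measure \<rho> (?D n (\<Union>i. A i)) \<le> (\<Sum>i<k. measure \<rho> (?D n (A i))) + e / 2" for n
      proof -
        have "?D n (\<Union>i. A i) \<subseteq> (\<Union>i<k. ?D n (A i)) \<union> (R \<union> (\<sigma> n -` R \<inter> space \<rho>))"
          by (auto simp: R_def C_def)
        then have "measure \<rho> (?D n (\<Union>i. A i)) \<le> measure \<rho> ((\<Union>i<k. ?D n (A i)) \<union> (R \<union> (\<sigma> n -` R \<inter> space \<rho>)))"
          by (intro finite_measure_mono) measurable
        also have "\<dots> \<le> measure \<rho> (\<Union>i<k. ?D n (A i)) + measure \<rho> (R \<union> (\<sigma> n -` R \<inter> space \<rho>))"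
          by (intro measure_Un_le) measurable
        also have "measure \<rho> (R \<union> (\<sigma> n -` R \<inter> space \<rho>)) \<le> measure \<rho> R + measure \<rho> (\<sigma> n -` R \<inter> space \<rho>)"
          by (intro measure_Un_le) measurable
        also have "measure \<rho> (\<sigma> n -` R \<inter> space \<rho>) = measure \<rho> R"
          by (rule measure_vimage_invariant[OF \<sigma> inv Rs])
        also have "measure \<rho> (\<Union>i<k. ?D n (A i)) \<le> (\<Sum>i<k. measure \<rho> (?D n (A i)))"
          by (intro measure_UNION_le) auto
        finally show ?thesis using R by linarith
      qed
      have "(\<lambda>n. \<Sum>i<k. measure \<rho> (?D n (A i))) \<longlonglongrightarrow> (\<Sum>i<k. 0)"
        by (intro tendsto_sum Union)
      then have "eventually (\<lambda>n. (\<Sum>i<k. measure \<rho> (?D n (A i))) < e / 2) sequentially"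
        using e by (intro order_tendstoD(2)) auto
      then obtain n0 where "\<And>n. n \<ge> n0 \<Longrightarrow> (\<Sum>i<k. measure \<rho> (?D n (A i))) < e / 2"
        by (auto simp: eventually_sequentially)
      then have "\<forall>n\<ge>n0. norm (measure \<rho> (?D n (\<Union>i. A i)) - 0) < e"
        using bound by (fastforce simp: intro: le_less_trans)
      then show "\<exists>n0. \<forall>n\<ge>n0. norm (measure \<rho> (?D n (\<Union>i. A i)) - 0) < e" by blast
    qed
  qed
qed

text \<open>Composition with a measure preserving map is an L1 isometry. Strong convergence of these
  operators to the identity therefore passes from indicators to linear combinations and then to L1
  limits.\<close>

lemma L1_continuity_along_maps:
  fixes V :: "'a \<Rightarrow> real"
  assumes fin: "finite_measure \<rho>" and \<sigma>: "\<And>n::nat. \<sigma> n \<in> measurable \<rho> \<rho>" and inv: "\<And>n. distr \<rho> \<rho> (\<sigma> n) = \<rho>"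
    and D: "\<And>B. B \<in> sets \<rho> \<Longrightarrow> (\<lambda>n. measure \<rho> {x \<in> space \<rho>. (\<sigma> n x \<in> B) \<noteq> (x \<in> B)}) \<longlonglongrightarrow> 0"
    and V: "integrable \<rho> V"
  shows "(\<lambda>n. \<integral>x. \<bar>V (\<sigma> n x) - V x\<bar> \<partial>\<rho>) \<longlonglongrightarrow> 0"
proof -
  interpret finite_measure \<rho> by fact
  note [measurable] = \<sigma>
  have comp: "integrable \<rho> (\<lambda>x. f (\<sigma> n x))" "(\<integral>x. f (\<sigma> n x) \<partial>\<rho>) = (\<integral>x. f x \<partial>\<rho>)"
    if f: "integrable \<rho> f" for f :: "'a \<Rightarrow> real" and n
    using integrable_distr[OF \<sigma>, of n f] integral_distr[OF \<sigma>, of f n] f inv[of n]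
    by auto
  show ?thesis using V
  proof (induction rule: integrable_induct)
    case (base A c)
    have "(\<integral>x. \<bar>indicator A (\<sigma> n x) *\<^sub>R c - indicator A x *\<^sub>R c\<bar> \<partial>\<rho>) = \<bar>c\<bar> * measure \<rho> {x \<in> space \<rho>. (\<sigma> n x \<in> A) \<noteq> (x \<in> A)}" for n
    proof -
      have [measurable]: "A \<in> sets \<rho>" by fact
      have "(\<integral>x. \<bar>indicator A (\<sigma> n x) *\<^sub>R c - indicator A x *\<^sub>R c\<bar> \<partial>\<rho>)
          = (\<integral>x. \<bar>c\<bar> * indicator {x \<in> space \<rho>. (\<sigma> n x \<in> A) \<noteq> (x \<in> A)} x \<partial>\<rho>)"
        by (intro Bochner_Integration.integral_cong) (auto split: split_indicator)
      then show ?thesis by simp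
    qed
    then show ?case using tendsto_mult_left[OF D[OF base(1)], of "\<bar>c\<bar>"] by simp
  next
    case (add f g)
    show ?case
    proof (rule tendsto_sandwich[OF _ _ tendsto_const])
      show "(\<lambda>n. (\<integral>x. \<bar>f (\<sigma> n x) - f x\<bar> \<partial>\<rho>) + (\<integral>x. \<bar>g (\<sigma> n x) - g x\<bar> \<partial>\<rho>)) \<longlonglongrightarrow> 0"
        using tendsto_add[OF add(3,4)] by simp
      show "\<forall>\<^sub>F n in sequentially. (\<integral>x. \<bar>f (\<sigma> n x) + g (\<sigma> n x) - (f x + g x)\<bar> \<partial>\<rho>)
          \<le> (\<integral>x. \<bar>f (\<sigma> n x) - f x\<bar> \<partial>\<rho>) + (\<integral>x. \<bar>g (\<sigma> n x) - g x\<bar> \<partial>\<rho>)"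
      proof (rule always_eventually, rule allI)
        fix n
        show "(\<integral>x. \<bar>f (\<sigma> n x) + g (\<sigma> n x) - (f x + g x)\<bar> \<partial>\<rho>)
          \<le> (\<integral>x. \<bar>f (\<sigma> n x) - f x\<bar> \<partial>\<rho>) + (\<integral>x. \<bar>g (\<sigma> n x) - g x\<bar> \<partial>\<rho>)"
        proof (subst Bochner_Integration.integral_add[symmetric])
          show "(\<integral>x. \<bar>f (\<sigma> n x) + g (\<sigma> n x) - (f x + g x)\<bar> \<partial>\<rho>)
            \<le> (\<integral>x. \<bar>f (\<sigma> n x) - f x\<bar> + \<bar>g (\<sigma> n x) - g x\<bar> \<partial>\<rho>)"
            using add(1,2) comp(1)[OF add(1), of n] comp(1)[OF add(2), of n]
            by (intro integral_mono) auto
        qed (use add(1,2) comp(1)[OF add(1), of n] comp(1)[OF add(2), of n] in auto)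
      qed
    qed (auto intro!: always_eventually)
  next
    case (lim f s)
    have [measurable]: "f \<in> borel_measurable \<rho>" "\<And>i. s i \<in> borel_measurable \<rho>" using lim by auto
    have "(\<lambda>i. \<integral>x. \<bar>s i x - f x\<bar> \<partial>\<rho>) \<longlonglongrightarrow> (\<integral>x. 0 \<partial>\<rho>)"
    proof (rule integral_dominated_convergence[where w="\<lambda>x. 3 * \<bar>f x\<bar>"])
      show "AE x in \<rho>. (\<lambda>i. \<bar>s i x - f x\<bar>) \<longlonglongrightarrow> 0"
        using lim by (intro AE_I2 tendsto_rabs_zero LIM_zero) blast
      show "AE x in \<rho>. norm \<bar>s i x - f x\<bar> \<le> 3 * \<bar>f x\<bar>" for i
      proof (intro AE_I2)
        fix x assume x: "x \<in> space \<rho>"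
        have "norm (s i x) \<le> 2 * norm (f x)" using lim x by blast
        then show "norm \<bar>s i x - f x\<bar> \<le> 3 * \<bar>f x\<bar>" by simp
      qed
    qed (use lim in auto)
    then have appr: "(\<lambda>i. \<integral>x. \<bar>s i x - f x\<bar> \<partial>\<rho>) \<longlonglongrightarrow> 0" by simp
    show ?case
    proof (rule LIMSEQ_I)
      fix e :: real assume e: "0 < e"
      obtain i where i: "(\<integral>x. \<bar>s i x - f x\<bar> \<partial>\<rho>) < e / 4"
        using order_tendstoD(2)[OF appr, of "e / 4"] e by (auto simp: eventually_sequentially)
      obtain n0 where n0: "\<And>n. n \<ge> n0 \<Longrightarrow> (\<integral>x. \<bar>s i (\<sigma> n x) - s i x\<bar> \<partial>\<rho>) < e / 2"
        using order_tendstoD(2)[OF lim(5)[of i], of "e / 2"] e by (auto simp: eventually_sequentially)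
      have "(\<integral>x. \<bar>f (\<sigma> n x) - f x\<bar> \<partial>\<rho>) < e" if n: "n \<ge> n0" for n
      proof -
        have I1: "integrable \<rho> (\<lambda>x. \<bar>s i x - f x\<bar>)" and If: "integrable \<rho> f" and Is: "integrable \<rho> (s i)"
          using lim by auto
        have "(\<integral>x. \<bar>f (\<sigma> n x) - f x\<bar> \<partial>\<rho>) \<le>
          (\<integral>x. \<bar>s i (\<sigma> n x) - f (\<sigma> n x)\<bar> + (\<bar>s i x - f x\<bar> + \<bar>s i (\<sigma> n x) - s i x\<bar>) \<partial>\<rho>)"
          using If Is comp(1)[OF If, of n] comp(1)[OF Is, of n] by (intro integral_mono) auto
        also have "\<dots> = (\<integral>x. \<bar>s i (\<sigma> n x) - f (\<sigma> n x)\<bar> \<partial>\<rho>) + ((\<integral>x. \<bar>s i x - f x\<bar> \<partial>\<rho>) + (\<integral>x. \<bar>s i (\<sigma> n x) - s i x\<bar> \<partial>\<rho>))"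
          using If Is comp(1)[OF If, of n] comp(1)[OF Is, of n] 
          by (subst Bochner_Integration.integral_add, simp, simp)+ simp
        also have "(\<integral>x. \<bar>s i (\<sigma> n x) - f (\<sigma> n x)\<bar> \<partial>\<rho>) = (\<integral>x. \<bar>s i x - f x\<bar> \<partial>\<rho>)"
          by (rule comp(2)[OF I1])
        finally show ?thesis using i n0[OF n] by linarith
      qed
      moreover have "0 \<le> (\<integral>x. \<bar>f (\<sigma> n x) - f x\<bar> \<partial>\<rho>)" for n by simp
      ultimately show "\<exists>n0. \<forall>n\<ge>n0. norm ((\<integral>x. \<bar>f (\<sigma> n x) - f x\<bar> \<partial>\<rho>) - 0) < e" by auto
    qed
  qed
qed

text \<open>V is the conditional expectation of F given \<pi>, obtained as the Radon-Nikodym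
  derivative of the image of the measure F K. It does the work of integrating F against the
  conditional measures on the fibres.\<close>

lemma conditional_density:
  fixes F :: "'a \<Rightarrow> real"
  assumes fin: "finite_measure K" and \<pi>: "\<pi> \<in> measurable K \<Omega>" and F: "F \<in> borel_measurable K"
    and b: "\<And>p. p \<in> space K \<Longrightarrow> 0 \<le> F p" "\<And>p. p \<in> space K \<Longrightarrow> F p \<le> 1"
  shows "\<exists>V. integrable (distr K \<Omega> \<pi>) V \<and>
    (\<forall>B\<in>sets \<Omega>. (\<integral>p. indicator B (\<pi> p) * F p \<partial>K) = (\<integral>x. indicator B x * V x \<partial>distr K \<Omega> \<pi>))"
proof -
  interpret K: finite_measure K by fact
  note [measurable] = \<pi> F
  define \<rho> where "\<rho> = distr K \<Omega> \<pi>"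
  define N where "N = distr (density K F) \<Omega> \<pi>"
  interpret \<rho>: finite_measure \<rho> unfolding \<rho>_def by (rule K.finite_measure_distr[OF \<pi>])
  have IF: "integrable K F"
    by (rule K.integrable_const_bound[where B=1]) (use b in auto)
  have \<pi>': "\<pi> \<in> measurable (density K F) \<Omega>" by simp
  have eN: "emeasure N B = ennreal (\<integral>p. indicator B (\<pi> p) * F p \<partial>K)" if [measurable]: "B \<in> sets \<Omega>" for B
  proof -
    have "emeasure N B = (\<integral>\<^sup>+p. ennreal (F p) * indicator (\<pi> -` B \<inter> space K) p \<partial>K)"
      unfolding N_def by (subst emeasure_distr[OF \<pi>' that]) (simp add: emeasure_density)
    also have "\<dots> = (\<integral>\<^sup>+p. ennreal (indicator B (\<pi> p) * F p) \<partial>K)"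
      by (intro nn_integral_cong) (auto split: split_indicator)
    also have "\<dots> = ennreal (\<integral>p. indicator B (\<pi> p) * F p \<partial>K)"
      using b by (intro nn_integral_eq_integral AE_I2 K.integrable_const_bound[where B=1])
        (auto split: split_indicator)
    finally show ?thesis .
  qed
  have fN: "finite_measure N"
  proof
    show "emeasure N (space N) \<noteq> \<infinity>"
      using eN[of "space \<Omega>"] by (simp add: N_def)
  qed
  have ac: "absolutely_continuous \<rho> N"
    unfolding absolutely_continuous_def
  proof
    fix B assume "B \<in> null_sets \<rho>"
    then have [measurable]: "B \<in> sets \<Omega>" and z: "emeasure K (\<pi> -` B \<inter> space K) = 0"
      by (auto simp: \<rho>_def null_sets_def emeasure_distr)
    have ae: "AE p in K. \<pi> p \<notin> B"
      by (rule AE_I[of _ _ "\<pi> -` B \<inter> space K"]) (use z in auto)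
    have "(\<integral>p. indicator B (\<pi> p) * F p \<partial>K) = (\<integral>p. 0 \<partial>K)"
      by (rule integral_cong_AE) (use ae in auto)
    then have "emeasure N B = 0" by (simp add: eN)
    then show "B \<in> null_sets N" by (simp add: null_sets_def N_def)
  qed
  have sN: "sets N = sets \<rho>" by (simp add: N_def \<rho>_def)
  obtain D where D: "D \<in> borel_measurable \<rho>" "AE x in \<rho>. RN_deriv \<rho> N x = ennreal (D x)"
      "AE x in N. 0 < D x" "\<And>x. 0 \<le> D x"
    using \<rho>.real_RN_deriv[OF fN ac sN] by blast
  note [measurable] = D(1)
  have dens: "density \<rho> D = N"
  proof -
    have "density \<rho> D = density \<rho> (RN_deriv \<rho> N)"
      using D(2) by (intro density_cong) auto
    also have "\<dots> = N" by (rule \<rho>.density_RN_deriv[OF ac sN])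
    finally show ?thesis .
  qed
  have nn: "(\<integral>\<^sup>+x. ennreal (indicator B x * D x) \<partial>\<rho>) = emeasure N B" if "B \<in> sets \<Omega>" for B
  proof -
    have [measurable]: "B \<in> sets \<rho>" using that by (simp add: \<rho>_def)
    have "emeasure N B = (\<integral>\<^sup>+x. ennreal (D x) * indicator B x \<partial>\<rho>)"
      unfolding dens[symmetric] by (simp add: emeasure_density)
    also have "\<dots> = (\<integral>\<^sup>+x. ennreal (indicator B x * D x) \<partial>\<rho>)"
      by (intro nn_integral_cong) (auto split: split_indicator)
    finally show ?thesis by simp
  qed
  show ?thesis
  proof (intro exI[of _ D] conjI ballI)
    have "(\<integral>\<^sup>+x. ennreal (D x) \<partial>\<rho>) = emeasure N (space \<Omega>)"
      unfolding nn[OF sets.top, symmetric] by (intro nn_integral_cong) (simp add: \<rho>_def)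
    also have "\<dots> < \<infinity>" using finite_measure.emeasure_finite[OF fN, of "space \<Omega>"] by (simp add: less_top)
    finally show "integrable (distr K \<Omega> \<pi>) D"
      unfolding \<rho>_def[symmetric] using D by (intro integrableI_nonneg) auto
    show "(\<integral>p. indicator B (\<pi> p) * F p \<partial>K) = (\<integral>x. indicator B x * D x \<partial>distr K \<Omega> \<pi>)" if "B \<in> sets \<Omega>" for B
    proof -
      have [measurable]: "B \<in> sets \<rho>" using that by (simp add: \<rho>_def)
      have "(\<integral>x. indicator B x * D x \<partial>\<rho>) = enn2real (emeasure N B)"
        unfolding nn[OF that, symmetric] using D(4) by (intro integral_eq_nn_integral) auto
      also have "\<dots> = (\<integral>p. indicator B (\<pi> p) * F p \<partial>K)"
        unfolding eN[OF that] using b by (intro enn2real_ennreal integral_nonneg_AE AE_I2) auto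
      finally show ?thesis by (simp add: \<rho>_def)
    qed
  qed
qed

section \<open>The circle and trigonometric approximation\<close>

lemma space_circle [simp]: "space circle_measure = {0..<1}"
  by (simp add: circle_measure_def space_restrict_space)

lemma sets_circle: "sets circle_measure = sets (restrict_space borel {0..<1})"
  by (simp add: circle_measure_def sets_restrict_space)

lemma sets_circle_iff: "B \<in> sets circle_measure \<longleftrightarrow> B \<in> sets borel \<and> B \<subseteq> {0..<1}"
  by (subst sets_circle) (auto simp: sets_restrict_space_iff)

lemma emeasure_circle: "B \<subseteq> {0..<1} \<Longrightarrow> emeasure circle_measure B = emeasure lborel B"
  by (simp add: circle_measure_def emeasure_restrict_space)

lemma prob_space_circle: "prob_space circle_measure"
  by (rule prob_spaceI) (simp add: emeasure_circle)

interpretation circle: prob_space circle_measure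
  by (rule prob_space_circle)

lemma measurable_circleI:
  assumes "f \<in> borel_measurable M" "\<And>x. x \<in> space M \<Longrightarrow> f x \<in> {0..<1}"
  shows "f \<in> measurable M circle_measure"
  using assms unfolding measurable_cong_sets[OF refl sets_circle]
  by (intro measurable_restrict_space2) auto

lemma borel_measurable_circle:
  "f \<in> measurable borel M \<Longrightarrow> f \<in> measurable circle_measure M"
  unfolding measurable_cong_sets[OF sets_circle refl]
  by (rule measurable_restrict_space1)

lemma frac_borel_measurable [measurable]: "frac \<in> borel_measurable (borel :: real measure)"
  unfolding frac_def by measurable

lemma circle_id_measurable [measurable]: "(\<lambda>x. x) \<in> borel_measurable circle_measure"
  by (rule borel_measurable_circle) simp

lemma rotation_measurable [measurable]: "(\<lambda>x. frac (x + u)) \<in> measurable circle_measure circle_measure"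
  by (rule measurable_circleI) (auto simp: frac_ge_0 frac_lt_1)

lemma lborel_vimage_plus: "B \<in> sets borel \<Longrightarrow> emeasure lborel ((\<lambda>x. x + c) -` B) = emeasure lborel (B :: real set)"
proof -
  assume B: "B \<in> sets borel"
  have "emeasure (distr lborel borel ((+) c)) B = emeasure lborel ((+) c -` B)"
    using B by (subst emeasure_distr) auto
  then have "emeasure lborel B = emeasure lborel ((+) c -` B)" by (simp only: lborel_distr_plus)
  moreover have "(+) c = (\<lambda>x. x + c)" by (auto simp: add.commute)
  ultimately show ?thesis by simp
qed

lemma distr_rotation: "distr circle_measure circle_measure (\<lambda>x. frac (x + u)) = circle_measure"
proof (rule measure_eqI)
  fix B assume "B \<in> sets (distr circle_measure circle_measure (\<lambda>x. frac (x + u)))"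
  then have B: "B \<in> sets circle_measure" by simp
  then have Bb [measurable]: "B \<in> sets borel" and B1: "B \<subseteq> {0..<1}" by (auto simp: sets_circle_iff)
  define v where "v = frac u"
  have v: "0 \<le> v" "v < 1" by (auto simp: v_def frac_ge_0 frac_lt_1)
  have fu: "frac (x + u) = (if x + v < 1 then x + v else x + v - 1)" if "0 \<le> x" "x < 1" for x
  proof -
    have "x + u - (x + v) \<in> \<int>" by (simp add: v_def frac_def)
    then have "frac (x + u) = frac (x + v)" by (metis diff_add_cancel frac_add_int_left)
    also have "\<dots> = (if x + v < 1 then x + v else x + v - 1)"
      using that v by (subst frac_unique_iff) auto
    finally show ?thesis .
  qed
  have "emeasure (distr circle_measure circle_measure (\<lambda>x. frac (x + u))) B
      = emeasure lborel {x \<in> {0..<1}. frac (x + u) \<in> B}"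
    using B by (subst emeasure_distr) (auto simp: vimage_def Int_def conj_commute intro!: emeasure_circle)
  also have "{x \<in> {0..<1}. frac (x + u) \<in> B} = (\<lambda>x. x + v) -` (B \<inter> {v..<1}) \<union> (\<lambda>x. x + (v - 1)) -` (B \<inter> {0..<v})"
    using B1 v by (auto simp: fu algebra_simps split: if_splits)
  also have "emeasure lborel \<dots> = emeasure lborel ((\<lambda>x. x + v) -` (B \<inter> {v..<1})) + emeasure lborel ((\<lambda>x. x + (v - 1)) -` (B \<inter> {0..<v}))"
  proof (rule plus_emeasure[symmetric])
    show "(\<lambda>x. x + v) -` (B \<inter> {v..<1}) \<in> sets lborel" "(\<lambda>x. x + (v - 1)) -` (B \<inter> {0..<v}) \<in> sets lborel"
      using measurable_sets_borel[of "\<lambda>x. x + v" borel "B \<inter> {v..<1}"]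
        measurable_sets_borel[of "\<lambda>x. x + (v - 1)" borel "B \<inter> {0..<v}"] by auto
  qed auto
  also have "\<dots> = emeasure lborel (B \<inter> {v..<1}) + emeasure lborel (B \<inter> {0..<v})"
    by (intro arg_cong2[where f="(+)"] lborel_vimage_plus) auto
  also have "\<dots> = emeasure lborel (B \<inter> {v..<1} \<union> B \<inter> {0..<v})"
    by (intro plus_emeasure) auto
  also have "B \<inter> {v..<1} \<union> B \<inter> {0..<v} = B" using B1 v by auto
  also have "emeasure lborel B = emeasure circle_measure B" by (simp add: emeasure_circle B1)
  finally show "emeasure (distr circle_measure circle_measure (\<lambda>x. frac (x + u))) B = emeasure circle_measure B" .
qed simp

lemma sets_circle_sigma:
  "sets circle_measure = sigma_sets {0..<1} (range (\<lambda>a. {0..<1} \<inter> {..<a}))"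
proof -
  have "sets circle_measure = (\<inter>) {0..<1} ` sigma_sets UNIV (range lessThan)"
    by (simp add: sets_circle sets_restrict_space borel_Iio)
  also have "\<dots> = sigma_sets {0..<1} ((\<inter>) {0..<1} ` range lessThan)"
  proof (rule sigma_sets_Int)
    have "{0..<1::real} \<in> sets borel" by simp
    then show "{0..<1::real} \<in> sigma_sets UNIV (range lessThan)" by (simp add: borel_Iio)
  qed auto
  finally show ?thesis by (simp add: image_image)
qed

text \<open>By \<open>mismatch_tendsto_0_sigma\<close> initial intervals [0, a) suffice. For these a
  mismatch needs a point within |u n| of 0, of 1 or of a, a set of length at most 4 |u n|; for |u n|
  > 1/2 that bound is trivial.\<close>

lemma rotation_mismatch_tendsto_0:
  assumes u: "u \<longlonglongrightarrow> 0" and B: "B \<in> sets circle_measure"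
  shows "(\<lambda>n. measure circle_measure {x \<in> space circle_measure. (frac (x + u n) \<in> B) \<noteq> (x \<in> B)}) \<longlonglongrightarrow> 0"
proof (rule mismatch_tendsto_0_sigma[OF _ _ distr_rotation _ _ B])
  show "sets circle_measure = sigma_sets (space circle_measure) (range (\<lambda>a. {0..<1} \<inter> {..<a}))"
    by (simp add: sets_circle_sigma)
  fix B :: "real set" assume "B \<in> range (\<lambda>a. {0..<1} \<inter> {..<a})"
  then obtain a where B: "B = {0..<1} \<inter> {..<a}" by blast
  have bound: "measure circle_measure {x \<in> space circle_measure. (frac (x + u n) \<in> B) \<noteq> (x \<in> B)} \<le> 4 * \<bar>u n\<bar>" for n
  proof (cases "\<bar>u n\<bar> \<le> 1 / 2")
    case False
    then show ?thesis using circle.prob_le_1[of "{x \<in> space circle_measure. (frac (x + u n) \<in> B) \<noteq> (x \<in> B)}"] by linarith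
  next
    case True
    define w where "w = \<bar>u n\<bar>"
    have w: "0 \<le> w" "w \<le> 1 / 2" using True by (auto simp: w_def)
    define J where "J = ({0..w} \<union> {1 - w..1}) \<union> {a - w..a + w}"
    have sub: "{x \<in> space circle_measure. (frac (x + u n) \<in> B) \<noteq> (x \<in> B)} \<subseteq> J \<inter> {0..<1}"
    proof
      fix x assume x: "x \<in> {x \<in> space circle_measure. (frac (x + u n) \<in> B) \<noteq> (x \<in> B)}"
      show "x \<in> J \<inter> {0..<1}"
      proof (rule ccontr)
        assume nJ: "x \<notin> J \<inter> {0..<1}"
        then have "w < x" "x < 1 - w" using x by (auto simp: J_def)
        then have "frac (x + u n) = x + u n" by (subst frac_eq) (auto simp: w_def)
        then show False using x nJ \<open>w < x\<close> \<open>x < 1 - w\<close> by (auto simp: B J_def w_def)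
      qed
    qed
    have "measure circle_measure {x \<in> space circle_measure. (frac (x + u n) \<in> B) \<noteq> (x \<in> B)} \<le> measure circle_measure (J \<inter> {0..<1})"
      by (rule circle.finite_measure_mono[OF sub]) (auto simp: sets_circle_iff J_def)
    also have "\<dots> = measure lborel (J \<inter> {0..<1})"
      by (simp add: measure_def emeasure_circle)
    also have "\<dots> \<le> measure lborel J"
    proof (rule measure_mono_fmeasurable)
      have "{c..d::real} \<in> fmeasurable lborel" for c d
        by (simp add: fmeasurable_def emeasure_lborel_Icc_eq)
      then show "J \<in> fmeasurable lborel" unfolding J_def by (intro fmeasurable.Un)
    qed (auto simp: J_def)
    also have "\<dots> \<le> measure lborel ({0..w} \<union> {1 - w..1}) + measure lborel {a - w..a + w}"
      unfolding J_def by (rule measure_Un_le) auto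
    also have "\<dots> \<le> measure lborel {0..w} + measure lborel {1 - w..1} + measure lborel {a - w..a + w}"
      by (intro add_right_mono measure_Un_le) auto
    also have "\<dots> = 4 * w" using w by simp
    finally show ?thesis by (simp add: w_def)
  qed
  show "(\<lambda>n. measure circle_measure {x \<in> space circle_measure. (frac (x + u n) \<in> B) \<noteq> (x \<in> B)}) \<longlonglongrightarrow> 0"
  proof (rule tendsto_sandwich[OF _ _ tendsto_const])
    show "(\<lambda>n. 4 * \<bar>u n\<bar>) \<longlonglongrightarrow> 0"
      using tendsto_mult_left[OF tendsto_rabs_zero[OF u], of 4] by simp
  qed (use bound in \<open>auto intro!: always_eventually\<close>)
qed (auto intro: circle.finite_measure_axioms)

section \<open>Density of trigonometric polynomials and uniqueness of Fourier coefficients\<close>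

inductive trig_poly :: "(real \<Rightarrow> complex) \<Rightarrow> bool" where
  char: "trig_poly (\<lambda>x. cis (2 * pi * of_int m * x))"
| add: "trig_poly P \<Longrightarrow> trig_poly Q \<Longrightarrow> trig_poly (\<lambda>x. P x + Q x)"
| cmult: "trig_poly P \<Longrightarrow> trig_poly (\<lambda>x. c * P x)"

lemma trig_poly_measurable: "trig_poly P \<Longrightarrow> P \<in> borel_measurable borel"
proof (induction rule: trig_poly.induct)
  case (char m)
  have "continuous_on UNIV (\<lambda>x. cis (2 * pi * of_int m * x))"
    by (intro continuous_intros)
  then show ?case by (rule borel_measurable_continuous_onI)
qed auto

lemma trig_poly_bounded: "trig_poly P \<Longrightarrow> \<exists>C. \<forall>x. norm (P x) \<le> C"
proof (induction rule: trig_poly.induct)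
  case (add P Q)
  then obtain C D where "\<And>x. norm (P x) \<le> C" "\<And>x. norm (Q x) \<le> D" by blast
  then have "\<forall>x. norm (P x + Q x) \<le> C + D" by (meson add_mono norm_triangle_le)
  then show ?case by blast
next
  case (cmult P c)
  then obtain C where "\<And>x. norm (P x) \<le> C" by blast
  then have "\<forall>x. norm (c * P x) \<le> norm c * C" by (simp add: norm_mult mult_left_mono)
  then show ?case by blast
qed auto

lemma trig_poly_mult: "trig_poly P \<Longrightarrow> trig_poly Q \<Longrightarrow> trig_poly (\<lambda>x. P x * Q x)"
proof (induction rule: trig_poly.induct)
  case (char m)
  from char show ?case
  proof (induction rule: trig_poly.induct)
    case (char n)
    show ?case using trig_poly.char[of "m + n"] by (simp add: cis_mult algebra_simps)
  next
    case (add P Q)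
    then show ?case using trig_poly.add by (simp add: algebra_simps)
  next
    case (cmult P c)
    then show ?case using trig_poly.cmult[of _ c] by (simp add: algebra_simps)
  qed
next
  case (add P Q)
  then show ?case using trig_poly.add by (simp add: algebra_simps)
next
  case (cmult P c)
  then show ?case using trig_poly.cmult[of _ c] by (simp add: algebra_simps)
qed

lemma trig_poly_const: "trig_poly (\<lambda>x. c)"
  using trig_poly.cmult[OF trig_poly.char[of 0], of c] by simp

lemma trig_poly_cos: "trig_poly (\<lambda>x. complex_of_real (cos (2 * pi * (x - b))))"
proof -
  have "complex_of_real (cos (2 * pi * (x - b)))
    = cis (- 2 * pi * b) / 2 * cis (2 * pi * of_int 1 * x) + cis (2 * pi * b) / 2 * cis (2 * pi * of_int (-1) * x)" for x
    by (simp add: complex_eq_iff cos_diff cos_add sin_add right_diff_distrib algebra_simps)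
       (simp add: field_simps)
  then show ?thesis
    by (simp only:) (intro trig_poly.add trig_poly.cmult trig_poly.char)
qed

lemma trig_poly_real_polynomial:
  assumes "real_polynomial_function p" and "trig_poly (\<lambda>x. complex_of_real (g x))"
  shows "trig_poly (\<lambda>x. complex_of_real (p (g x :: real)))"
  using assms(1)
proof (induction rule: real_polynomial_function.induct)
  case (linear f)
  interpret bounded_linear f by fact
  have "f y = f 1 * y" for y using scaleR[of y 1] by simp
  then have "complex_of_real (f (g x)) = complex_of_real (f 1) * complex_of_real (g x)" for x
    by (metis of_real_mult)
  then show ?case using trig_poly.cmult[OF assms(2)] by simp
qed (auto intro: trig_poly_const trig_poly.add trig_poly_mult)

text \<open>Approximation is meant in L1, since the functions approximated are later paired with
  bounded functions only.\<close>

definition trig_approx :: "(real \<Rightarrow> complex) \<Rightarrow> bool" where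
  "trig_approx u \<longleftrightarrow> integrable circle_measure u \<and>
    (\<forall>e>0. \<exists>P. trig_poly P \<and> (\<integral>x. norm (u x - P x) \<partial>circle_measure) < e)"

lemma trig_poly_integrable: "trig_poly P \<Longrightarrow> integrable circle_measure P"
  using trig_poly_bounded[of P] borel_measurable_circle[OF trig_poly_measurable[of P]]
  by (auto intro: circle.integrable_const_bound)

lemma trig_poly_approx: "trig_poly P \<Longrightarrow> trig_approx P"
  unfolding trig_approx_def by (auto intro!: trig_poly_integrable exI[of _ P])

lemma trig_approx_add:
  assumes u: "trig_approx u" and v: "trig_approx v"
  shows "trig_approx (\<lambda>x. u x + v x)"
  unfolding trig_approx_def
proof (intro conjI allI impI)
  have iu: "integrable circle_measure u" and iv: "integrable circle_measure v"
    using u v by (auto simp: trig_approx_def)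
  then show "integrable circle_measure (\<lambda>x. u x + v x)" by simp
  fix e :: real assume "0 < e"
  then obtain P Q where P: "trig_poly P" "(\<integral>x. norm (u x - P x) \<partial>circle_measure) < e / 2"
    and Q: "trig_poly Q" "(\<integral>x. norm (v x - Q x) \<partial>circle_measure) < e / 2"
    using u v unfolding trig_approx_def by (meson half_gt_zero)
  note iP = trig_poly_integrable[OF P(1)] and iQ = trig_poly_integrable[OF Q(1)]
  have "(\<integral>x. norm (u x + v x - (P x + Q x)) \<partial>circle_measure)
    \<le> (\<integral>x. norm (u x - P x) + norm (v x - Q x) \<partial>circle_measure)"
    using iu iv iP iQ by (intro integral_mono norm_diff_triangle_ineq) auto
  also have "\<dots> = (\<integral>x. norm (u x - P x) \<partial>circle_measure) + (\<integral>x. norm (v x - Q x) \<partial>circle_measure)"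
    using iu iv iP iQ by (intro Bochner_Integration.integral_add) auto
  finally show "\<exists>P. trig_poly P \<and> (\<integral>x. norm (u x + v x - P x) \<partial>circle_measure) < e"
    using P Q trig_poly.add[OF P(1) Q(1)] by (intro exI[of _ "\<lambda>x. P x + Q x"]) auto
qed

lemma trig_approx_limit:
  assumes iu: "integrable circle_measure u"
    and v: "\<And>e. 0 < e \<Longrightarrow> \<exists>v. trig_approx v \<and> (\<integral>x. norm (u x - v x) \<partial>circle_measure) < e"
  shows "trig_approx u"
  unfolding trig_approx_def
proof (intro conjI allI impI iu)
  fix e :: real assume e: "0 < e"
  obtain v where va: "trig_approx v" and v: "(\<integral>x. norm (u x - v x) \<partial>circle_measure) < e / 2"
    using v[of "e / 2"] e by auto
  obtain P where P: "trig_poly P" "(\<integral>x. norm (v x - P x) \<partial>circle_measure) < e / 2"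
    using va e unfolding trig_approx_def by (meson half_gt_zero)
  have iv: "integrable circle_measure v" using va by (simp add: trig_approx_def)
  note iP = trig_poly_integrable[OF P(1)]
  have "(\<integral>x. norm (u x - P x) \<partial>circle_measure)
    \<le> (\<integral>x. norm (u x - v x) + norm (v x - P x) \<partial>circle_measure)"
    using iu iv iP by (intro integral_mono) (auto intro: norm_diff_triangle_le)
  also have "\<dots> = (\<integral>x. norm (u x - v x) \<partial>circle_measure) + (\<integral>x. norm (v x - P x) \<partial>circle_measure)"
    using iu iv iP by (intro Bochner_Integration.integral_add) auto
  finally show "\<exists>P. trig_poly P \<and> (\<integral>x. norm (u x - P x) \<partial>circle_measure) < e"
    using P v by (intro exI[of _ P]) auto
qed

lemma trig_approx_cmult:
  assumes u: "trig_approx u"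
  shows "trig_approx (\<lambda>x. c * u x)"
  unfolding trig_approx_def
proof (intro conjI allI impI)
  have iu: "integrable circle_measure u"
    using u by (auto simp: trig_approx_def)
  then show "integrable circle_measure (\<lambda>x. c * u x)" by simp
  fix e :: real assume "0 < e"
  then have "0 < e / (norm c + 1)" by (simp add: add_nonneg_pos)
  then obtain P where P: "trig_poly P" "(\<integral>x. norm (u x - P x) \<partial>circle_measure) < e / (norm c + 1)"
    using u unfolding trig_approx_def by blast
  have "(\<integral>x. norm (c * u x - c * P x) \<partial>circle_measure) = norm c * (\<integral>x. norm (u x - P x) \<partial>circle_measure)"
    by (simp add: norm_mult flip: right_diff_distrib)
  also have "\<dots> \<le> (norm c + 1) * (\<integral>x. norm (u x - P x) \<partial>circle_measure)"
    by (intro mult_right_mono) auto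
  also have "\<dots> < e" using P(2) by (simp add: less_divide_eq add_nonneg_pos mult.commute)
  finally show "\<exists>P. trig_poly P \<and> (\<integral>x. norm (c * u x - P x) \<partial>circle_measure) < e"
    using trig_poly.cmult[OF P(1)] by blast
qed

lemma trig_approx_LIMSEQ:
  assumes v: "\<And>n. trig_approx (v n)" and u: "u \<in> borel_measurable circle_measure"
    and lim: "AE x in circle_measure. (\<lambda>n. v n x) \<longlonglongrightarrow> u x"
    and w: "integrable circle_measure w" and bd: "\<And>n. AE x in circle_measure. norm (v n x) \<le> w x"
  shows "trig_approx u"
proof (rule trig_approx_limit)
  have vm: "v n \<in> borel_measurable circle_measure" for n
    using v[of n] by (auto simp: trig_approx_def)
  show iu: "integrable circle_measure u"
    by (rule integrable_dominated_convergence[OF u vm w lim bd])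
  have "(\<lambda>n. \<integral>x. norm (u x - v n x) \<partial>circle_measure) \<longlonglongrightarrow> (\<integral>x. 0 \<partial>circle_measure)"
  proof (rule integral_dominated_convergence[where w="\<lambda>x. norm (u x) + w x"])
    show "AE x in circle_measure. (\<lambda>n. norm (u x - v n x)) \<longlonglongrightarrow> 0"
      using lim
    proof eventually_elim
      case (elim x)
      have "(\<lambda>n. u x - v n x) \<longlonglongrightarrow> u x - u x" by (intro tendsto_diff tendsto_const elim)
      then show ?case by (intro tendsto_norm_zero) simp
    qed
    show "AE x in circle_measure. norm (norm (u x - v n x)) \<le> norm (u x) + w x" for n
      using bd[of n]
    proof eventually_elim
      case (elim x)
      then show ?case using norm_triangle_ineq4[of "u x" "v n x"] by simp
    qed
  qed (use u vm iu w in auto)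
  then have l: "(\<lambda>n. \<integral>x. norm (u x - v n x) \<partial>circle_measure) \<longlonglongrightarrow> 0" by simp
  fix e :: real assume "0 < e"
  then obtain n where "(\<integral>x. norm (u x - v n x) \<partial>circle_measure) < e"
    using order_tendstoD(2)[OF l, of e] by (auto simp: eventually_sequentially)
  then show "\<exists>v. trig_approx v \<and> (\<integral>x. norm (u x - v x) \<partial>circle_measure) < e"
    using v by blast
qed

text \<open>The arc (0, a) is the set where cos (2 pi (x - a/2)) exceeds cos (pi a). The indicator
  of t > cos (pi a) is a pointwise limit of continuous ramps \<open>h n\<close>, Weierstrass
  replaces these by polynomials on [-1, 1], and a polynomial in a cosine is a trigonometric
  polynomial.\<close>

lemma trig_approx_arc:
  assumes a: "0 < a" "a < 1"
  shows "trig_approx (\<lambda>x. complex_of_real (indicator {0<..<a} x))"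
proof -
  define g where "g x = cos (2 * pi * (x - a / 2))" for x
  define h where "h n t = min 1 (max 0 (real n * (t - cos (pi * a))))" for n :: nat and t :: real
  have "\<exists>p. real_polynomial_function p \<and> (\<forall>t\<in>{-1..1}. \<bar>h n t - p t\<bar> < 1 / real (Suc n))" for n
  proof -
    have "continuous_on {-1..1} (h n)" unfolding h_def by (intro continuous_intros)
    then show ?thesis
      using Stone_Weierstrass_real_polynomial_function[of "{-1..1::real}" "h n" "1 / real (Suc n)"]
      by (metis compact_Icc of_nat_0_less_iff zero_less_Suc zero_less_divide_1_iff)
  qed
  then obtain p where p: "\<And>n. real_polynomial_function (p n)"
    and ph: "\<And>n t. t \<in> {-1..1} \<Longrightarrow> \<bar>h n t - p n t\<bar> < 1 / real (Suc n)"
    by metis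
  have g1: "g x \<in> {-1..1}" for x by (simp add: g_def)
  have hb: "0 \<le> h n t" "h n t \<le> 1" for n t by (auto simp: h_def)
  show ?thesis
  proof (rule trig_approx_LIMSEQ[where v="\<lambda>n x. complex_of_real (p n (g x))" and w="\<lambda>_. 2"])
    show "trig_approx (\<lambda>x. complex_of_real (p n (g x)))" for n
    proof -
      have "trig_poly (\<lambda>x. complex_of_real (g x))" unfolding g_def by (rule trig_poly_cos)
      then show ?thesis by (rule trig_poly_approx[OF trig_poly_real_polynomial[OF p]])
    qed
    show "(\<lambda>x. complex_of_real (indicator {0<..<a} x)) \<in> borel_measurable circle_measure"
      by (rule borel_measurable_circle) simp
    show "AE x in circle_measure. norm (complex_of_real (p n (g x))) \<le> 2" for n
    proof (rule AE_I2)
      fix x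
      have "1 / real (Suc n) \<le> 1" by simp
      then show "norm (complex_of_real (p n (g x))) \<le> 2"
        unfolding norm_of_real using ph[OF g1, of n x] hb[of n "g x"] by linarith
    qed
    show "AE x in circle_measure. (\<lambda>n. complex_of_real (p n (g x))) \<longlonglongrightarrow> complex_of_real (indicator {0<..<a} x)"
    proof (rule AE_I2)
      fix x assume "x \<in> space circle_measure"
      then have x: "0 \<le> x" "x < 1" by auto
      have cosa: "cos (pi * a) < g x \<longleftrightarrow> x \<in> {0<..<a}"
      proof -
        have ax: "\<bar>2 * pi * (x - a / 2)\<bar> = 2 * pi * \<bar>x - a / 2\<bar>" by (simp add: abs_mult)
        have gx: "g x = cos (2 * pi * \<bar>x - a / 2\<bar>)" unfolding g_def by (metis ax cos_abs_real)
        show ?thesis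
        proof (cases "\<bar>x - a / 2\<bar> \<le> 1 / 2")
          case True
          have "2 * pi * \<bar>x - a / 2\<bar> \<le> 2 * pi * (1 / 2)" using True by (intro mult_left_mono) auto
          then have "cos (pi * a) < g x \<longleftrightarrow> 2 * pi * \<bar>x - a / 2\<bar> < pi * a"
            unfolding gx using a by (intro cos_mono_less_eq) auto
          also have "\<dots> \<longleftrightarrow> \<bar>x - a / 2\<bar> < a / 2" by (simp add: field_simps)
          also have "\<dots> \<longleftrightarrow> x \<in> {0<..<a}" unfolding greaterThanLessThan_iff by arith
          finally show ?thesis .
        next
          case False
          \<comment> \<open>Here the shorter way from x to the centre a/2 of the arc passes through
            1 and has length 1 - (x - a/2) \<ge> a/2, so x lies outside the arc and the cosine is
            not above the threshold.\<close>
          then have xa: "x - a / 2 > 1 / 2" using x a by linarith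
          have "g x = cos (2 * pi * (1 - (x - a / 2)))"
            unfolding g_def by (simp add: right_diff_distrib cos_diff)
          moreover have "cos (2 * pi * (1 - (x - a / 2))) \<le> cos (pi * a)"
          proof (rule cos_monotone_0_pi_le)
            have "pi * a \<le> pi * (2 * (1 - (x - a / 2)))" using x a by (intro mult_left_mono) auto
            then show "pi * a \<le> 2 * pi * (1 - (x - a / 2))" by (simp add: algebra_simps)
            have "pi * (2 * (1 - (x - a / 2))) \<le> pi * 1" using xa by (intro mult_left_mono) auto
            then show "2 * pi * (1 - (x - a / 2)) \<le> pi" by (simp add: algebra_simps)
          qed (use a in auto)
          ultimately show ?thesis using xa x a by auto
        qed
      qed
      have hl: "(\<lambda>n. h n (g x)) \<longlonglongrightarrow> indicator {0<..<a} x"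
      proof (cases "cos (pi * a) < g x")
        case True
        then have d: "0 < g x - cos (pi * a)" by simp
        obtain N :: nat where N: "1 / (g x - cos (pi * a)) < real N" using reals_Archimedean2 by blast
        have "h n (g x) = 1" if "n \<ge> N" for n
        proof -
          have "1 < real N * (g x - cos (pi * a))" using N d by (simp add: divide_less_eq)
          also have "\<dots> \<le> real n * (g x - cos (pi * a))" using that d by (intro mult_right_mono) auto
          finally show ?thesis by (simp add: h_def)
        qed
        then have "eventually (\<lambda>n. h n (g x) = 1) sequentially" by (auto simp: eventually_sequentially)
        then show ?thesis using True cosa by (simp add: tendsto_eventually)
      next
        case False
        have "h n (g x) = 0" for n
        proof -
          have "real n * (g x - cos (pi * a)) \<le> 0" using False by (intro mult_nonneg_nonpos) auto
          then show ?thesis by (simp add: h_def)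
        qed
        then show ?thesis using False cosa by simp
      qed
      have "(\<lambda>n. h n (g x) - p n (g x)) \<longlonglongrightarrow> 0"
      proof (rule Lim_null_comparison)
        show "(\<lambda>n. 1 / real (Suc n)) \<longlonglongrightarrow> 0" using LIMSEQ_inverse_real_of_nat by (simp add: inverse_eq_divide)
        show "\<forall>\<^sub>F n in sequentially. norm (h n (g x) - p n (g x)) \<le> 1 / real (Suc n)"
          using ph[OF g1, of _ x] by (intro always_eventually allI) (simp only: real_norm_def less_imp_le)
      qed
      from tendsto_diff[OF hl this] show "(\<lambda>n. complex_of_real (p n (g x))) \<longlonglongrightarrow> complex_of_real (indicator {0<..<a} x)"
        by (intro tendsto_of_real) simp
    qed
  qed auto
qed

lemma trig_approx_indicator:
  assumes "B \<in> sets circle_measure"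
  shows "trig_approx (\<lambda>x. complex_of_real (indicator B x))"
proof -
  let ?G = "range (\<lambda>a. {0..<1} \<inter> {..<a::real})"
  have c1: "trig_approx (\<lambda>x. complex_of_real 1)"
    by (intro trig_poly_approx trig_poly_const)
  have "Int_stable ?G"
  proof (rule Int_stableI_image)
    fix a b :: real
    have "({0..<1} \<inter> {..<a}) \<inter> ({0..<1} \<inter> {..<b}) = {0..<1} \<inter> {..<min a b}" by auto
    then show "\<exists>k\<in>UNIV. ({0..<1} \<inter> {..<a}) \<inter> ({0..<1} \<inter> {..<b}) = {0..<1} \<inter> {..<k}" by blast
  qed
  moreover have "?G \<subseteq> Pow {0..<1}" by auto
  moreover have "B \<in> sigma_sets {0..<1} ?G" using assms by (simp add: sets_circle_sigma)
  ultimately show ?thesis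
  proof (induction rule: sigma_sets_induct_disjoint)
    case (basic A)
    then obtain a where A: "A = {0..<1} \<inter> {..<a}" by blast
    have Am: "A \<in> sets circle_measure" by (auto simp: A sets_circle_iff)
    consider "a \<le> 0" | "0 < a" "a < 1" | "1 \<le> a" by linarith
    then show ?case
    proof cases
      case 1
      then have "A = {}" by (auto simp: A)
      then show ?thesis using trig_poly_approx[OF trig_poly_const[of 0]] by simp
    next
      case 2
      show ?thesis
      \<comment> \<open>A constant sequence in the limit lemma amounts to a change on a null set:
        [0, a) and (0, a) differ only in the point 0.\<close>
      proof (rule trig_approx_LIMSEQ[where v="\<lambda>n x. complex_of_real (indicator {0<..<a} x)" and w="\<lambda>_. 1"])
        show "trig_approx (\<lambda>x. complex_of_real (indicator {0<..<a} x))" by (rule trig_approx_arc[OF 2])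
        have "emeasure circle_measure {0} = 0" by (subst emeasure_circle) auto
        then have "AE x in circle_measure. x \<noteq> 0"
          by (intro AE_I[of _ _ "{0}"]) (auto simp: sets_circle_iff)
        then show "AE x in circle_measure. (\<lambda>n. complex_of_real (indicator {0<..<a} x)) \<longlonglongrightarrow> complex_of_real (indicator A x)"
          using AE_space
        proof eventually_elim
          case (elim x)
          then have "indicator {0<..<a} x = (indicator A x :: real)"
            using 2 by (auto simp: A indicator_def)
          then show ?case by simp
        qed
      qed (use Am in \<open>auto intro!: AE_I2 simp: indicator_def\<close>)
    next
      case 3
      have "integrable circle_measure (\<lambda>x. complex_of_real (indicator A x))"
        using Am by (intro circle.integrable_const_bound[where B=1]) (auto simp: indicator_def)
      then show ?thesis
      proof (rule trig_approx_limit)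
        fix e :: real assume e: "0 < e"
        have "(\<integral>x. norm (complex_of_real (indicator A x) - complex_of_real 1) \<partial>circle_measure) = (\<integral>x. 0 \<partial>circle_measure)"
          using 3 by (intro Bochner_Integration.integral_cong) (auto simp: A)
        then show "\<exists>v. trig_approx v \<and> (\<integral>x. norm (complex_of_real (indicator A x) - v x) \<partial>circle_measure) < e"
          using c1 e by (intro exI[of _ "\<lambda>x. complex_of_real 1"]) auto
      qed
    qed
  next
    case empty
    then show ?case using trig_poly_approx[OF trig_poly_const[of 0]] by simp
  next
    case (compl A)
    have Am: "A \<in> sets circle_measure" using compl(1) by (simp add: sets_circle_sigma)
    show ?case
    proof (rule trig_approx_limit)
      show "integrable circle_measure (\<lambda>x. complex_of_real (indicator ({0..<1} - A) x))"
      proof (rule circle.integrable_const_bound[where B=1])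
        have "{0..<1} - A \<in> sets circle_measure" using sets.compl_sets[OF Am] by simp
        then show "(\<lambda>x. complex_of_real (indicator ({0..<1} - A) x)) \<in> borel_measurable circle_measure"
          by measurable
      qed (auto simp: indicator_def)
      fix e :: real assume e: "0 < e"
      have "trig_approx (\<lambda>x. complex_of_real 1 + (-1) * complex_of_real (indicator A x))"
        by (intro trig_approx_add trig_approx_cmult c1 compl)
      moreover have "(\<integral>x. norm (complex_of_real (indicator ({0..<1} - A) x) - (complex_of_real 1 + (-1) * complex_of_real (indicator A x))) \<partial>circle_measure) = (\<integral>x. 0 \<partial>circle_measure)"
        by (intro Bochner_Integration.integral_cong) (auto simp: indicator_def)
      ultimately show "\<exists>v. trig_approx v \<and> (\<integral>x. norm (complex_of_real (indicator ({0..<1} - A) x) - v x) \<partial>circle_measure) < e"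
        using e by (intro exI[of _ "\<lambda>x. complex_of_real 1 + (-1) * complex_of_real (indicator A x)"]) auto
    qed
  next
    case (union A)
    have Am: "A i \<in> sets circle_measure" for i using union(2) by (auto simp: sets_circle_sigma)
    have fin: "trig_approx (\<lambda>x. complex_of_real (indicator (\<Union>i<n. A i) x))" for n
    proof (induction n)
      case 0
      then show ?case using trig_poly_approx[OF trig_poly_const[of 0]] by simp
    next
      case (Suc n)
      have "A n \<inter> A i = {}" if "i < n" for i
        using disjoint_family_onD[OF union(1), of n i] that by simp
      then have "A n \<inter> (\<Union>i<n. A i) = {}" by (simp add: Int_UN_distrib)
      then have "complex_of_real (indicator (\<Union>i<Suc n. A i) x) = complex_of_real (indicator (\<Union>i<n. A i) x) + complex_of_real (indicator (A n) x)" for x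
        unfolding lessThan_Suc UN_insert by (subst indicator_add[symmetric]) (simp_all add: Int_commute)
      then show ?case using trig_approx_add[OF Suc union(3)] by simp
    qed
    show ?case
    proof (rule trig_approx_LIMSEQ[where v="\<lambda>n x. complex_of_real (indicator (\<Union>i<n. A i) x)" and w="\<lambda>_. 1"])
      show "AE x in circle_measure. (\<lambda>n. complex_of_real (indicator (\<Union>i<n. A i) x)) \<longlonglongrightarrow> complex_of_real (indicator (\<Union>i. A i) x)"
        by (intro AE_I2 tendsto_of_real LIMSEQ_indicator_UN)
      have "(\<Union>i. A i) \<in> sets circle_measure" using Am by auto
      then show "(\<lambda>x. complex_of_real (indicator (\<Union>i. A i) x)) \<in> borel_measurable circle_measure" by simp
    qed (use fin in \<open>auto intro!: AE_I2 simp: indicator_def\<close>)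
  qed
qed

theorem trig_approx_integrable:
  fixes u :: "real \<Rightarrow> complex"
  assumes "integrable circle_measure u"
  shows "trig_approx u"
  using assms
proof (induction rule: integrable_induct)
  case (base A c)
  then show ?case
    using trig_approx_cmult[OF trig_approx_indicator[OF base(1)], of c]
    by (simp add: scaleR_conv_of_real mult.commute)
next
  case (add f g)
  then show ?case by (intro trig_approx_add)
next
  case (lim f s)
  show ?case
    by (rule trig_approx_LIMSEQ[where v=s and w="\<lambda>x. 2 * norm (f x)"]) (use lim in auto)
qed

text \<open>Since u is orthogonal to all trigonometric polynomials, the integral of |u|^2 equals
  that of u (cnj u - P) for each P. It is at most C times the L1 distance from cnj u to P, which can
  be made arbitrarily small.\<close>

lemma fourier_uniqueness:
  fixes u :: "real \<Rightarrow> complex"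
  assumes u: "u \<in> borel_measurable circle_measure" and bd: "\<And>x. x \<in> {0..<1} \<Longrightarrow> norm (u x) \<le> C"
    and z: "\<And>m. (\<integral>x. u x * cis (2 * pi * of_int m * x) \<partial>circle_measure) = 0"
  shows "AE x in circle_measure. u x = 0"
proof -
  note [measurable] = u
  have iu: "integrable circle_measure u"
    by (rule circle.integrable_const_bound[where B=C]) (use bd in auto)
  have C0: "0 \<le> C" by (rule order.trans[OF norm_ge_zero bd[of 0]]) simp
  have iuP: "integrable circle_measure (\<lambda>x. u x * v x)" if iv: "integrable circle_measure v" for v
  proof (rule Bochner_Integration.integrable_bound[of _ "\<lambda>x. C * norm (v x)"])
    show "AE x in circle_measure. norm (u x * v x) \<le> norm (C * norm (v x))"
      using bd C0 by (intro AE_I2) (auto simp: norm_mult intro!: mult_right_mono)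
  qed (use iv in auto)
  have zP: "(\<integral>x. u x * P x \<partial>circle_measure) = 0" if "trig_poly P" for P
    using that
  proof (induction rule: trig_poly.induct)
    case (char m)
    then show ?case by (rule z)
  next
    case (add P Q)
    then show ?case using iuP[OF trig_poly_integrable] by (simp add: distrib_left)
  next
    case (cmult P c)
    then show ?case by (simp add: mult.left_commute[of _ c])
  qed
  have icu: "integrable circle_measure (\<lambda>x. cnj (u x))" using iu by simp
  have le: "(\<integral>x. (norm (u x))\<^sup>2 \<partial>circle_measure) \<le> C * e" if e: "0 < e" for e
  proof -
    obtain P where P: "trig_poly P" "(\<integral>x. norm (cnj (u x) - P x) \<partial>circle_measure) < e"
      using trig_approx_integrable[OF icu] e unfolding trig_approx_def by blast
    note iP = trig_poly_integrable[OF P(1)]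
    have "complex_of_real (\<integral>x. (norm (u x))\<^sup>2 \<partial>circle_measure) = (\<integral>x. complex_of_real ((norm (u x))\<^sup>2) \<partial>circle_measure)"
      by (simp only: integral_complex_of_real)
    also have "\<dots> = (\<integral>x. u x * cnj (u x) \<partial>circle_measure)"
      by (simp only: complex_norm_square)
    also have "\<dots> = (\<integral>x. u x * cnj (u x) \<partial>circle_measure) - (\<integral>x. u x * P x \<partial>circle_measure)"
      by (simp add: zP[OF P(1)])
    also have "\<dots> = (\<integral>x. u x * (cnj (u x) - P x) \<partial>circle_measure)"
      using iuP[OF icu] iuP[OF iP] by (simp add: right_diff_distrib)
    finally have "norm (complex_of_real (\<integral>x. (norm (u x))\<^sup>2 \<partial>circle_measure)) = norm (\<integral>x. u x * (cnj (u x) - P x) \<partial>circle_measure)"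
      by (rule arg_cong)
    also have "\<dots> \<le> (\<integral>x. C * norm (cnj (u x) - P x) \<partial>circle_measure)"
    proof (rule order.trans[OF integral_norm_bound integral_mono])
      show "integrable circle_measure (\<lambda>x. norm (u x * (cnj (u x) - P x)))"
        using icu iP by (intro integrable_norm iuP) auto
      show "norm (u x * (cnj (u x) - P x)) \<le> C * norm (cnj (u x) - P x)" if "x \<in> space circle_measure" for x
        using that bd by (auto simp: norm_mult intro!: mult_right_mono)
    qed (use icu iP in auto)
    also have "\<dots> = C * (\<integral>x. norm (cnj (u x) - P x) \<partial>circle_measure)" by simp
    also have "\<dots> \<le> C * e" using P(2) C0 by (intro mult_left_mono) auto
    finally show ?thesis by simp
  qed
  have i2: "integrable circle_measure (\<lambda>x. (norm (u x))\<^sup>2)"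
    by (rule circle.integrable_const_bound[where B="C\<^sup>2"]) (use bd in \<open>auto intro!: power_mono\<close>)
  have "(\<integral>x. (norm (u x))\<^sup>2 \<partial>circle_measure) \<le> 0"
  proof (rule field_le_epsilon)
    fix e :: real assume e: "0 < e"
    have "C * (e / (C + 1)) \<le> e" using C0 e by (simp add: divide_simps mult_left_mono)
    then show "(\<integral>x. (norm (u x))\<^sup>2 \<partial>circle_measure) \<le> 0 + e"
      using le[of "e / (C + 1)"] e C0 by simp
  qed
  then have "(\<integral>x. (norm (u x))\<^sup>2 \<partial>circle_measure) = 0" by (simp add: order_antisym)
  then show ?thesis using integral_nonneg_eq_0_iff_AE[OF i2] by simp
qed

section \<open>Measurable flows\<close>

lemma (in prob_space) AE_witness:
  assumes "AE x in M. P x"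
  obtains x where "x \<in> space M" "P x"
proof -
  have "\<exists>x\<in>space M. P x"
  proof (rule ccontr)
    assume n: "\<not> (\<exists>x\<in>space M. P x)"
    have "AE x in M. False" using assms AE_space by eventually_elim (use n in blast)
    then show False by simp
  qed
  then show ?thesis using that by blast
qed

text \<open>This is the price of replacing a translation of the line by a rotation of the circle: t
  + v and frac (t + v) differ only on this set.\<close>

lemma circle_overflow_le: "measure circle_measure {t \<in> {0..<1}. t + v \<notin> {0..<1}} \<le> \<bar>v\<bar>"
proof -
  define J where "J = (if 0 \<le> v then {1 - v..1} else {0..-v})"
  have "measure circle_measure {t \<in> {0..<1}. t + v \<notin> {0..<1}} = measure lborel {t \<in> {0..<1}. t + v \<notin> {0..<1}}"
    unfolding measure_def by (subst emeasure_circle) auto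
  also have "\<dots> \<le> measure lborel J"
  proof (rule measure_mono_fmeasurable)
    show "{t \<in> {0..<1}. t + v \<notin> {0..<1}} \<in> sets lborel" by measurable
  qed (auto simp: J_def fmeasurable_def emeasure_lborel_Icc_eq)
  also have "\<dots> = \<bar>v\<bar>" by (simp add: J_def)
  finally show ?thesis .
qed

lemma circle_integral_rotation:
  fixes f :: "real \<Rightarrow> 'a::{banach, second_countable_topology}"
  assumes "f \<in> borel_measurable circle_measure"
  shows "(\<integral>t. f (frac (t + v)) \<partial>circle_measure) = (\<integral>t. f t \<partial>circle_measure)"
  using integral_distr[OF rotation_measurable, of f v] assms by (simp add: distr_rotation)

lemma cis_int_frac: "cis (2 * pi * of_int m * frac x) = cis (2 * pi * of_int m * x)"
proof -
  have "2 * pi * of_int m * frac x = 2 * pi * of_int m * x - 2 * pi * of_int (m * \<lfloor>x\<rfloor>)"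
    by (simp add: frac_def algebra_simps)
  then have "cis (2 * pi * of_int m * frac x) = cis (2 * pi * of_int m * x) / cis (2 * pi * of_int (m * \<lfloor>x\<rfloor>))"
    by (simp only: cis_divide)
  also have "cis (2 * pi * of_int (m * \<lfloor>x\<rfloor>)) = 1" by (rule cis_multiple_2pi) simp
  finally show ?thesis by simp
qed

text \<open>Rotation by half a period of the character preserves the integral and reverses the sign
  of the integrand.\<close>

lemma circle_integral_char:
  assumes "m \<noteq> 0"
  shows "(\<integral>t. cis (2 * pi * of_int m * t) \<partial>circle_measure) = 0"
proof -
  let ?I = "\<integral>t. cis (2 * pi * of_int m * t) \<partial>circle_measure"
  define v where "v = 1 / (2 * of_int m :: real)"
  have "?I = (\<integral>t. cis (2 * pi * of_int m * frac (t + v)) \<partial>circle_measure)"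
    by (rule circle_integral_rotation[symmetric])
      (intro borel_measurable_circle trig_poly_measurable trig_poly.char)
  also have "\<dots> = (\<integral>t. - cis (2 * pi * of_int m * t) \<partial>circle_measure)"
  proof (rule Bochner_Integration.integral_cong[OF refl])
    fix t
    have "2 * pi * of_int m * (t + v) = 2 * pi * of_int m * t + pi"
      using assms by (simp add: v_def field_simps)
    then show "cis (2 * pi * of_int m * frac (t + v)) = - cis (2 * pi * of_int m * t)"
      by (simp add: cis_int_frac flip: cis_mult)
  qed
  also have "\<dots> = - ?I" by simp
  finally have "2 * ?I = 0" by simp
  then show ?thesis by simp
qed

locale prob_flow = prob_space \<nu> for \<nu> :: "'b measure" +
  fixes S :: "real \<Rightarrow> 'b \<Rightarrow> 'b"
  assumes flow: "mp_flow \<nu> S"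
begin

lemma S_measurable [measurable (raw)]:
  assumes "f \<in> borel_measurable N" "g \<in> measurable N \<nu>"
  shows "(\<lambda>x. S (f x) (g x)) \<in> measurable N \<nu>"
proof -
  have "(\<lambda>(t, y). S t y) \<in> measurable (borel \<Otimes>\<^sub>M \<nu>) \<nu>" using flow by (simp add: mp_flow_def)
  from measurable_compose[OF measurable_Pair[OF assms] this] show ?thesis by simp
qed

lemma S_0 [simp]: "y \<in> space \<nu> \<Longrightarrow> S 0 y = y"
  using flow by (simp add: mp_flow_def)

lemma S_add: "y \<in> space \<nu> \<Longrightarrow> S t (S u y) = S (t + u) y"
  using flow by (simp add: mp_flow_def)

lemma S_space [simp]: "y \<in> space \<nu> \<Longrightarrow> S t y \<in> space \<nu>"
  using measurable_space[OF S_measurable[of "\<lambda>_. t" \<nu> "\<lambda>y. y"]] by simp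

lemma S_distr: "distr \<nu> \<nu> (S t) = \<nu>"
  using flow by (simp add: mp_flow_def)

lemma S_meas [measurable]: "S t \<in> measurable \<nu> \<nu>"
  using S_measurable[of "\<lambda>_. t" \<nu> "\<lambda>y. y"] by simp

lemma measure_S_vimage:
  assumes "A \<in> sets \<nu>"
  shows "measure \<nu> {y \<in> space \<nu>. S t y \<in> A} = measure \<nu> A"
  using measure_vimage_invariant[OF S_meas S_distr assms, of t]
  by (simp add: vimage_def Int_def conj_commute)

abbreviation "\<M> \<equiv> circle_measure \<Otimes>\<^sub>M \<nu>"

sublocale yc: pair_prob_space \<nu> circle_measure ..

text \<open>Joint measurability of the flow alone forces its continuity in measure. For fixed y the
  set of times t with S t y in C is a measurable subset of the line, and almost invariance of such
  sets under small translations is integrated over y by dominated convergence.\<close>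

lemma flow_mismatch_tendsto_0:
  assumes u: "u \<longlonglongrightarrow> 0" and C [measurable]: "C \<in> sets \<nu>"
  shows "(\<lambda>n. measure \<nu> {y \<in> space \<nu>. (S (u n) y \<in> C) \<noteq> (y \<in> C)}) \<longlonglongrightarrow> 0"
proof -
  define G where "G n y t = (if (S (t + u n) y \<in> C) \<noteq> (S t y \<in> C) then 1 else 0 :: real)" for n y t
  define I where "I n y = (\<integral>t. G n y t \<partial>circle_measure)" for n y
  have Gm [measurable]: "case_prod (G n) \<in> borel_measurable (\<nu> \<Otimes>\<^sub>M circle_measure)" for n
    unfolding G_def by measurable
  have GI: "integrable (\<nu> \<Otimes>\<^sub>M circle_measure) (case_prod (G n))" for n
    by (rule yc.integrable_const_bound[where B=1]) (auto simp: G_def)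
  have eq: "measure \<nu> {y \<in> space \<nu>. (S (u n) y \<in> C) \<noteq> (y \<in> C)} = (\<integral>y. I n y \<partial>\<nu>)" for n
  proof -
    \<comment> \<open>Averaging over time turns the mismatch into one for translations of the circle.\<close>
    have inner: "(\<integral>y. G n y t \<partial>\<nu>) = measure \<nu> {y \<in> space \<nu>. (S (u n) y \<in> C) \<noteq> (y \<in> C)}" for t
    proof -
      let ?D = "{y \<in> space \<nu>. (S (u n) y \<in> C) \<noteq> (y \<in> C)}"
      have "(\<integral>y. G n y t \<partial>\<nu>) = (\<integral>y. indicator {y \<in> space \<nu>. S t y \<in> ?D} y \<partial>\<nu>)"
        by (intro Bochner_Integration.integral_cong) (auto simp: G_def S_add add.commute indicator_def)
      also have "\<dots> = measure \<nu> {y \<in> space \<nu>. S t y \<in> ?D}" by simp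
      also have "\<dots> = measure \<nu> ?D" by (rule measure_S_vimage) measurable
      finally show ?thesis .
    qed
    have "(\<integral>y. I n y \<partial>\<nu>) = (\<integral>t. \<integral>y. G n y t \<partial>\<nu> \<partial>circle_measure)"
      unfolding I_def by (rule yc.Fubini_integral[OF GI, symmetric])
    also have "\<dots> = (\<integral>t. measure \<nu> {y \<in> space \<nu>. (S (u n) y \<in> C) \<noteq> (y \<in> C)} \<partial>circle_measure)"
      by (simp only: inner)
    also have "\<dots> = measure \<nu> {y \<in> space \<nu>. (S (u n) y \<in> C) \<noteq> (y \<in> C)}"
      by (simp add: circle.prob_space[simplified])
    finally show ?thesis by simp
  qed
  have Ilim: "(\<lambda>n. I n y) \<longlonglongrightarrow> 0" if y: "y \<in> space \<nu>" for y
  proof -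
    define B where "B = {t \<in> space circle_measure. S t y \<in> C}"
    have Bm [measurable]: "B \<in> sets circle_measure" unfolding B_def using y by measurable
    define a where "a n = measure circle_measure {t \<in> space circle_measure. (frac (t + u n) \<in> B) \<noteq> (t \<in> B)}" for n
    have bd: "I n y \<le> a n + \<bar>u n\<bar>" for n
    proof -
      have [measurable]: "{t \<in> {0..<1}. t + u n \<notin> {0..<1}} \<in> sets circle_measure"
        unfolding sets_circle_iff by auto
      have "I n y \<le> (\<integral>t. indicator ({t \<in> space circle_measure. (frac (t + u n) \<in> B) \<noteq> (t \<in> B)} \<union> {t \<in> {0..<1}. t + u n \<notin> {0..<1}}) t \<partial>circle_measure)"
        unfolding I_def
      proof (rule integral_mono)
        show "integrable circle_measure (G n y)"
          by (rule circle.integrable_const_bound[where B=1]) (use y in \<open>auto simp: G_def\<close>)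
        show "integrable circle_measure (indicator ({t \<in> space circle_measure. (frac (t + u n) \<in> B) \<noteq> (t \<in> B)} \<union> {t \<in> {0..<1}. t + u n \<notin> {0..<1}}) :: real \<Rightarrow> real)"
          by (rule circle.integrable_const_bound[where B=1]) (auto simp: indicator_def)
        fix t assume t: "t \<in> space circle_measure"
        show "G n y t \<le> indicator ({t \<in> space circle_measure. (frac (t + u n) \<in> B) \<noteq> (t \<in> B)} \<union> {t \<in> {0..<1}. t + u n \<notin> {0..<1}}) t"
        proof (cases "t + u n \<in> {0..<1}")
          case True
          then have "frac (t + u n) = t + u n" by (simp add: frac_eq)
          then show ?thesis using t True by (auto simp: G_def B_def indicator_def)
        next
          case False
          then show ?thesis using t by (auto simp: G_def indicator_def)
        qed
      qed
      also have "\<dots> = measure circle_measure ({t \<in> space circle_measure. (frac (t + u n) \<in> B) \<noteq> (t \<in> B)} \<union> {t \<in> {0..<1}. t + u n \<notin> {0..<1}})"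
        by simp (rule arg_cong[where f="measure circle_measure"], auto)
      also have "\<dots> \<le> a n + measure circle_measure {t \<in> {0..<1}. t + u n \<notin> {0..<1}}"
        unfolding a_def by (intro measure_Un_le) measurable
      also have "\<dots> \<le> a n + \<bar>u n\<bar>" using circle_overflow_le by simp
      finally show ?thesis .
    qed
    have "a \<longlonglongrightarrow> 0" unfolding a_def by (rule rotation_mismatch_tendsto_0[OF u Bm])
    then have "(\<lambda>n. a n + \<bar>u n\<bar>) \<longlonglongrightarrow> 0 + 0" by (intro tendsto_add tendsto_rabs_zero u)
    then have up: "(\<lambda>n. a n + \<bar>u n\<bar>) \<longlonglongrightarrow> 0" by simp
    have "0 \<le> I n y" for n unfolding I_def by (simp add: G_def)
    then show ?thesis
      by (intro tendsto_sandwich[OF _ _ tendsto_const up]) (use bd in \<open>auto intro!: always_eventually\<close>)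
  qed
  have "(\<lambda>n. \<integral>y. I n y \<partial>\<nu>) \<longlonglongrightarrow> (\<integral>y. 0 \<partial>\<nu>)"
  proof (rule integral_dominated_convergence[where w="\<lambda>_. 1"])
    show "I n \<in> borel_measurable \<nu>" for n
      unfolding I_def by (rule circle.borel_measurable_lebesgue_integral) simp
    show "AE y in \<nu>. (\<lambda>n. I n y) \<longlonglongrightarrow> 0" using Ilim by (intro AE_I2)
    have "\<bar>I n y\<bar> \<le> (\<integral>t. 1 \<partial>circle_measure)" if y: "y \<in> space \<nu>" for n y
      unfolding I_def
    proof (rule order.trans[OF integral_abs_bound integral_mono])
      show "integrable circle_measure (\<lambda>t. \<bar>G n y t\<bar>)"
        by (rule circle.integrable_const_bound[where B=1]) (use y in \<open>auto simp: G_def\<close>)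
    qed (auto simp: G_def)
    then show "AE y in \<nu>. norm (I n y) \<le> 1" for n
      by (intro AE_I2) (simp add: circle.prob_space[simplified])
  qed auto
  then show ?thesis by (simp only: eq) simp
qed

text \<open>The indicator is averaged along the orbit over a time window of length 1/(n+1). Moving y
  by time u shifts the window by the fraction (n+1) |u| of its length, which gives the Lipschitz
  constant, and short windows give L1 closeness. Such observables are needed because the fibre
  motions will be known only up to a small error in time.\<close>

lemma lipschitz_approx:
  assumes C [measurable]: "C \<in> sets \<nu>" and e: "0 < e"
  obtains f L where "f \<in> borel_measurable \<nu>" "\<And>y. 0 \<le> f y" "\<And>y. f y \<le> (1::real)" "0 \<le> L"
    "\<And>y u. y \<in> space \<nu> \<Longrightarrow> \<bar>f (S u y) - f y\<bar> \<le> L * \<bar>u\<bar>"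
    "(\<integral>y. \<bar>f y - indicator C y\<bar> \<partial>\<nu>) < e"
proof -
  define g :: "nat \<Rightarrow> 'b \<Rightarrow> real \<Rightarrow> real" where "g n y t = indicator C (S (t / Suc n) y)" for n y t
  define f where "f n y = (\<integral>t. g n y t \<partial>circle_measure)" for n y
  have gm [measurable]: "case_prod (g n) \<in> borel_measurable (\<nu> \<Otimes>\<^sub>M circle_measure)" for n
    unfolding g_def by measurable
  have g_ym: "g n y \<in> borel_measurable circle_measure" if "y \<in> space \<nu>" for n y
    unfolding g_def using that by measurable
  have gb: "0 \<le> g n y t" "g n y t \<le> 1" for n y t by (auto simp: g_def)
  have fm: "f n \<in> borel_measurable \<nu>" for n
    unfolding f_def by (rule circle.borel_measurable_lebesgue_integral) simp
  have f0: "0 \<le> f n y" for n y unfolding f_def by (simp add: gb)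
  \<comment> \<open>This bound is claimed for every y, also outside the space, where the integrand
    may fail to be integrable and the integral takes its default value 0.\<close>
  have f1: "f n y \<le> 1" for n y
  proof (cases "integrable circle_measure (g n y)")
    case True
    then have "f n y \<le> (\<integral>t. 1 \<partial>circle_measure)" unfolding f_def by (intro integral_mono) (auto simp: gb)
    then show ?thesis by (simp add: circle.prob_space[simplified])
  qed (simp add: f_def not_integrable_integral_eq)
  have gi: "integrable circle_measure (g n y)" if "y \<in> space \<nu>" for n y
    by (rule circle.integrable_const_bound[where B=1]) (use that g_ym gb in auto)
  have lip: "\<bar>f n (S u y) - f n y\<bar> \<le> real (Suc n) * \<bar>u\<bar>" if y: "y \<in> space \<nu>" for n u y
  proof -
    define v where "v = real (Suc n) * u"
    have sh: "g n (S u y) t = g n y (t + v)" for t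
      using y by (simp add: g_def v_def S_add add_divide_distrib)
    have gfrac: "integrable circle_measure (\<lambda>t. g n y (frac (t + v)))"
      using y by (intro circle.integrable_const_bound[where B=1] measurable_compose[OF rotation_measurable g_ym]) (auto simp: gb)
    have "f n y = (\<integral>t. g n y (frac (t + v)) \<partial>circle_measure)"
      unfolding f_def by (rule circle_integral_rotation[symmetric, OF g_ym[OF y]])
    moreover have "f n (S u y) = (\<integral>t. g n y (t + v) \<partial>circle_measure)"
      unfolding f_def sh ..
    moreover have gv: "integrable circle_measure (\<lambda>t. g n y (t + v))"
    proof -
      have "g n (S u y) = (\<lambda>t. g n y (t + v))" using sh by blast
      then show ?thesis using gi[of "S u y" n] y by simp
    qed
    ultimately have "\<bar>f n (S u y) - f n y\<bar> = \<bar>\<integral>t. g n y (t + v) - g n y (frac (t + v)) \<partial>circle_measure\<bar>"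
      using gfrac by simp
    also have "\<dots> \<le> (\<integral>t. indicator {t \<in> {0..<1}. t + v \<notin> {0..<1}} t \<partial>circle_measure)"
    proof (rule order.trans[OF integral_abs_bound integral_mono])
      show "integrable circle_measure (\<lambda>t. \<bar>g n y (t + v) - g n y (frac (t + v))\<bar>)"
        using gv gfrac by simp
      have "{t \<in> {0..<1}. t + v \<notin> {0..<1}} \<in> sets circle_measure"
        unfolding sets_circle_iff by auto
      then show "integrable circle_measure (indicator {t \<in> {0..<1}. t + v \<notin> {0..<1}} :: real \<Rightarrow> real)"
        by (intro circle.integrable_const_bound[where B=1]) (auto simp: indicator_def)
      fix t assume t: "t \<in> space circle_measure"
      show "\<bar>g n y (t + v) - g n y (frac (t + v))\<bar> \<le> indicator {t \<in> {0..<1}. t + v \<notin> {0..<1}} t"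
      proof (cases "t + v \<in> {0..<1}")
        case True
        then have "frac (t + v) = t + v" by (simp add: frac_eq)
        then show ?thesis by simp
      next
        case False
        then show ?thesis using t gb[of n y "t + v"] gb[of n y "frac (t + v)"] by (auto simp: indicator_def)
      qed
    qed
    also have "\<dots> = measure circle_measure {t \<in> {0..<1}. t + v \<notin> {0..<1}}"
      by simp (rule arg_cong[where f="measure circle_measure"], auto)
    also have "\<dots> \<le> \<bar>v\<bar>" by (rule circle_overflow_le)
    finally show ?thesis by (simp add: v_def abs_mult)
  qed
  define m where "m n t = (\<integral>y. \<bar>g n y t - indicator C y\<bar> \<partial>\<nu>)" for n t
  define h where "h n y t = \<bar>g n y t - indicator C y\<bar>" for n y t
  have hI: "integrable (\<nu> \<Otimes>\<^sub>M circle_measure) (case_prod (h n))" for n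
  proof (rule yc.integrable_const_bound[where B=1])
    show "case_prod (h n) \<in> borel_measurable (\<nu> \<Otimes>\<^sub>M circle_measure)" unfolding h_def g_def by measurable
  qed (auto simp: h_def g_def indicator_def)
  have le: "(\<integral>y. \<bar>f n y - indicator C y\<bar> \<partial>\<nu>) \<le> (\<integral>t. m n t \<partial>circle_measure)" for n
  proof -
    have "(\<integral>y. \<bar>f n y - indicator C y\<bar> \<partial>\<nu>) \<le> (\<integral>y. (\<integral>t. h n y t \<partial>circle_measure) \<partial>\<nu>)"
    proof (rule integral_mono)
      have "\<bar>f n y - indicator C y\<bar> \<le> 1" for y
        using f0[of n y] f1[of n y] by (auto simp: indicator_def)
      then show "integrable \<nu> (\<lambda>y. \<bar>f n y - indicator C y\<bar>)"
        using fm by (intro integrable_const_bound[where B=1]) auto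
      show "integrable \<nu> (\<lambda>y. \<integral>t. h n y t \<partial>circle_measure)"
        by (rule yc.integrable_fst'[OF hI, simplified])
      fix y assume y: "y \<in> space \<nu>"
      have "f n y - indicator C y = (\<integral>t. g n y t - indicator C y \<partial>circle_measure)"
        unfolding f_def using gi[OF y] by (simp add: circle.prob_space[simplified])
      then show "\<bar>f n y - indicator C y\<bar> \<le> (\<integral>t. h n y t \<partial>circle_measure)"
        unfolding h_def by (simp add: integral_abs_bound)
    qed
    also have "\<dots> = (\<integral>t. m n t \<partial>circle_measure)"
      unfolding m_def h_def[symmetric] by (rule yc.Fubini_integral[OF hI, symmetric])
    finally show ?thesis .
  qed
  have "(\<lambda>n. \<integral>t. m n t \<partial>circle_measure) \<longlonglongrightarrow> (\<integral>t. 0 \<partial>circle_measure)"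
  proof (rule integral_dominated_convergence[where w="\<lambda>_. 1"])
    show "m n \<in> borel_measurable circle_measure" for n
      using yc.integrable_snd[OF hI, of n] unfolding m_def h_def by simp
    have mt: "m n t = measure \<nu> {y \<in> space \<nu>. (S (t / Suc n) y \<in> C) \<noteq> (y \<in> C)}" for n t
    proof -
      have "m n t = (\<integral>y. indicator {y \<in> space \<nu>. (S (t / Suc n) y \<in> C) \<noteq> (y \<in> C)} y \<partial>\<nu>)"
        unfolding m_def by (intro Bochner_Integration.integral_cong) (auto simp: g_def indicator_def)
      then show ?thesis by simp
    qed
    show "AE t in circle_measure. (\<lambda>n. m n t) \<longlonglongrightarrow> 0"
    proof (rule AE_I2)
      fix t :: real
      have "(\<lambda>n. t / Suc n) \<longlonglongrightarrow> 0"
        using tendsto_mult_left[OF LIMSEQ_inverse_real_of_nat, of t] by (simp add: divide_inverse)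
      then show "(\<lambda>n. m n t) \<longlonglongrightarrow> 0" unfolding mt by (rule flow_mismatch_tendsto_0[OF _ C])
    qed
    show "AE t in circle_measure. norm (m n t) \<le> 1" for n by (intro AE_I2) (simp add: mt)
  qed auto
  then have lim: "(\<lambda>n. \<integral>t. m n t \<partial>circle_measure) \<longlonglongrightarrow> 0" by simp
  then obtain n where n: "(\<integral>t. m n t \<partial>circle_measure) < e"
    using order_tendstoD(2)[OF lim e] by (auto simp: eventually_sequentially)
  show ?thesis
    by (rule that[of "f n" "real (Suc n)"]) (use fm f0 f1 lip le_less_trans[OF le n] in auto)
qed

text \<open>
  The Fourier coefficients of \<open>t \<mapsto> 1\<^sub>A (S (\<tau> t) y)\<close>, a function of period 1, are eigenfunctions of the flow
  with rational eigenvalues. They vanish, except for the constant one, so that \<open>1\<^sub>A\<close> is constant.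
\<close>

lemma time_map_ergodic:
  assumes noeig: "\<forall>t. t \<in> \<rat> \<longrightarrow> \<not> flow_eigenvalue_L2_0 \<nu> S t"
    and \<tau>: "\<tau> \<in> \<rat>" "\<tau> \<noteq> 0" and A [measurable]: "A \<in> sets \<nu>" and inv: "S \<tau> -` A \<inter> space \<nu> = A"
  shows "measure \<nu> A = 0 \<or> measure \<nu> A = 1"
proof -
  define g :: "'b \<Rightarrow> real \<Rightarrow> complex" where "g y t = of_bool (S (\<tau> * t) y \<in> A)" for y t
  define h where "h m y = (\<integral>t. g y t * cis (2 * pi * of_int m * t) \<partial>circle_measure)" for m y
  have cm [measurable]: "(\<lambda>t. cis (2 * pi * of_int m * t)) \<in> borel_measurable borel" for m
    by (rule trig_poly_measurable[OF trig_poly.char])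
  have cmc [measurable]: "(\<lambda>t. cis (2 * pi * of_int m * t)) \<in> borel_measurable circle_measure" for m
    by (rule borel_measurable_circle) simp
  have gm: "(\<lambda>(y, t). g y t * cis (2 * pi * of_int m * t)) \<in> borel_measurable (\<nu> \<Otimes>\<^sub>M circle_measure)" for m
    unfolding g_def by measurable
  have gI: "integrable (\<nu> \<Otimes>\<^sub>M circle_measure) (\<lambda>(y, t). g y t * cis (2 * pi * of_int m * t))" for m
    by (rule yc.integrable_const_bound[where B=1]) (use gm in \<open>auto simp: g_def norm_mult\<close>)
  have gym: "g y \<in> borel_measurable circle_measure" if "y \<in> space \<nu>" for y
    unfolding g_def using that by measurable
  have period: "g y (t + of_int k) = g y t" if y: "y \<in> space \<nu>" for y t k
  proof -
    have step: "g y (t + 1) = g y t" for t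
    proof -
      have z: "S (\<tau> * t) y \<in> space \<nu>" using y by simp
      have "S (\<tau> * (t + 1)) y = S \<tau> (S (\<tau> * t) y)" using y by (simp add: S_add algebra_simps)
      moreover have "S \<tau> (S (\<tau> * t) y) \<in> A \<longleftrightarrow> S (\<tau> * t) y \<in> A" using inv z by auto
      ultimately show ?thesis by (simp add: g_def)
    qed
    show ?thesis
    proof (induction k rule: int_induct[where k=0])
      case (step1 i)
      then show ?case using step[of "t + of_int i"] by (simp add: algebra_simps)
    next
      case (step2 i)
      then show ?case using step[of "t + of_int (i - 1)"] by (simp add: algebra_simps)
    qed simp
  qed
  have hm [measurable]: "h m \<in> borel_measurable \<nu>" for m
    unfolding h_def by (rule circle.borel_measurable_lebesgue_integral) (use gm in simp)
  have hb: "norm (h m y) \<le> 1" if y: "y \<in> space \<nu>" for m y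
  proof -
    have "norm (h m y) \<le> (\<integral>t. 1 \<partial>circle_measure)"
      unfolding h_def
    proof (rule order.trans[OF integral_norm_bound integral_mono])
      show "integrable circle_measure (\<lambda>t. norm (g y t * cis (2 * pi * of_int m * t)))"
      proof (intro integrable_norm circle.integrable_const_bound[where B=1])
        show "(\<lambda>t. g y t * cis (2 * pi * of_int m * t)) \<in> borel_measurable circle_measure"
          using gym[OF y] by measurable
      qed (auto simp: g_def norm_mult)
    qed (auto simp: g_def norm_mult)
    then show ?thesis by (simp add: circle.prob_space[simplified])
  qed
  have hi: "integrable \<nu> (h m)" for m
    by (rule integrable_const_bound[where B=1]) (use hb in auto)
  have eig: "h m (S u y) = cis (2 * pi * (- of_int m / \<tau> * u)) * h m y" if y: "y \<in> space \<nu>" for m u y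
  proof -
    define v where "v = u / \<tau>"
    have sh: "g (S u y) t = g y (frac (t + v))" for t
    proof -
      have "g (S u y) t = g y (t + v)"
        using y \<tau> by (simp add: g_def S_add v_def distrib_left)
      also have "\<dots> = g y (frac (t + v))"
        using period[OF y, of "frac (t + v)" "\<lfloor>t + v\<rfloor>"] by (simp add: frac_def)
      finally show ?thesis .
    qed
    have "h m (S u y) = (\<integral>t. cis (- 2 * pi * of_int m * v) * (g y (frac (t + v)) * cis (2 * pi * of_int m * frac (t + v))) \<partial>circle_measure)"
      unfolding h_def sh cis_int_frac
      by (intro Bochner_Integration.integral_cong) (auto simp: cis_mult algebra_simps)
    also have "\<dots> = cis (- 2 * pi * of_int m * v) * (\<integral>t. g y (frac (t + v)) * cis (2 * pi * of_int m * frac (t + v)) \<partial>circle_measure)"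
      by simp
    also have "(\<integral>t. g y (frac (t + v)) * cis (2 * pi * of_int m * frac (t + v)) \<partial>circle_measure) = h m y"
      unfolding h_def by (rule circle_integral_rotation) (use gym[OF y] in measurable)
    finally show ?thesis by (simp add: v_def mult.assoc)
  qed
  \<comment> \<open>The bound 2 and the free integer m serve two uses: \<open>h m\<close> for m
    nonzero, and \<open>h 0 - c\<close>, an invariant function, that is, one with the rational
    eigenvalue 0.\<close>
  have eigenfunction_zero: "AE y in \<nu>. k y = 0"
    if km [measurable]: "k \<in> borel_measurable \<nu>" and kb: "\<And>y. y \<in> space \<nu> \<Longrightarrow> norm (k y) \<le> 2"
      and k0: "(\<integral>y. k y \<partial>\<nu>) = 0" and ke: "\<And>u y. y \<in> space \<nu> \<Longrightarrow> k (S u y) = cis (2 * pi * (- of_int m / \<tau> * u)) * k y"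
    for k and m :: int
  proof (rule ccontr)
    assume n: "\<not> (AE y in \<nu>. k y = 0)"
    have "(norm (k y))\<^sup>2 \<le> 2\<^sup>2" if "y \<in> space \<nu>" for y using kb[OF that] by (intro power_mono) auto
    then have "integrable \<nu> (\<lambda>y. (cmod (k y))\<^sup>2)"
      by (intro integrable_const_bound[where B="2\<^sup>2"]) auto
    then have "k \<in> L2_0 \<nu>" using k0 by (simp add: L2_0_def)
    moreover have "\<forall>u. AE y in \<nu>. k (S u y) = exp (2 * pi * \<i> * complex_of_real (- of_int m / \<tau> * u)) * k y"
      using ke by (intro allI AE_I2) (simp add: cis_conv_exp mult_ac)
    ultimately have "flow_eigenvalue_L2_0 \<nu> S (- of_int m / \<tau>)"
      using n unfolding flow_eigenvalue_L2_0_def by blast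
    moreover have "- of_int m / \<tau> \<in> \<rat>" using \<tau> by simp
    ultimately show False using noeig by blast
  qed
  have hz: "AE y in \<nu>. h m y = 0" if m: "m \<noteq> 0" for m
  proof (rule eigenfunction_zero)
    show "norm (h m y) \<le> 2" if "y \<in> space \<nu>" for y using hb[OF that, of m] by simp
    \<comment> \<open>Half a period of the eigenvalue: the flow at this time reverses the sign of
      \<open>h m\<close> while preserving its integral. The mean therefore vanishes, as membership
      in \<open>L2_0\<close> demands.\<close>
    define u where "u = \<tau> / (2 * of_int m)"
    have "cis (2 * pi * (- of_int m / \<tau> * u)) = -1"
    proof -
      have "2 * pi * (- of_int m / \<tau> * u) = - pi" using m \<tau> by (simp add: u_def field_simps)
      then show ?thesis by (simp add: complex_eq_iff)
    qed
    then have "h m (S u y) = - h m y" if "y \<in> space \<nu>" for y using eig[OF that, of m u] by simp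
    then have "(\<integral>y. h m (S u y) \<partial>\<nu>) = (\<integral>y. - h m y \<partial>\<nu>)"
      by (intro Bochner_Integration.integral_cong) auto
    moreover have "(\<integral>y. h m (S u y) \<partial>\<nu>) = (\<integral>y. h m y \<partial>\<nu>)"
      using integral_distr[OF S_meas hm, of u m] by (simp add: S_distr)
    ultimately show "(\<integral>y. h m y \<partial>\<nu>) = 0" by simp
  qed (use eig in auto)
  define c where "c = complex_of_real (measure \<nu> A)"
  have h0: "(\<integral>y. h 0 y \<partial>\<nu>) = c"
  proof -
    have inner: "(\<integral>y. g y t \<partial>\<nu>) = c" for t
    proof -
      have "(\<integral>y. g y t \<partial>\<nu>) = (\<integral>y. complex_of_real (indicator {y \<in> space \<nu>. S (\<tau> * t) y \<in> A} y) \<partial>\<nu>)"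
        by (intro Bochner_Integration.integral_cong) (auto simp: g_def indicator_def)
      also have "\<dots> = complex_of_real (measure \<nu> {y \<in> space \<nu>. S (\<tau> * t) y \<in> A})"
        by (subst integral_complex_of_real) simp
      finally show ?thesis by (simp add: measure_S_vimage[OF A] c_def)
    qed
    have "(\<integral>y. h 0 y \<partial>\<nu>) = (\<integral>t. \<integral>y. g y t \<partial>\<nu> \<partial>circle_measure)"
      unfolding h_def using yc.Fubini_integral[of "\<lambda>y t. g y t"] gI[of 0] by simp
    also have "\<dots> = (\<integral>t. c \<partial>circle_measure)" by (simp only: inner)
    finally show ?thesis by (simp add: circle.prob_space[simplified])
  qed
  have nc: "norm c \<le> 1" by (simp add: c_def)
  have hc: "AE y in \<nu>. h 0 y - c = 0"
  proof (rule eigenfunction_zero[of _ 0])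
    show "norm (h 0 y - c) \<le> 2" if "y \<in> space \<nu>" for y
      using norm_triangle_ineq4[of "h 0 y" c] hb[OF that, of 0] nc by linarith
    show "(\<integral>y. h 0 y - c \<partial>\<nu>) = 0" using hi[of 0] h0 by (simp add: prob_space)
  qed (use eig[of _ 0] in auto)
  have "AE y in \<nu>. \<forall>m. m \<noteq> 0 \<longrightarrow> h m y = 0"
    unfolding AE_all_countable using hz by (auto intro: AE_I2)
  then have "AE y in \<nu>. y \<in> space \<nu> \<and> (\<forall>m. m \<noteq> 0 \<longrightarrow> h m y = 0) \<and> h 0 y = c"
    using hc AE_space by eventually_elim auto
  then obtain y where y: "y \<in> space \<nu>" and ym: "\<And>m. m \<noteq> 0 \<Longrightarrow> h m y = 0" and y0: "h 0 y = c"
    using AE_witness by blast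
  \<comment> \<open>For this y all Fourier coefficients of t \<mapsto> g y t - c vanish. Hence g y t
    = c for almost every t, and since g only takes the values 0 and 1, so does c.\<close>
  have "AE t in circle_measure. g y t - c = 0"
  proof (rule fourier_uniqueness)
    show "(\<lambda>t. g y t - c) \<in> borel_measurable circle_measure" using gym[OF y] by simp
    show "norm (g y t - c) \<le> 2" for t
      using norm_triangle_ineq4[of "g y t" c] nc by (auto simp: g_def split: if_splits)
    have i1: "integrable circle_measure (\<lambda>t. g y t * cis (2 * pi * of_int m * t))" for m
    proof (rule circle.integrable_const_bound[where B=1])
      show "(\<lambda>t. g y t * cis (2 * pi * of_int m * t)) \<in> borel_measurable circle_measure"
        using gym[OF y] by measurable
    qed (auto simp: g_def norm_mult)
    have i2: "integrable circle_measure (\<lambda>t. cis (2 * pi * of_int m * t))" for m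
      by (rule trig_poly_integrable[OF trig_poly.char])
    show "(\<integral>t. (g y t - c) * cis (2 * pi * of_int m * t) \<partial>circle_measure) = 0" for m
    proof -
      have "(\<integral>t. (g y t - c) * cis (2 * pi * of_int m * t) \<partial>circle_measure)
        = h m y - c * (\<integral>t. cis (2 * pi * of_int m * t) \<partial>circle_measure)"
        unfolding h_def using i1[of m] i2[of m] by (simp add: left_diff_distrib)
      also have "\<dots> = 0"
      proof (cases "m = 0")
        case True
        then show ?thesis using y0 by (simp add: circle.prob_space[simplified])
      next
        case False
        then show ?thesis by (simp add: ym circle_integral_char)
      qed
      finally show ?thesis .
    qed
  qed
  then obtain t where "g y t - c = 0" using circle.AE_witness by blast
  then show ?thesis unfolding g_def c_def by (cases "S (\<tau> * t) y \<in> A") auto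
qed

end

text \<open>With V the conditional expectation of F, invariance of the base measure turns the
  difference into the integral of 1_E(\<sigma> n x) (V x - V (\<sigma> n x)). It is bounded by the
  L1 modulus of V along \<open>\<sigma> n\<close>, which does not involve E. This uniformity allows
  E to vary with n later.\<close>

lemma uniform_fibre_continuity:
  fixes F :: "'a \<Rightarrow> real"
  assumes fin: "finite_measure K" and \<pi>: "\<pi> \<in> measurable K \<Omega>" and F: "F \<in> borel_measurable K"
    and b: "\<And>p. p \<in> space K \<Longrightarrow> 0 \<le> F p" "\<And>p. p \<in> space K \<Longrightarrow> F p \<le> 1"
    and \<sigma>: "\<And>n::nat. \<sigma> n \<in> measurable \<Omega> \<Omega>"
    and inv: "\<And>n. distr (distr K \<Omega> \<pi>) (distr K \<Omega> \<pi>) (\<sigma> n) = distr K \<Omega> \<pi>"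
    and D: "\<And>B. B \<in> sets \<Omega> \<Longrightarrow> (\<lambda>n. measure (distr K \<Omega> \<pi>) {x \<in> space \<Omega>. (\<sigma> n x \<in> B) \<noteq> (x \<in> B)}) \<longlonglongrightarrow> 0"
  shows "\<exists>d. d \<longlonglongrightarrow> 0 \<and> (\<forall>n. \<forall>E\<in>sets \<Omega>.
    \<bar>(\<integral>p. indicator E (\<sigma> n (\<pi> p)) * F p \<partial>K) - (\<integral>p. indicator E (\<pi> p) * F p \<partial>K)\<bar> \<le> d n)"
proof -
  let ?\<rho> = "distr K \<Omega> \<pi>"
  have fin\<rho>: "finite_measure ?\<rho>" by (rule finite_measure.finite_measure_distr[OF fin \<pi>])
  have "\<exists>V. integrable ?\<rho> V \<and>
    (\<forall>B\<in>sets \<Omega>. (\<integral>p. indicator B (\<pi> p) * F p \<partial>K) = (\<integral>x. indicator B x * V x \<partial>?\<rho>))"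
    by (rule conditional_density[OF fin \<pi> F]) (use b in auto)
  then obtain V where V: "integrable ?\<rho> V"
    and eq: "\<And>B. B \<in> sets \<Omega> \<Longrightarrow> (\<integral>p. indicator B (\<pi> p) * F p \<partial>K) = (\<integral>x. indicator B x * V x \<partial>?\<rho>)"
    by blast
  have \<sigma>': "\<sigma> n \<in> measurable ?\<rho> ?\<rho>" for n using \<sigma>[of n] by simp
  note [measurable] = \<pi> \<sigma>
  have Vm [measurable]: "V \<in> borel_measurable \<Omega>" using V by auto
  define d where "d n = (\<integral>x. \<bar>V (\<sigma> n x) - V x\<bar> \<partial>?\<rho>)" for n
  have "d \<longlonglongrightarrow> 0" unfolding d_def
    by (rule L1_continuity_along_maps[OF fin\<rho> \<sigma>' inv _ V]) (use D in simp)
  moreover have "\<bar>(\<integral>p. indicator E (\<sigma> n (\<pi> p)) * F p \<partial>K) - (\<integral>p. indicator E (\<pi> p) * F p \<partial>K)\<bar> \<le> d n"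
    if E [measurable]: "E \<in> sets \<Omega>" for n E
  proof -
    have Vs: "integrable ?\<rho> (\<lambda>x. V (\<sigma> n x))"
      using integrable_distr[OF \<sigma>', of n V] V inv[of n] by simp
    have i1: "integrable ?\<rho> (\<lambda>x. indicator E (\<sigma> n x) * V x)"
      by (rule Bochner_Integration.integrable_bound[OF V]) (auto simp: indicator_def)
    have i2: "integrable ?\<rho> (\<lambda>x. indicator E (\<sigma> n x) * V (\<sigma> n x))"
      by (rule Bochner_Integration.integrable_bound[OF Vs]) (auto simp: indicator_def)
    have "(\<integral>p. indicator E (\<sigma> n (\<pi> p)) * F p \<partial>K) = (\<integral>p. indicator (\<sigma> n -` E \<inter> space \<Omega>) (\<pi> p) * F p \<partial>K)"
      using measurable_space[OF \<pi>] by (intro Bochner_Integration.integral_cong) (auto simp: indicator_def)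
    also have "\<dots> = (\<integral>x. indicator (\<sigma> n -` E \<inter> space \<Omega>) x * V x \<partial>?\<rho>)"
      by (rule eq) measurable
    also have "\<dots> = (\<integral>x. indicator E (\<sigma> n x) * V x \<partial>?\<rho>)"
      by (intro Bochner_Integration.integral_cong) (auto simp: indicator_def)
    finally have 1: "(\<integral>p. indicator E (\<sigma> n (\<pi> p)) * F p \<partial>K) = (\<integral>x. indicator E (\<sigma> n x) * V x \<partial>?\<rho>)" .
    have "(\<integral>p. indicator E (\<pi> p) * F p \<partial>K) = (\<integral>x. indicator E x * V x \<partial>?\<rho>)" by (rule eq[OF E])
    also have "\<dots> = (\<integral>x. indicator E (\<sigma> n x) * V (\<sigma> n x) \<partial>?\<rho>)"
      using integral_distr[OF \<sigma>', of "\<lambda>x. indicator E x * V x" n] by (simp add: inv)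
    finally have 2: "(\<integral>p. indicator E (\<pi> p) * F p \<partial>K) = (\<integral>x. indicator E (\<sigma> n x) * V (\<sigma> n x) \<partial>?\<rho>)" .
    have "\<bar>(\<integral>p. indicator E (\<sigma> n (\<pi> p)) * F p \<partial>K) - (\<integral>p. indicator E (\<pi> p) * F p \<partial>K)\<bar>
        = \<bar>\<integral>x. indicator E (\<sigma> n x) * V x - indicator E (\<sigma> n x) * V (\<sigma> n x) \<partial>?\<rho>\<bar>"
      unfolding 1 2 using i1 i2 by simp
    also have "\<dots> \<le> d n" unfolding d_def
    proof (rule order.trans[OF integral_abs_bound integral_mono])
      show "integrable ?\<rho> (\<lambda>x. \<bar>indicator E (\<sigma> n x) * V x - indicator E (\<sigma> n x) * V (\<sigma> n x)\<bar>)"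
        using i1 i2 by simp
      show "integrable ?\<rho> (\<lambda>x. \<bar>V (\<sigma> n x) - V x\<bar>)" using V Vs by simp
    qed (auto simp: indicator_def)
    finally show ?thesis .
  qed
  ultimately show ?thesis by blast
qed

text \<open>An ergodic T acting on one fibre coordinate alone, and preserving \<kappa>, makes that
  coordinate independent of all the others. For an event C in the other coordinates, the law of the
  fibre coordinate restricted to C is T-invariant and dominated by \<nu>; ergodicity makes it a
  multiple of \<nu>. Then \<kappa> is a product and Fubini applies.\<close>

lemma integral_fibre_average:
  fixes \<kappa> :: "(('a \<times> 'b) \<times> 'c) measure" and F :: "'a \<times> 'b \<Rightarrow> complex" and G :: "'c \<Rightarrow> complex"
  assumes p\<kappa>: "prob_space \<kappa>" and p\<nu>: "prob_space \<nu>"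
    and s: "sets \<kappa> = sets ((A \<Otimes>\<^sub>M \<nu>) \<Otimes>\<^sub>M N)" and marg: "distr \<kappa> \<nu> (\<lambda>p. snd (fst p)) = \<nu>"
    and T [measurable]: "T \<in> measurable \<nu> \<nu>" and T\<nu>: "distr \<nu> \<nu> T = \<nu>"
    and erg: "\<And>P. P \<in> sets \<nu> \<Longrightarrow> T -` P \<inter> space \<nu> = P \<Longrightarrow> measure \<nu> P = 0 \<or> measure \<nu> P = 1"
    and inv: "distr \<kappa> \<kappa> (\<lambda>p. ((fst (fst p), T (snd (fst p))), snd p)) = \<kappa>"
    and F [measurable]: "F \<in> borel_measurable (A \<Otimes>\<^sub>M \<nu>)" and G [measurable]: "G \<in> borel_measurable N"
    and int: "integrable \<kappa> (\<lambda>p. F (fst p) * G (snd p))"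
  shows "(\<integral>p. F (fst p) * G (snd p) \<partial>\<kappa>) = (\<integral>p. (\<integral>y. F (fst (fst p), y) \<partial>\<nu>) * G (snd p) \<partial>\<kappa>)"
proof -
  interpret K: prob_space \<kappa> by fact
  interpret \<nu>: prob_space \<nu> by fact
  have [measurable_cong]: "sets \<kappa> = sets ((A \<Otimes>\<^sub>M \<nu>) \<Otimes>\<^sub>M N)" by (rule s)
  have sp: "space \<kappa> = (space A \<times> space \<nu>) \<times> space N"
    using sets_eq_imp_space_eq[OF s] by (simp add: space_pair_measure)
  define b where "b p = (fst (fst p), snd p)" for p :: "('a \<times> 'b) \<times> 'c"
  define y where "y p = snd (fst p)" for p :: "('a \<times> 'b) \<times> 'c"
  define U where "U p = ((fst (fst p), T (snd (fst p))), snd p)" for p :: "('a \<times> 'b) \<times> 'c"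
  have bm [measurable]: "b \<in> measurable \<kappa> (A \<Otimes>\<^sub>M N)" unfolding b_def by measurable
  have ym [measurable]: "y \<in> measurable \<kappa> \<nu>" unfolding y_def by measurable
  have Um [measurable]: "U \<in> measurable \<kappa> \<kappa>" unfolding U_def by measurable
  have Uinv: "distr \<kappa> \<kappa> U = \<kappa>" using inv by (simp add: U_def[abs_def])
  define \<eta> where "\<eta> = distr \<kappa> (A \<Otimes>\<^sub>M N) b"
  interpret \<eta>: prob_space \<eta> unfolding \<eta>_def by (rule K.prob_space_distr[OF bm])
  have prod: "\<eta> \<Otimes>\<^sub>M \<nu> = distr \<kappa> ((A \<Otimes>\<^sub>M N) \<Otimes>\<^sub>M \<nu>) (\<lambda>p. (b p, y p))"
  proof (rule pair_measure_eqI)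
    show "sets (\<eta> \<Otimes>\<^sub>M \<nu>) = sets (distr \<kappa> ((A \<Otimes>\<^sub>M N) \<Otimes>\<^sub>M \<nu>) (\<lambda>p. (b p, y p)))"
      by (simp add: \<eta>_def cong: sets_pair_measure_cong)
    fix C B assume "C \<in> sets \<eta>" and B [measurable]: "B \<in> sets \<nu>"
    then have C [measurable]: "C \<in> sets (A \<Otimes>\<^sub>M N)" by (simp add: \<eta>_def)
    define c where "c = measure \<eta> C"
    have c: "0 \<le> c" "c = measure \<kappa> (b -` C \<inter> space \<kappa>)"
      by (auto simp: c_def \<eta>_def measure_distr)
    \<comment> \<open>\<open>M1\<close> is the law of the fibre coordinate on the event C, and
      \<open>M2\<close> is what independence predicts for it.\<close>
    define \<kappa>C where "\<kappa>C = density \<kappa> (indicator (b -` C \<inter> space \<kappa>))"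
    define M1 where "M1 = distr \<kappa>C \<nu> y"
    define M2 where "M2 = scale_measure (ennreal c) \<nu>"
    have yC: "y \<in> measurable \<kappa>C \<nu>" by (simp add: \<kappa>C_def)
    have M1: "emeasure M1 P = emeasure \<kappa> ((b -` C \<inter> space \<kappa>) \<inter> (y -` P \<inter> space \<kappa>))" if [measurable]: "P \<in> sets \<nu>" for P
    proof -
      have "emeasure M1 P = emeasure \<kappa>C (y -` P \<inter> space \<kappa>)"
        unfolding M1_def by (subst emeasure_distr[OF yC]) (auto simp: \<kappa>C_def)
      also have "\<dots> = (\<integral>\<^sup>+p. indicator (b -` C \<inter> space \<kappa>) p * indicator (y -` P \<inter> space \<kappa>) p \<partial>\<kappa>)"
        unfolding \<kappa>C_def by (subst emeasure_density) auto
      also have "\<dots> = (\<integral>\<^sup>+p. indicator ((b -` C \<inter> space \<kappa>) \<inter> (y -` P \<inter> space \<kappa>)) p \<partial>\<kappa>)"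
        by (intro nn_integral_cong) (auto split: split_indicator)
      also have "\<dots> = emeasure \<kappa> ((b -` C \<inter> space \<kappa>) \<inter> (y -` P \<inter> space \<kappa>))"
        by (rule nn_integral_indicator) measurable
      finally show ?thesis .
    qed
    have m1: "measure M1 P = measure \<kappa> ((b -` C \<inter> space \<kappa>) \<inter> (y -` P \<inter> space \<kappa>))" if "P \<in> sets \<nu>" for P
      using M1[OF that] by (simp add: measure_def)
    have m2: "measure M2 P = c * measure \<nu> P" for P
      by (simp add: M2_def measure_scale_measure c)
    have s1: "sets M1 = sets \<nu>" "space M1 = space \<nu>" by (auto simp: M1_def)
    have s2: "sets M2 = sets \<nu>" "space M2 = space \<nu>" by (auto simp: M2_def space_scale_measure)
    have "M1 = M2"
    proof (rule ccontr)
      assume ne: "M1 \<noteq> M2"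
      have f1: "finite_measure M1"
        by standard (simp add: s1 M1)
      have f2: "finite_measure M2"
        by standard (simp add: M2_def space_scale_measure \<nu>.emeasure_space_1)
      have TM1: "T \<in> measurable M1 M1" using T by (simp add: measurable_def s1)
      have i1: "distr M1 M1 T = M1"
      proof (rule measure_eqI)
        fix P assume "P \<in> sets (distr M1 M1 T)"
        then have P [measurable]: "P \<in> sets \<nu>" by (simp add: s1)
        have "emeasure (distr M1 M1 T) P = emeasure M1 (T -` P \<inter> space \<nu>)"
          using P by (subst emeasure_distr[OF TM1]) (auto simp: s1)
        also have "\<dots> = emeasure \<kappa> ((b -` C \<inter> space \<kappa>) \<inter> (y -` (T -` P \<inter> space \<nu>) \<inter> space \<kappa>))"
          by (rule M1) measurable
        also have "(b -` C \<inter> space \<kappa>) \<inter> (y -` (T -` P \<inter> space \<nu>) \<inter> space \<kappa>)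
          = U -` ((b -` C \<inter> space \<kappa>) \<inter> (y -` P \<inter> space \<kappa>)) \<inter> space \<kappa>"
          using measurable_space[OF Um] measurable_space[OF ym] by (auto simp: U_def b_def y_def)
        also have "emeasure \<kappa> \<dots> = emeasure (distr \<kappa> \<kappa> U) ((b -` C \<inter> space \<kappa>) \<inter> (y -` P \<inter> space \<kappa>))"
          by (subst emeasure_distr[OF Um]) auto
        also have "\<dots> = emeasure M1 P" by (simp add: Uinv M1)
        finally show "emeasure (distr M1 M1 T) P = emeasure M1 P" .
      qed simp
      have i2: "distr M2 M2 T = M2"
      proof (rule measure_eqI)
        fix P assume "P \<in> sets (distr M2 M2 T)"
        then have P [measurable]: "P \<in> sets \<nu>" by (simp add: s2)
        have TM2: "T \<in> measurable M2 M2" using T by (simp add: measurable_def s2)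
        have "emeasure (distr M2 M2 T) P = emeasure M2 (T -` P \<inter> space \<nu>)"
          using P by (subst emeasure_distr[OF TM2]) (auto simp: s2)
        also have "\<dots> = ennreal c * emeasure (distr \<nu> \<nu> T) P"
          by (subst emeasure_distr[OF T P]) (simp add: M2_def)
        also have "\<dots> = emeasure M2 P" by (simp add: M2_def T\<nu>)
        finally show "emeasure (distr M2 M2 T) P = emeasure M2 P" .
      qed simp
      have mass: "measure M1 (space M1) = measure M2 (space M1)"
      proof -
        have "y -` space \<nu> \<inter> space \<kappa> = space \<kappa>" using measurable_space[OF ym] by auto
        then show ?thesis unfolding m2 s1 s2 by (simp add: m1 c(2) \<nu>.prob_space Int_assoc)
      qed
      have s12: "sets M2 = sets M1" by (simp add: s1 s2)
      obtain P where P: "P \<in> sets M1" "T -` P \<inter> space M1 = P" and lt: "measure M2 P < measure M1 P"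
        by (rule distinct_invariant_measures_invariant_set[OF f1 f2 s12 TM1 i1 i2 mass ne])
      have Pn [measurable]: "P \<in> sets \<nu>" "T -` P \<inter> space \<nu> = P" using P by (auto simp: s1)
      have le1: "measure M1 P \<le> measure \<nu> P"
      proof -
        have "measure M1 P \<le> measure \<kappa> (y -` P \<inter> space \<kappa>)"
          unfolding m1[OF Pn(1)] by (intro K.finite_measure_mono) auto
        also have "\<dots> = measure (distr \<kappa> \<nu> y) P" by (subst measure_distr) auto
        also have "\<dots> = measure \<nu> P" using marg by (simp add: y_def[abs_def])
        finally show ?thesis .
      qed
      have le2: "measure M1 P \<le> c"
        unfolding m1[OF Pn(1)] c(2) by (intro K.finite_measure_mono) auto
      \<comment> \<open>If \<nu> P = 0 then M1 P \<le> \<nu> P = 0; if \<nu> P = 1 then M1 P \<le> c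
        = M2 P. Either way M2 P < M1 P fails.\<close>
      show False using erg[OF Pn] lt le1 le2 unfolding m2 by auto
    qed
    then have "emeasure M1 B = emeasure M2 B" by simp
    then have e: "emeasure \<kappa> ((b -` C \<inter> space \<kappa>) \<inter> (y -` B \<inter> space \<kappa>)) = ennreal c * emeasure \<nu> B"
      by (simp add: M1 M2_def)
    have "emeasure (distr \<kappa> ((A \<Otimes>\<^sub>M N) \<Otimes>\<^sub>M \<nu>) (\<lambda>p. (b p, y p))) (C \<times> B)
      = emeasure \<kappa> ((\<lambda>p. (b p, y p)) -` (C \<times> B) \<inter> space \<kappa>)"
      by (rule emeasure_distr) auto
    also have "(\<lambda>p. (b p, y p)) -` (C \<times> B) \<inter> space \<kappa> = (b -` C \<inter> space \<kappa>) \<inter> (y -` B \<inter> space \<kappa>)" by auto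
    finally show "emeasure \<eta> C * emeasure \<nu> B = emeasure (distr \<kappa> ((A \<Otimes>\<^sub>M N) \<Otimes>\<^sub>M \<nu>) (\<lambda>p. (b p, y p))) (C \<times> B)"
      using e by (simp add: c_def \<eta>.emeasure_eq_measure)
  qed (use \<eta>.sigma_finite_measure_axioms \<nu>.sigma_finite_measure_axioms in auto)
  interpret \<eta>\<nu>: pair_prob_space \<eta> \<nu> ..
  define H where "H = (\<lambda>(z, y). F (fst z, y) * G (snd z))"
  have [measurable_cong]: "sets \<eta> = sets (A \<Otimes>\<^sub>M N)" by (simp add: \<eta>_def)
  have Hm: "H \<in> borel_measurable ((A \<Otimes>\<^sub>M N) \<Otimes>\<^sub>M \<nu>)" unfolding H_def by measurable
  have pm: "(\<lambda>p. (b p, y p)) \<in> measurable \<kappa> ((A \<Otimes>\<^sub>M N) \<Otimes>\<^sub>M \<nu>)" by measurable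
  have Hby: "H (b p, y p) = F (fst p) * G (snd p)" for p by (simp add: H_def b_def y_def)
  have Hi: "integrable (\<eta> \<Otimes>\<^sub>M \<nu>) H"
    unfolding prod by (subst integrable_distr_eq[OF pm Hm]) (simp add: Hby int)
  have inner [measurable]: "(\<lambda>x. \<integral>y. F (x, y) \<partial>\<nu>) \<in> borel_measurable A"
    by (rule \<nu>.borel_measurable_lebesgue_integral) simp
  have "(\<integral>p. F (fst p) * G (snd p) \<partial>\<kappa>) = (\<integral>z. H z \<partial>(\<eta> \<Otimes>\<^sub>M \<nu>))"
    unfolding prod by (subst integral_distr[OF pm Hm]) (simp add: Hby)
  also have "\<dots> = (\<integral>z. \<integral>y. H (z, y) \<partial>\<nu> \<partial>\<eta>)" by (rule \<eta>\<nu>.integral_fst'[OF Hi, symmetric])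
  also have "\<dots> = (\<integral>z. (\<integral>y. F (fst z, y) \<partial>\<nu>) * G (snd z) \<partial>\<eta>)"
    by (simp add: H_def)
  also have "\<dots> = (\<integral>p. (\<integral>y. F (fst (b p), y) \<partial>\<nu>) * G (snd (b p)) \<partial>\<kappa>)"
    unfolding \<eta>_def by (rule integral_distr[OF bm]) measurable
  finally show ?thesis by (simp add: b_def)
qed

section \<open>Joinings of powers of the skew product\<close>

definition skew :: "real \<Rightarrow> (real \<Rightarrow> 'b \<Rightarrow> 'b) \<Rightarrow> real \<times> 'b \<Rightarrow> real \<times> 'b" where
  "skew \<alpha> S = (\<lambda>(x, y). (frac (x + \<alpha>), S (frac x - 1 / 2) y))"

lemma frac_frac_add: "frac (frac x + y) = frac (x + y :: real)"
  by (rule frac_cong_int) (simp add: frac_def)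

lemma (in prob_space) distr_pair_snd:
  assumes "prob_space N"
  shows "distr (N \<Otimes>\<^sub>M M) M snd = M"
proof (rule measure_eqI)
  interpret N: prob_space N by fact
  fix B assume "B \<in> sets (distr (N \<Otimes>\<^sub>M M) M snd)"
  then have B: "B \<in> sets M" by simp
  have "emeasure (distr (N \<Otimes>\<^sub>M M) M snd) B = emeasure (N \<Otimes>\<^sub>M M) (snd -` B \<inter> space (N \<Otimes>\<^sub>M M))"
    using B by (subst emeasure_distr) auto
  also have "snd -` B \<inter> space (N \<Otimes>\<^sub>M M) = space N \<times> B"
    using sets.sets_into_space[OF B] by (auto simp: space_pair_measure)
  also have "emeasure (N \<Otimes>\<^sub>M M) \<dots> = emeasure M B"
    using B by (subst emeasure_pair_measure_Times) (auto simp: N.emeasure_space_1)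
  finally show "emeasure (distr (N \<Otimes>\<^sub>M M) M snd) B = emeasure M B" .
qed simp

context prob_flow
begin

lemma skew_measurable [measurable]: "skew \<alpha> S \<in> measurable \<M> \<M>"
proof -
  have [measurable]: "frac \<in> borel_measurable circle_measure" by (rule borel_measurable_circle) simp
  show ?thesis unfolding skew_def by measurable
qed

lemma skew_funpow:
  assumes "x \<in> {0..<1}" "y \<in> space \<nu>"
  shows "(skew \<alpha> S ^^ n) (x, y) = (frac (x + real n * \<alpha>), S (birkhoff \<alpha> n x) y)"
proof (induction n)
  case 0
  then show ?case using assms by (simp add: frac_eq)
next
  case (Suc n)
  have "birkhoff \<alpha> (Suc n) x = (frac (x + real n * \<alpha>) - 1 / 2) + birkhoff \<alpha> n x"
    by (simp add: birkhoff_def)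
  moreover have "(skew \<alpha> S ^^ Suc n) (x, y) = skew \<alpha> S (frac (x + real n * \<alpha>), S (birkhoff \<alpha> n x) y)"
    by (simp only: funpow.simps o_apply Suc)
  ultimately show ?case using assms
    by (simp add: skew_def frac_frac_add S_add distrib_right add_ac)
qed

end

locale flow_joining = prob_flow \<nu> S for \<nu> :: "'b measure" and S +
  fixes \<alpha> :: real and r s :: nat and \<kappa> :: "((real \<times> 'b) \<times> (real \<times> 'b)) measure"
  assumes joining: "\<kappa> \<in> ergodic_joinings \<M> (skew \<alpha> S) r s"
begin

definition "Q = (\<lambda>(p, q). ((skew \<alpha> S ^^ r) p, (skew \<alpha> S ^^ s) q))"
definition base :: "(real \<times> 'b) \<times> (real \<times> 'b) \<Rightarrow> real \<times> real" where
  "base p = (fst (fst p), fst (snd p))"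
text \<open>The speeds r and s make \<open>Q\<close> cover \<open>rot \<alpha>\<close> on the base,
  so that both base coordinates are driven by one time parameter.\<close>

definition rot :: "real \<Rightarrow> real \<times> real \<Rightarrow> real \<times> real" where
  "rot t b = (frac (fst b + real r * t), frac (snd b + real s * t))"
definition fib :: "real \<Rightarrow> real \<Rightarrow> (real \<times> 'b) \<times> (real \<times> 'b) \<Rightarrow> (real \<times> 'b) \<times> (real \<times> 'b)" where
  "fib t u p = ((fst (fst p), S t (snd (fst p))), (fst (snd p), S u (snd (snd p))))"
abbreviation "\<Omega> \<equiv> circle_measure \<Otimes>\<^sub>M circle_measure"
definition "\<rho> = distr \<kappa> \<Omega> base"

lemma sets_kappa [measurable_cong]: "sets \<kappa> = sets (\<M> \<Otimes>\<^sub>M \<M>)"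
  using joining by (simp add: ergodic_joinings_def)

lemma space_kappa: "space \<kappa> = ({0..<1} \<times> space \<nu>) \<times> ({0..<1} \<times> space \<nu>)"
  using sets_eq_imp_space_eq[OF sets_kappa] by (simp add: space_pair_measure)

sublocale K: prob_space \<kappa>
  using joining by (simp add: ergodic_joinings_def)

lemma marginals:
  "distr \<kappa> \<M> fst = circle_measure \<Otimes>\<^sub>M \<nu>"
  "distr \<kappa> \<M> snd = circle_measure \<Otimes>\<^sub>M \<nu>"
  using joining by (simp_all add: ergodic_joinings_def)

lemma Q_measurable [measurable]: "Q \<in> measurable \<kappa> \<kappa>"
proof -
  have [measurable]: "skew \<alpha> S ^^ n \<in> measurable \<M> \<M>" for n
    by (induction n) (auto intro: measurable_comp skew_measurable simp: id_def)
  show ?thesis unfolding Q_def by measurable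
qed

lemma Q_distr: "distr \<kappa> \<kappa> Q = \<kappa>"
  using joining by (simp add: ergodic_joinings_def Q_def)

lemma ergodic: "P \<in> sets \<kappa> \<Longrightarrow> Q -` P \<inter> space \<kappa> = P \<Longrightarrow> measure \<kappa> P = 0 \<or> measure \<kappa> P = 1"
  using joining unfolding ergodic_joinings_def Q_def by blast

lemmas Q_funpow = distr_funpow[OF Q_measurable Q_distr]

lemma base_measurable [measurable]: "base \<in> measurable \<kappa> \<Omega>"
  unfolding base_def by measurable

lemma rot_measurable [measurable]: "rot t \<in> measurable \<Omega> \<Omega>"
  unfolding rot_def by measurable

lemma fib_measurable [measurable]: "fib t u \<in> measurable \<kappa> \<kappa>"
  unfolding fib_def by measurable

lemma space_base: "space \<Omega> = {0..<1} \<times> {0..<1}"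
  by (simp add: space_pair_measure)

lemma base_space: "p \<in> space \<kappa> \<Longrightarrow> base p \<in> {0..<1} \<times> {0..<1}"
  by (auto simp: space_kappa base_def)

lemma base_fib [simp]: "base (fib t u p) = base p"
  by (simp add: base_def fib_def)

lemma fib_fib: "p \<in> space \<kappa> \<Longrightarrow> fib t u (fib t' u' p) = fib (t + t') (u + u') p"
  by (auto simp: fib_def space_kappa S_add)

lemma fib_0 [simp]: "p \<in> space \<kappa> \<Longrightarrow> fib 0 0 p = p"
  by (auto simp: fib_def space_kappa)

lemma rot_add: "rot t (rot u b) = rot (t + u) b"
  by (simp add: rot_def frac_frac_add algebra_simps)

lemma rot_0 [simp]: "b \<in> {0..<1} \<times> {0..<1} \<Longrightarrow> rot 0 b = b"
  by (auto simp: rot_def frac_eq)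

lemma rot_space: "rot t b \<in> {0..<1} \<times> {0..<1}"
  by (simp add: rot_def frac_ge_0 frac_lt_1)

text \<open>The speeds r and s are integers, so the motion has period 1 in t. A long orbit time k
  \<alpha> can therefore be replaced by its small fractional part.\<close>

lemma rot_cong_int: "t - u \<in> \<int> \<Longrightarrow> rot t b = rot u b"
proof -
  assume tu: "t - u \<in> \<int>"
  have "real k * t - real k * u \<in> \<int>" for k :: nat
    using Ints_mult[OF Ints_of_nat tu, of k] by (simp add: right_diff_distrib)
  then show ?thesis by (auto simp: rot_def intro!: frac_cong_int)
qed

lemma Q_funpow_eq:
  assumes "p \<in> space \<kappa>"
  shows "(Q ^^ n) p = ((fst (rot (real n * \<alpha>) (base p)), S (birkhoff \<alpha> (r * n) (fst (base p))) (snd (fst p))),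
    (snd (rot (real n * \<alpha>) (base p)), S (birkhoff \<alpha> (s * n) (snd (base p))) (snd (snd p))))"
proof -
  have "Q ^^ n = (\<lambda>(p, q). ((skew \<alpha> S ^^ (r * n)) p, (skew \<alpha> S ^^ (s * n)) q))" for n
  proof (induction n)
    case (Suc n)
    have "skew \<alpha> S ^^ (k * Suc n) = (skew \<alpha> S ^^ k) \<circ> (skew \<alpha> S ^^ (k * n))" for k
      by (simp add: funpow_add)
    moreover have "Q ^^ Suc n = Q \<circ> (\<lambda>(p, q). ((skew \<alpha> S ^^ (r * n)) p, (skew \<alpha> S ^^ (s * n)) q))"
      by (simp only: funpow.simps Suc)
    ultimately show ?case by (simp only: Q_def) auto
  qed (simp add: fun_eq_iff)
  then show ?thesis using assms
    by (auto simp: space_kappa skew_funpow base_def rot_def mult.assoc)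
qed

lemma base_Q: "p \<in> space \<kappa> \<Longrightarrow> base ((Q ^^ n) p) = rot (real n * \<alpha>) (base p)"
  by (simp add: Q_funpow_eq base_def)

text \<open>The cocycle depends on the base alone and times of one flow commute. Consequently the
  image of \<open>\<kappa>\<close> under a fibre motion is again \<open>Q\<close>-invariant and can
  be compared with \<open>\<kappa>\<close>.\<close>

lemma fib_Q: "p \<in> space \<kappa> \<Longrightarrow> fib t u (Q p) = Q (fib t u p)"
proof -
  assume p: "p \<in> space \<kappa>"
  then have "fib t u p \<in> space \<kappa>" using measurable_space[OF fib_measurable] by blast
  then show ?thesis
    using Q_funpow_eq[OF p, of 1] Q_funpow_eq[of "fib t u p" 1] p
    by (auto simp: fib_def base_def space_kappa S_add add.commute)
qed

sublocale rho: prob_space \<rho>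
  unfolding \<rho>_def by (rule K.prob_space_distr[OF base_measurable])

lemma sets_rho [measurable_cong, simp]: "sets \<rho> = sets \<Omega>" by (simp add: \<rho>_def)
lemma space_rho [simp]: "space \<rho> = {0..<1} \<times> {0..<1}" by (simp add: \<rho>_def space_base)

lemma rho_rot_orbit: "distr \<rho> \<rho> (rot (real n * \<alpha>)) = \<rho>"
proof -
  have "distr \<rho> \<rho> (rot (real n * \<alpha>)) = distr \<rho> \<Omega> (rot (real n * \<alpha>))" by (rule distr_cong) auto
  also have "\<dots> = distr \<kappa> \<Omega> (rot (real n * \<alpha>) \<circ> base)" unfolding \<rho>_def by (rule distr_distr) auto
  also have "\<dots> = distr \<kappa> \<Omega> (base \<circ> (Q ^^ n))"
    by (rule distr_cong) (auto simp: base_Q)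
  also have "\<dots> = distr (distr \<kappa> \<kappa> (Q ^^ n)) \<Omega> base"
    by (rule distr_distr[symmetric]) (auto intro: Q_funpow)
  also have "\<dots> = \<rho>" by (simp add: Q_funpow \<rho>_def)
  finally show ?thesis .
qed

lemma rho_rot:
  assumes "t - real n * \<alpha> \<in> \<int>"
  shows "distr \<rho> \<rho> (rot t) = \<rho>"
proof -
  have "rot t = rot (real n * \<alpha>)" using rot_cong_int[OF assms] by blast
  then show ?thesis by (simp add: rho_rot_orbit)
qed

lemma rho_marginals:
  "distr \<rho> circle_measure fst = circle_measure" "distr \<rho> circle_measure snd = circle_measure"
proof -
  have "distr \<rho> circle_measure fst = distr \<kappa> circle_measure (fst \<circ> base)"
    unfolding \<rho>_def by (rule distr_distr) auto
  also have "fst \<circ> base = fst \<circ> fst" by (auto simp: base_def)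
  also have "distr \<kappa> circle_measure (fst \<circ> fst) = distr (distr \<kappa> \<M> fst) circle_measure fst"
    by (rule distr_distr[symmetric]) auto
  finally show "distr \<rho> circle_measure fst = circle_measure" by (simp add: marginals distr_pair_fst)
  have "distr \<rho> circle_measure snd = distr \<kappa> circle_measure (snd \<circ> base)"
    unfolding \<rho>_def by (rule distr_distr) auto
  also have "snd \<circ> base = fst \<circ> snd" by (auto simp: base_def)
  also have "distr \<kappa> circle_measure (fst \<circ> snd) = distr (distr \<kappa> \<M> snd) circle_measure fst"
    by (rule distr_distr[symmetric]) auto
  finally show "distr \<rho> circle_measure snd = circle_measure" by (simp add: marginals distr_pair_fst)
qed

lemma fibre_marginals:
  "distr \<kappa> \<nu> (\<lambda>p. snd (fst p)) = \<nu>" "distr \<kappa> \<nu> (\<lambda>p. snd (snd p)) = \<nu>"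
proof -
  have "distr (distr \<kappa> \<M> fst) \<nu> snd = distr \<kappa> \<nu> (snd \<circ> fst)"
    "distr (distr \<kappa> \<M> snd) \<nu> snd = distr \<kappa> \<nu> (snd \<circ> snd)"
    by (rule distr_distr; auto)+
  then show "distr \<kappa> \<nu> (\<lambda>p. snd (fst p)) = \<nu>" "distr \<kappa> \<nu> (\<lambda>p. snd (snd p)) = \<nu>"
    by (simp_all add: marginals distr_pair_snd prob_space_circle comp_def)
qed

lemma rho_measure_fst: "B \<in> sets circle_measure \<Longrightarrow> measure \<rho> {b \<in> space \<rho>. fst b \<in> B} = measure circle_measure B"
  using measure_distr[of fst \<rho> circle_measure B]
  by (simp add: rho_marginals vimage_def Int_def conj_commute)

lemma rho_measure_snd: "B \<in> sets circle_measure \<Longrightarrow> measure \<rho> {b \<in> space \<rho>. snd b \<in> B} = measure circle_measure B"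
  using measure_distr[of snd \<rho> circle_measure B]
  by (simp add: rho_marginals vimage_def Int_def conj_commute)

text \<open>Rectangles generate the sigma-algebra, and the mismatch of a rectangle is at most the
  sum of the mismatches of its sides under the two marginals. Thus nothing about the coupling of the
  base points enters.\<close>

lemma rot_mismatch_tendsto_0:
  assumes orb: "\<And>n. \<delta> n - real (k n) * \<alpha> \<in> \<int>" and \<delta>: "\<delta> \<longlonglongrightarrow> 0" and B: "B \<in> sets \<Omega>"
  shows "(\<lambda>n. measure \<rho> {b \<in> space \<rho>. (rot (\<delta> n) b \<in> B) \<noteq> (b \<in> B)}) \<longlonglongrightarrow> 0"
proof (rule mismatch_tendsto_0_sigma)
  show "finite_measure \<rho>" by (rule rho.finite_measure_axioms)
  show "rot (\<delta> n) \<in> measurable \<rho> \<rho>" for n by measurable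
  show "distr \<rho> \<rho> (rot (\<delta> n)) = \<rho>" for n by (rule rho_rot[OF orb])
  show "sets \<rho> = sigma_sets (space \<rho>) {a \<times> b | a b. a \<in> sets circle_measure \<and> b \<in> sets circle_measure}"
    by (simp add: sets_pair_measure)
  show "B \<in> sets \<rho>" using B by simp
  fix B assume "B \<in> {a \<times> b | a b. a \<in> sets circle_measure \<and> b \<in> sets circle_measure}"
  then obtain a c where B: "B = a \<times> c" and [measurable]: "a \<in> sets circle_measure" "c \<in> sets circle_measure" by blast
  define m where "m k a n = measure circle_measure {x \<in> space circle_measure. (frac (x + real k * \<delta> n) \<in> a) \<noteq> (x \<in> a)}" for k a n
  have "m k a \<longlonglongrightarrow> 0" if "a \<in> sets circle_measure" for k a
    unfolding m_def using tendsto_mult_left[OF \<delta>, of "real k"] that by (intro rotation_mismatch_tendsto_0) auto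
  then have "(\<lambda>n. m r a n + m s c n) \<longlonglongrightarrow> 0 + 0" by (intro tendsto_add) auto
  then have up: "(\<lambda>n. m r a n + m s c n) \<longlonglongrightarrow> 0" by simp
  have bd: "measure \<rho> {b \<in> space \<rho>. (rot (\<delta> n) b \<in> B) \<noteq> (b \<in> B)} \<le> m r a n + m s c n" for n
  proof -
    let ?X = "{x \<in> space circle_measure. (frac (x + real r * \<delta> n) \<in> a) \<noteq> (x \<in> a)}"
    let ?Y = "{x \<in> space circle_measure. (frac (x + real s * \<delta> n) \<in> c) \<noteq> (x \<in> c)}"
    have [measurable]: "?X \<in> sets circle_measure" "?Y \<in> sets circle_measure" by measurable
    have "measure \<rho> {b \<in> space \<rho>. (rot (\<delta> n) b \<in> B) \<noteq> (b \<in> B)}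
      \<le> measure \<rho> ({b \<in> space \<rho>. fst b \<in> ?X} \<union> {b \<in> space \<rho>. snd b \<in> ?Y})"
    proof (rule rho.finite_measure_mono)
      have *: "{b \<in> space \<rho>. fst b \<in> X} \<in> sets \<rho>" "{b \<in> space \<rho>. snd b \<in> X} \<in> sets \<rho>"
        if [measurable]: "X \<in> sets circle_measure" for X by measurable
      show "{b \<in> space \<rho>. fst b \<in> ?X} \<union> {b \<in> space \<rho>. snd b \<in> ?Y} \<in> sets \<rho>"
        by (intro sets.Un *) measurable
    qed (auto simp: B rot_def)
    also have "\<dots> \<le> measure \<rho> {b \<in> space \<rho>. fst b \<in> ?X} + measure \<rho> {b \<in> space \<rho>. snd b \<in> ?Y}"
      by (rule measure_Un_le) measurable
    finally show ?thesis by (simp only: rho_measure_fst rho_measure_snd m_def \<open>?X \<in> _\<close> \<open>?Y \<in> _\<close>)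
  qed
  show "(\<lambda>n. measure \<rho> {b \<in> space \<rho>. (rot (\<delta> n) b \<in> B) \<noteq> (b \<in> B)}) \<longlonglongrightarrow> 0"
    by (intro tendsto_sandwich[OF _ _ tendsto_const up]) (use bd in \<open>auto intro!: always_eventually\<close>)
qed

end

section \<open>Invariance of joinings along jumps of the cocycle\<close>

lemma abs_mult_diff_le:
  fixes a b c d :: real
  assumes "0 \<le> a" "a \<le> 1" "0 \<le> b" "b \<le> 1" "0 \<le> c" "c \<le> 1" "0 \<le> d" "d \<le> 1"
  shows "\<bar>a * b - c * d\<bar> \<le> \<bar>a - c\<bar> + \<bar>b - d\<bar>"
proof -
  have "\<bar>a * b - c * d\<bar> = \<bar>(a - c) * b + c * (b - d)\<bar>" by (simp add: algebra_simps)
  also have "\<dots> \<le> \<bar>a - c\<bar> * \<bar>b\<bar> + \<bar>c\<bar> * \<bar>b - d\<bar>"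
    by (rule order.trans[OF abs_triangle_ineq]) (simp add: abs_mult)
  also have "\<dots> \<le> \<bar>a - c\<bar> * 1 + 1 * \<bar>b - d\<bar>"
    using assms by (intro add_mono mult_mono) auto
  finally show ?thesis by simp
qed

lemma (in prob_space) integral_diff_le:
  fixes f g :: "'a \<Rightarrow> real"
  assumes "integrable M f" "integrable M g" "X \<in> sets M"
    and "\<And>x. x \<in> space M \<Longrightarrow> \<bar>f x - g x\<bar> \<le> c * indicator X x"
  shows "\<bar>(\<integral>x. f x \<partial>M) - (\<integral>x. g x \<partial>M)\<bar> \<le> c * measure M X"
proof -
  have "\<bar>(\<integral>x. f x \<partial>M) - (\<integral>x. g x \<partial>M)\<bar> = \<bar>\<integral>x. f x - g x \<partial>M\<bar>"
    using assms by simp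
  also have "\<dots> \<le> (\<integral>x. c * indicator X x \<partial>M)"
  proof (rule order.trans[OF integral_abs_bound integral_mono])
    show "integrable M (\<lambda>x. c * indicator X x)"
      using assms(3) by (intro integrable_mult_right) (simp add: less_top[symmetric])
  qed (use assms in auto)
  also have "\<dots> = c * measure M X" using assms(3) by simp
  finally show ?thesis .
qed

context flow_joining
begin

text \<open>Regularity is asked only along orbits of the flow, as \<nu> lives on a space without a
  metric. The range [0, 1] makes products of two such functions Lipschitz in both times with the
  same constants.\<close>

definition lip :: "('b \<Rightarrow> real) \<Rightarrow> real \<Rightarrow> bool" where
  "lip f L \<longleftrightarrow> f \<in> borel_measurable \<nu> \<and> (\<forall>y. 0 \<le> f y \<and> f y \<le> 1) \<and> 0 \<le> L \<and>
    (\<forall>y\<in>space \<nu>. \<forall>u. \<bar>f (S u y) - f y\<bar> \<le> L * \<bar>u\<bar>)"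

definition obs :: "('b \<Rightarrow> real) \<Rightarrow> ('b \<Rightarrow> real) \<Rightarrow> (real \<times> 'b) \<times> (real \<times> 'b) \<Rightarrow> real" where
  "obs f g p = f (snd (fst p)) * g (snd (snd p))"

lemma obs_measurable [measurable]:
  assumes f: "f \<in> borel_measurable \<nu>" and g: "g \<in> borel_measurable \<nu>"
  shows "obs f g \<in> borel_measurable \<kappa>"
proof -
  have y: "(\<lambda>p. snd (fst p)) \<in> measurable \<kappa> \<nu>" "(\<lambda>p. snd (snd p)) \<in> measurable \<kappa> \<nu>"
    by measurable
  show ?thesis unfolding obs_def
    by (rule borel_measurable_times[OF measurable_compose[OF y(1) f] measurable_compose[OF y(2) g]])
qed

lemma obs_range:
  assumes "lip f L" "lip g L'"
  shows "0 \<le> obs f g p" "obs f g p \<le> 1"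
  using assms by (auto simp: obs_def lip_def intro: mult_le_one)

lemma obs_lip:
  assumes f: "lip f L" and g: "lip g L'" and p: "p \<in> space \<kappa>"
  shows "\<bar>obs f g (fib t u p) - obs f g (fib t' u' p)\<bar> \<le> L * \<bar>t - t'\<bar> + L' * \<bar>u - u'\<bar>"
proof -
  obtain x y x' y' where pe: "p = ((x, y), (x', y'))" by (metis surj_pair)
  have y: "y \<in> space \<nu>" "y' \<in> space \<nu>" using p by (auto simp: pe space_kappa)
  have *: "\<bar>h (S t y) - h (S t' y)\<bar> \<le> L * \<bar>t - t'\<bar>" if "lip h L" "y \<in> space \<nu>" for h L t t' y
  proof -
    have "\<bar>h (S (t - t') (S t' y)) - h (S t' y)\<bar> \<le> L * \<bar>t - t'\<bar>"
      using that by (auto simp: lip_def)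
    then show ?thesis using that by (simp add: S_add)
  qed
  let ?a = "f (S t y)" and ?c = "f (S t' y)" and ?b = "g (S u y')" and ?d = "g (S u' y')"
  have "\<bar>?a * ?b - ?c * ?d\<bar> \<le> \<bar>?a - ?c\<bar> + \<bar>?b - ?d\<bar>"
    by (rule abs_mult_diff_le) (use f g in \<open>auto simp: lip_def\<close>)
  also have "\<dots> \<le> L * \<bar>t - t'\<bar> + L' * \<bar>u - u'\<bar>"
    using *[OF f y(1), of t t'] *[OF g y(2), of u u'] by simp
  finally show ?thesis by (simp add: obs_def fib_def pe)
qed

lemma obs_Q:
  assumes "p \<in> space \<kappa>"
  shows "obs f g (fib t u ((Q ^^ n) p))
    = obs f g (fib (t + birkhoff \<alpha> (r * n) (fst (base p))) (u + birkhoff \<alpha> (s * n) (snd (base p))) p)"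
  using assms by (auto simp: Q_funpow_eq obs_def fib_def space_kappa S_add)

lemma integral_Q_funpow:
  assumes "h \<in> borel_measurable \<kappa>"
  shows "(\<integral>p. h ((Q ^^ n) p) \<partial>\<kappa>) = (\<integral>p. h p \<partial>\<kappa> :: real)"
  using integral_distr[OF Q_funpow(1) assms, of n] by (simp add: Q_funpow(2))

lemma integrable_01:
  assumes "h \<in> borel_measurable \<kappa>" "\<And>p. p \<in> space \<kappa> \<Longrightarrow> 0 \<le> h p" "\<And>p. p \<in> space \<kappa> \<Longrightarrow> h p \<le> (1::real)"
  shows "integrable \<kappa> h"
  by (rule K.integrable_const_bound[where B=1]) (use assms in auto)

lemma birkhoff_rot:
  "birkhoff \<alpha> n (fst (rot t b)) = birkhoff \<alpha> n (fst b + real r * t)"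
  "birkhoff \<alpha> n (snd (rot t b)) = birkhoff \<alpha> n (snd b + real s * t)"
  by (auto simp: rot_def frac_def intro!: birkhoff_cong_int)

text \<open>
  On \<open>A\<close> the fibre motion of \<open>Q ^^ q\<close> is nearly \<open>fib a a'\<close>, so invariance under \<open>Q ^^ q\<close> trades \<open>obs f g\<close> for
  the fixed observable \<open>obs f g \<circ> fib (- a) (- a')\<close>, to which the base shift can be applied by \<open>dev\<close>.
  Going back, the shifted base point sees the cocycle changed by \<open>(w, w')\<close>.
\<close>

lemma cell_estimate:
  assumes f: "lip f L" and g: "lip g L'" and A: "A \<in> sets \<Omega>"
    and near: "\<And>b. b \<in> A \<Longrightarrow> \<bar>birkhoff \<alpha> (r * q) (fst b) - a\<bar> \<le> \<eta>"
      "\<And>b. b \<in> A \<Longrightarrow> \<bar>birkhoff \<alpha> (s * q) (snd b) - a'\<bar> \<le> \<eta>"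
    and jump: "\<And>b. b \<in> A \<Longrightarrow> birkhoff \<alpha> (r * q) (fst b + real r * \<delta>) = birkhoff \<alpha> (r * q) (fst b) + w"
      "\<And>b. b \<in> A \<Longrightarrow> birkhoff \<alpha> (s * q) (snd b + real s * \<delta>) = birkhoff \<alpha> (s * q) (snd b) + w'"
    and orb: "\<delta> - real k * \<alpha> \<in> \<int>"
    and dev: "\<And>E. E \<in> sets \<Omega> \<Longrightarrow> \<bar>(\<integral>p. indicator E (rot \<delta> (base p)) * obs f g (fib (-a) (-a') p) \<partial>\<kappa>)
        - (\<integral>p. indicator E (base p) * obs f g (fib (-a) (-a') p) \<partial>\<kappa>)\<bar> \<le> d"
  shows "\<bar>(\<integral>p. indicator A (base p) * obs f g p \<partial>\<kappa>)
      - (\<integral>p. indicator A (rot (-\<delta>) (base p)) * obs f g (fib v v' p) \<partial>\<kappa>)\<bar>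
    \<le> (2 * (L + L') * \<eta> + (L * \<bar>w - v\<bar> + L' * \<bar>w' - v'\<bar>)) * measure \<rho> A + d"
proof -
  note [measurable] = A
  have [measurable]: "f \<in> borel_measurable \<nu>" "g \<in> borel_measurable \<nu>" using f g by (auto simp: lip_def)
  have L: "0 \<le> L" "0 \<le> L'" using f g by (auto simp: lip_def)
  have [measurable]: "Q ^^ q \<in> measurable \<kappa> \<kappa>" by (rule Q_funpow)
  define Fa where "Fa p = obs f g (fib (-a) (-a') p)" for p
  have [measurable]: "Fa \<in> borel_measurable \<kappa>" unfolding Fa_def by measurable
  have Fa: "0 \<le> Fa p" "Fa p \<le> 1" for p using obs_range[OF f g] by (auto simp: Fa_def)
  have bsp: "base p \<in> {0..<1} \<times> {0..<1}" if "p \<in> space \<kappa>" for p using base_space[OF that] .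
  have int: "integrable \<kappa> (\<lambda>p. indicator B (h (base p)) * H (j p) :: real)"
    if [measurable]: "B \<in> sets \<Omega>" "h \<in> measurable \<Omega> \<Omega>" "j \<in> measurable \<kappa> \<kappa>" "H \<in> borel_measurable \<kappa>"
      and "\<And>p. 0 \<le> H p \<and> H p \<le> 1" for B h H j
    by (rule integrable_01) (use that in \<open>auto simp: indicator_def\<close>)
  \<comment> \<open>\<open>E\<close> is the set A carried along by the base motion of Q^q, and
    \<open>E'\<close> is \<open>E\<close> carried further by the shift \<delta>. The deviation
    hypothesis is applied to \<open>E'\<close>.\<close>
  define E where "E = {b \<in> space \<Omega>. rot (- real q * \<alpha>) b \<in> A}"
  have [measurable]: "E \<in> sets \<Omega>" unfolding E_def by measurable
  define E' where "E' = {b \<in> space \<Omega>. rot (- \<delta>) b \<in> E}"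
  have [measurable]: "E' \<in> sets \<Omega>" unfolding E'_def by measurable
  have FaQ: "Fa ((Q ^^ q) p) = obs f g (fib (birkhoff \<alpha> (r * q) (fst (base p)) - a) (birkhoff \<alpha> (s * q) (snd (base p)) - a') p)"
    if "p \<in> space \<kappa>" for p
    unfolding Fa_def using obs_Q[OF that, of f g "-a" "-a'" q] by simp
  have 1: "\<bar>(\<integral>p. indicator A (base p) * obs f g p \<partial>\<kappa>) - (\<integral>p. indicator A (base p) * Fa ((Q ^^ q) p) \<partial>\<kappa>)\<bar>
    \<le> ((L + L') * \<eta>) * measure \<kappa> {p \<in> space \<kappa>. base p \<in> A}"
  proof (rule K.integral_diff_le)
    show "integrable \<kappa> (\<lambda>p. indicator A (base p) * obs f g p)"
      using int[of A "\<lambda>x. x" "\<lambda>x. x" "obs f g"] obs_range[OF f g] by simp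
    show "integrable \<kappa> (\<lambda>p. indicator A (base p) * Fa ((Q ^^ q) p))"
      using int[of A "\<lambda>x. x" "Q ^^ q" Fa] Fa by simp
    fix p assume p: "p \<in> space \<kappa>"
    show "\<bar>indicator A (base p) * obs f g p - indicator A (base p) * Fa ((Q ^^ q) p)\<bar>
      \<le> (L + L') * \<eta> * indicator {p \<in> space \<kappa>. base p \<in> A} p"
    proof (cases "base p \<in> A")
      case True
      have "\<bar>obs f g (fib 0 0 p) - Fa ((Q ^^ q) p)\<bar> \<le>
         L * \<bar>0 - (birkhoff \<alpha> (r * q) (fst (base p)) - a)\<bar> + L' * \<bar>0 - (birkhoff \<alpha> (s * q) (snd (base p)) - a')\<bar>"
        unfolding FaQ[OF p] by (rule obs_lip[OF f g p])
      also have "\<dots> \<le> L * \<eta> + L' * \<eta>"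
        using near[OF True] L by (intro add_mono mult_left_mono) auto
      finally show ?thesis using True p by (simp add: distrib_right)
    qed simp
  qed measurable
  have 2: "(\<integral>p. indicator A (base p) * Fa ((Q ^^ q) p) \<partial>\<kappa>) = (\<integral>p. indicator E (base p) * Fa p \<partial>\<kappa>)"
  proof -
    have "(\<integral>p. indicator A (base p) * Fa ((Q ^^ q) p) \<partial>\<kappa>) = (\<integral>p. indicator E (base ((Q ^^ q) p)) * Fa ((Q ^^ q) p) \<partial>\<kappa>)"
    proof (rule Bochner_Integration.integral_cong[OF refl])
      fix p assume p: "p \<in> space \<kappa>"
      have "base ((Q ^^ q) p) \<in> E \<longleftrightarrow> base p \<in> A"
        using rot_space bsp[OF p] by (simp add: base_Q[OF p] E_def rot_add space_base)
      then show "indicator A (base p) * Fa ((Q ^^ q) p) = indicator E (base ((Q ^^ q) p)) * Fa ((Q ^^ q) p)"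
        by (simp add: indicator_def)
    qed
    also have "\<dots> = (\<integral>p. indicator E (base p) * Fa p \<partial>\<kappa>)"
      by (rule integral_Q_funpow) measurable
    finally show ?thesis .
  qed
  have 3: "\<bar>(\<integral>p. indicator E (base p) * Fa p \<partial>\<kappa>) - (\<integral>p. indicator E (rot (-\<delta>) (base p)) * Fa p \<partial>\<kappa>)\<bar> \<le> d"
  proof -
    have "(\<integral>p. indicator E' (rot \<delta> (base p)) * Fa p \<partial>\<kappa>) = (\<integral>p. indicator E (base p) * Fa p \<partial>\<kappa>)"
      using bsp rot_space by (intro Bochner_Integration.integral_cong[OF refl]) (auto simp: E'_def rot_add space_base indicator_def)
    moreover have "(\<integral>p. indicator E' (base p) * Fa p \<partial>\<kappa>) = (\<integral>p. indicator E (rot (-\<delta>) (base p)) * Fa p \<partial>\<kappa>)"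
      using bsp by (intro Bochner_Integration.integral_cong[OF refl]) (auto simp: E'_def space_base indicator_def)
    ultimately show ?thesis using dev[of E'] by (simp add: Fa_def)
  qed
  have 4: "(\<integral>p. indicator E (rot (-\<delta>) (base p)) * Fa p \<partial>\<kappa>) = (\<integral>p. indicator A (rot (-\<delta>) (base p)) * Fa ((Q ^^ q) p) \<partial>\<kappa>)"
  proof -
    have "(\<integral>p. indicator A (rot (-\<delta>) (base p)) * Fa ((Q ^^ q) p) \<partial>\<kappa>)
      = (\<integral>p. indicator E (rot (-\<delta>) (base ((Q ^^ q) p))) * Fa ((Q ^^ q) p) \<partial>\<kappa>)"
    proof (rule Bochner_Integration.integral_cong[OF refl])
      fix p assume p: "p \<in> space \<kappa>"
      have "rot (-\<delta>) (base ((Q ^^ q) p)) \<in> E \<longleftrightarrow> rot (-\<delta>) (base p) \<in> A"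
        using rot_space by (simp add: base_Q[OF p] E_def rot_add space_base)
      then show "indicator A (rot (-\<delta>) (base p)) * Fa ((Q ^^ q) p) = indicator E (rot (-\<delta>) (base ((Q ^^ q) p))) * Fa ((Q ^^ q) p)"
        by (simp add: indicator_def)
    qed
    also have "\<dots> = (\<integral>p. indicator E (rot (-\<delta>) (base p)) * Fa p \<partial>\<kappa>)"
      by (rule integral_Q_funpow) measurable
    finally show ?thesis by simp
  qed
  \<comment> \<open>The base point is now rot \<delta> b' with b' in A. Its cocycle values exceed
    those at b' by exactly w and w', so after subtraction of a and a' the fibre times are w and w'
    up to \<eta>. Together with step 1 this accounts for the factor 2 in front of (L + L')
    \<eta>.\<close>
  have 5: "\<bar>(\<integral>p. indicator A (rot (-\<delta>) (base p)) * Fa ((Q ^^ q) p) \<partial>\<kappa>)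
      - (\<integral>p. indicator A (rot (-\<delta>) (base p)) * obs f g (fib v v' p) \<partial>\<kappa>)\<bar>
    \<le> ((L + L') * \<eta> + (L * \<bar>w - v\<bar> + L' * \<bar>w' - v'\<bar>)) * measure \<kappa> {p \<in> space \<kappa>. rot (-\<delta>) (base p) \<in> A}"
  proof (rule K.integral_diff_le)
    show "integrable \<kappa> (\<lambda>p. indicator A (rot (-\<delta>) (base p)) * Fa ((Q ^^ q) p))"
      using int[of A "rot (-\<delta>)" "Q ^^ q" Fa] Fa by simp
    show "integrable \<kappa> (\<lambda>p. indicator A (rot (-\<delta>) (base p)) * obs f g (fib v v' p))"
      using int[of A "rot (-\<delta>)" "fib v v'" "obs f g"] obs_range[OF f g] by simp
    fix p assume p: "p \<in> space \<kappa>"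
    show "\<bar>indicator A (rot (-\<delta>) (base p)) * Fa ((Q ^^ q) p) - indicator A (rot (-\<delta>) (base p)) * obs f g (fib v v' p)\<bar>
      \<le> ((L + L') * \<eta> + (L * \<bar>w - v\<bar> + L' * \<bar>w' - v'\<bar>)) * indicator {p \<in> space \<kappa>. rot (-\<delta>) (base p) \<in> A} p"
    proof (cases "rot (-\<delta>) (base p) \<in> A")
      case True
      define b' where "b' = rot (-\<delta>) (base p)"
      have b: "base p = rot \<delta> b'" using bsp[OF p] by (simp add: b'_def rot_add)
      have b': "b' \<in> A" using True by (simp add: b'_def)
      have e1: "birkhoff \<alpha> (r * q) (fst (base p)) = birkhoff \<alpha> (r * q) (fst b') + w"
        unfolding b birkhoff_rot by (rule jump(1)[OF b'])
      have e2: "birkhoff \<alpha> (s * q) (snd (base p)) = birkhoff \<alpha> (s * q) (snd b') + w'"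
        unfolding b birkhoff_rot by (rule jump(2)[OF b'])
      have "\<bar>Fa ((Q ^^ q) p) - obs f g (fib v v' p)\<bar> \<le>
         L * \<bar>(birkhoff \<alpha> (r * q) (fst (base p)) - a) - v\<bar> + L' * \<bar>(birkhoff \<alpha> (s * q) (snd (base p)) - a') - v'\<bar>"
        unfolding FaQ[OF p] by (rule obs_lip[OF f g p])
      also have "\<dots> \<le> L * (\<eta> + \<bar>w - v\<bar>) + L' * (\<eta> + \<bar>w' - v'\<bar>)"
        using near[OF b'] L unfolding e1 e2 by (intro add_mono mult_left_mono) auto
      finally show ?thesis using True p by (simp add: algebra_simps)
    qed simp
  qed measurable
  have m1: "measure \<kappa> {p \<in> space \<kappa>. base p \<in> A} = measure \<rho> A"
    unfolding \<rho>_def by (subst measure_distr) (auto simp: vimage_def Int_def conj_commute)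
  have m2: "measure \<kappa> {p \<in> space \<kappa>. rot (-\<delta>) (base p) \<in> A} = measure \<rho> A"
  proof -
    define X where "X = {b \<in> space \<Omega>. rot (-\<delta>) b \<in> A}"
    have X [measurable]: "X \<in> sets \<Omega>" unfolding X_def by measurable
    have "measure \<rho> X = measure \<kappa> (base -` X \<inter> space \<kappa>)"
      unfolding \<rho>_def by (rule measure_distr) measurable
    also have "base -` X \<inter> space \<kappa> = {p \<in> space \<kappa>. rot (-\<delta>) (base p) \<in> A}"
      using bsp by (auto simp: X_def space_base)
    finally have "measure \<kappa> {p \<in> space \<kappa>. rot (-\<delta>) (base p) \<in> A} = measure \<rho> X" ..
    also have "\<dots> = measure \<rho> (rot \<delta> -` X \<inter> space \<rho>)"
      by (rule measure_vimage_invariant[symmetric]) (use rho_rot[OF orb] in auto)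
    also have "rot \<delta> -` X \<inter> space \<rho> = A"
      using sets.sets_into_space[OF A] rot_space by (auto simp: X_def space_base rot_add)
    finally show ?thesis .
  qed
  show ?thesis using 1 3 5 unfolding 2 4 m1 m2 by (simp add: algebra_simps)
qed

end

text \<open>This interface separates the arithmetic of the sawtooth from the measure theory: along
  vanishing orbit shifts \<open>\<delta> n\<close>, the cocycle of length \<open>q n\<close> changes
  by a constant vector on the set \<open>A n\<close>. The bound C is the same for all n, so that a
  fixed finite grid of cocycle values serves every n; only the limit (v, v') of the jump vectors has
  to be independent of n.\<close>

locale jump_sequence = flow_joining \<nu> S \<alpha> r s \<kappa>
  for \<nu> :: "'b measure" and S \<alpha> r s \<kappa> +
  fixes q k :: "nat \<Rightarrow> nat" and \<delta> :: "nat \<Rightarrow> real" and A :: "nat \<Rightarrow> (real \<times> real) set"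
    and w w' :: "nat \<Rightarrow> real" and v v' C :: real
  assumes orbit: "\<And>n. \<delta> n - real (k n) * \<alpha> \<in> \<int>" and \<delta>_0: "\<delta> \<longlonglongrightarrow> 0"
    and A_sets [measurable]: "\<And>n. A n \<in> sets \<Omega>"
    and bound: "\<And>n b. b \<in> A n \<Longrightarrow> \<bar>birkhoff \<alpha> (r * q n) (fst b)\<bar> \<le> C"
      "\<And>n b. b \<in> A n \<Longrightarrow> \<bar>birkhoff \<alpha> (s * q n) (snd b)\<bar> \<le> C"
    and jump: "\<And>n b. b \<in> A n \<Longrightarrow> birkhoff \<alpha> (r * q n) (fst b + real r * \<delta> n) = birkhoff \<alpha> (r * q n) (fst b) + w n"
      "\<And>n b. b \<in> A n \<Longrightarrow> birkhoff \<alpha> (s * q n) (snd b + real s * \<delta> n) = birkhoff \<alpha> (s * q n) (snd b) + w' n"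
    and w_lim: "w \<longlonglongrightarrow> v" "w' \<longlonglongrightarrow> v'"
begin

lemma deviation:
  fixes H :: "(real \<times> 'b) \<times> (real \<times> 'b) \<Rightarrow> real"
  assumes "H \<in> borel_measurable \<kappa>" "\<And>p. 0 \<le> H p" "\<And>p. H p \<le> 1"
  shows "\<exists>d. d \<longlonglongrightarrow> 0 \<and> (\<forall>n. \<forall>E\<in>sets \<Omega>. \<bar>(\<integral>p. indicator E (rot (\<delta> n) (base p)) * H p \<partial>\<kappa>)
    - (\<integral>p. indicator E (base p) * H p \<partial>\<kappa>)\<bar> \<le> d n)"
proof (rule uniform_fibre_continuity[of \<kappa> base \<Omega> H "\<lambda>n. rot (\<delta> n)"])
  show "finite_measure \<kappa>" by (rule K.finite_measure_axioms)
  show "distr (distr \<kappa> \<Omega> base) (distr \<kappa> \<Omega> base) (rot (\<delta> n)) = distr \<kappa> \<Omega> base" for n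
    using rho_rot[OF orbit] by (simp add: \<rho>_def)
  show "(\<lambda>n. measure (distr \<kappa> \<Omega> base) {x \<in> space \<Omega>. (rot (\<delta> n) x \<in> B) \<noteq> (x \<in> B)}) \<longlonglongrightarrow> 0" if "B \<in> sets \<Omega>" for B
    using rot_mismatch_tendsto_0[OF orbit \<delta>_0 that] unfolding space_rho space_base unfolding \<rho>_def .
qed (use assms in auto)

text \<open>The set \<open>A n \<inter> B\<close> is cut into cells on which both cocycle values lie
  within \<eta> of a grid point. The grid points range over a finite set not depending on n, so only
  finitely many shifted observables occur and their deviations tend to 0 together. The cells are
  disjoint, so the errors proportional to their measures add up to at most the error of a single
  cell of measure 1.\<close>

lemma lip_mismatch_tendsto_0:
  assumes f: "lip f L" and g: "lip g L'" and B [measurable]: "B \<in> sets \<Omega>"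
  shows "(\<lambda>n. (\<integral>p. indicator (A n \<inter> B) (base p) * obs f g p \<partial>\<kappa>)
    - (\<integral>p. indicator (A n \<inter> B) (base p) * obs f g (fib v v' p) \<partial>\<kappa>)) \<longlonglongrightarrow> 0"
proof (rule LIMSEQ_I)
  fix e :: real assume e: "0 < e"
  have [measurable]: "f \<in> borel_measurable \<nu>" "g \<in> borel_measurable \<nu>" using f g by (auto simp: lip_def)
  have L: "0 \<le> L" "0 \<le> L'" using f g by (auto simp: lip_def)
  \<comment> \<open>The factor 8 makes the grid error 2 (L + L') \<eta> at most e/4; the summand 1
    keeps the denominator positive.\<close>
  define \<eta> where "\<eta> = e / (8 * (L + L' + 1))"
  have \<eta>: "0 < \<eta>" using e L by (simp add: \<eta>_def)
  have L\<eta>: "2 * (L + L') * \<eta> \<le> e / 4"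
  proof -
    have "8 * (L + L') * e \<le> 8 * (L + L' + 1) * e" using L e by (intro mult_right_mono) auto
    then show ?thesis using L by (simp add: \<eta>_def field_simps)
  qed
  define Kc where "Kc = \<lceil>C / \<eta>\<rceil> + 1"
  define I where "I = {-Kc..Kc} \<times> {-Kc..Kc}"
  have fI: "finite I" by (simp add: I_def)
  define W where "W n b = (\<lfloor>birkhoff \<alpha> (r * q n) (fst b) / \<eta>\<rfloor>, \<lfloor>birkhoff \<alpha> (s * q n) (snd b) / \<eta>\<rfloor>)" for n b
  define cell where "cell n x = {b \<in> space \<Omega>. b \<in> A n \<inter> B \<and> W n b = x}" for n x
  have bm [measurable]: "birkhoff \<alpha> m \<in> borel_measurable circle_measure" for m
    by (rule borel_measurable_circle) simp
  have cell_sets [measurable]: "cell n x \<in> sets \<Omega>" for n x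
  proof -
    have "cell n x = {b \<in> space \<Omega>. b \<in> A n \<inter> B \<and> \<lfloor>birkhoff \<alpha> (r * q n) (fst b) / \<eta>\<rfloor> = fst x \<and> \<lfloor>birkhoff \<alpha> (s * q n) (snd b) / \<eta>\<rfloor> = snd x}"
      by (auto simp: cell_def W_def)
    also have "\<dots> \<in> sets \<Omega>" by measurable
    finally show ?thesis .
  qed
  have floorI: "\<lfloor>t / \<eta>\<rfloor> \<in> {-Kc..Kc}" if "\<bar>t\<bar> \<le> C" for t
  proof -
    have "t / \<eta> \<le> C / \<eta>" "(- C) / \<eta> \<le> t / \<eta>" using that \<eta> by (intro divide_right_mono; simp)+
    then show ?thesis unfolding Kc_def by (auto simp: le_floor_iff floor_le_iff) linarith+
  qed
  have WI: "W n b \<in> I" if "b \<in> A n" for n b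
    using bound[OF that] floorI by (simp add: W_def I_def)
  have ind: "indicator (A n \<inter> B) b = (\<Sum>x\<in>I. indicator (cell n x) b :: real)" if b: "b \<in> space \<Omega>" for n b
  proof (cases "b \<in> A n \<inter> B")
    case True
    have "(\<Sum>x\<in>I. indicator (cell n x) b :: real) = (\<Sum>x\<in>I. if W n b = x then 1 else 0)"
      using True b by (intro sum.cong) (auto simp: cell_def indicator_def)
    then show ?thesis using True WI[of b n] fI by simp
  next
    case False
    then have "(\<Sum>x\<in>I. indicator (cell n x) b :: real) = 0"
      by (intro sum.neutral) (auto simp: cell_def indicator_def)
    then show ?thesis using False by simp
  qed
  define F where "F x p = obs f g (fib (- (\<eta> * of_int (fst x))) (- (\<eta> * of_int (snd x))) p)" for x :: "int \<times> int" and p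
  define G where "G p = obs f g (fib v v' p)" for p
  have [measurable]: "G \<in> borel_measurable \<kappa>" unfolding G_def by measurable
  define ok where "ok H d \<longleftrightarrow> d \<longlonglongrightarrow> 0 \<and> (\<forall>n. \<forall>E\<in>sets \<Omega>. \<bar>(\<integral>p. indicator E (rot (\<delta> n) (base p)) * H p \<partial>\<kappa>)
    - (\<integral>p. indicator E (base p) * H p \<partial>\<kappa>)\<bar> \<le> d n)"
    for H :: "(real \<times> 'b) \<times> (real \<times> 'b) \<Rightarrow> real" and d
  have "\<exists>d. ok (F x) d" for x
    unfolding ok_def F_def by (rule deviation) (use obs_range[OF f g] in auto)
  then obtain d where okd: "\<And>x. ok (F x) (d x)" by metis
  have d0: "d x \<longlonglongrightarrow> 0" for x using okd[of x] by (simp add: ok_def)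
  have d: "\<bar>(\<integral>p. indicator E (rot (\<delta> n) (base p)) * F x p \<partial>\<kappa>) - (\<integral>p. indicator E (base p) * F x p \<partial>\<kappa>)\<bar> \<le> d x n"
    if "E \<in> sets \<Omega>" for x n E using okd[of x] that by (simp add: ok_def)
  have "\<exists>d. ok G d"
    unfolding ok_def G_def by (rule deviation) (use obs_range[OF f g] in auto)
  then obtain dG where okG: "ok G dG" by blast
  have dG0: "dG \<longlonglongrightarrow> 0" using okG by (simp add: ok_def)
  have dG: "\<bar>(\<integral>p. indicator E (rot (\<delta> n) (base p)) * G p \<partial>\<kappa>) - (\<integral>p. indicator E (base p) * G p \<partial>\<kappa>)\<bar> \<le> dG n"
    if "E \<in> sets \<Omega>" for n E using okG that by (simp add: ok_def)
  define en where "en n = L * \<bar>w n - v\<bar> + L' * \<bar>w' n - v'\<bar>" for n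
  have en0: "en \<longlonglongrightarrow> 0"
  proof -
    have "(\<lambda>n. L * \<bar>w n - v\<bar> + L' * \<bar>w' n - v'\<bar>) \<longlonglongrightarrow> L * 0 + L' * 0"
      by (intro tendsto_add tendsto_mult tendsto_const tendsto_rabs_zero LIM_zero w_lim)
    then show ?thesis by (simp add: en_def[abs_def])
  qed
  have en_ge: "0 \<le> en n" for n using L by (simp add: en_def)
  have cell_est: "\<bar>(\<integral>p. indicator (cell n x) (base p) * obs f g p \<partial>\<kappa>)
      - (\<integral>p. indicator (cell n x) (rot (-\<delta> n) (base p)) * G p \<partial>\<kappa>)\<bar>
    \<le> (2 * (L + L') * \<eta> + en n) * measure \<rho> (cell n x) + d x n" for n x
    unfolding G_def en_def
  proof (rule cell_estimate[OF f g cell_sets])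
    fix b assume "b \<in> cell n x"
    then have b: "b \<in> A n" "W n b = x" by (auto simp: cell_def)
    have fl: "\<bar>t - \<eta> * of_int \<lfloor>t / \<eta>\<rfloor>\<bar> \<le> \<eta>" for t
    proof -
      have "of_int \<lfloor>t / \<eta>\<rfloor> \<le> t / \<eta>" "t / \<eta> < of_int \<lfloor>t / \<eta>\<rfloor> + 1" by linarith+
      then have "of_int \<lfloor>t / \<eta>\<rfloor> * \<eta> \<le> t" "t < (of_int \<lfloor>t / \<eta>\<rfloor> + 1) * \<eta>"
        using \<eta> by (simp_all only: pos_le_divide_eq pos_divide_less_eq)
      then show ?thesis by (simp add: algebra_simps abs_le_iff)
    qed
    show "\<bar>birkhoff \<alpha> (r * q n) (fst b) - \<eta> * of_int (fst x)\<bar> \<le> \<eta>"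
      "\<bar>birkhoff \<alpha> (s * q n) (snd b) - \<eta> * of_int (snd x)\<bar> \<le> \<eta>"
      unfolding b(2)[symmetric] W_def fst_conv snd_conv by (rule fl)+
    show "birkhoff \<alpha> (r * q n) (fst b + real r * \<delta> n) = birkhoff \<alpha> (r * q n) (fst b) + w n"
      "birkhoff \<alpha> (s * q n) (snd b + real s * \<delta> n) = birkhoff \<alpha> (s * q n) (snd b) + w' n"
      by (rule jump[OF b(1)])+
  next
    show "\<delta> n - real (k n) * \<alpha> \<in> \<int>" by (rule orbit)
  next
    fix E assume "E \<in> sets \<Omega>"
    then show "\<bar>(\<integral>p. indicator E (rot (\<delta> n) (base p)) * obs f g (fib (- (\<eta> * of_int (fst x))) (- (\<eta> * of_int (snd x))) p) \<partial>\<kappa>)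
        - (\<integral>p. indicator E (base p) * obs f g (fib (- (\<eta> * of_int (fst x))) (- (\<eta> * of_int (snd x))) p) \<partial>\<kappa>)\<bar> \<le> d x n"
      using d[of E n x] by (simp add: F_def)
  qed
  have int: "integrable \<kappa> (\<lambda>p. indicator E (h (base p)) * H p :: real)"
    if [measurable]: "E \<in> sets \<Omega>" "h \<in> measurable \<Omega> \<Omega>" "H \<in> borel_measurable \<kappa>"
      and "\<And>p. 0 \<le> H p \<and> H p \<le> 1" for E h H
    by (rule integrable_01) (use that in \<open>auto simp: indicator_def\<close>)
  have split: "(\<integral>p. indicator (A n \<inter> B) (h (base p)) * H p \<partial>\<kappa>) = (\<Sum>x\<in>I. \<integral>p. indicator (cell n x) (h (base p)) * H p \<partial>\<kappa>)"
    if h [measurable]: "h \<in> measurable \<Omega> \<Omega>" and H [measurable]: "H \<in> borel_measurable \<kappa>" and H01: "\<And>p. 0 \<le> H p \<and> H p \<le> (1::real)" for h H n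
  proof -
    have "(\<integral>p. indicator (A n \<inter> B) (h (base p)) * H p \<partial>\<kappa>) = (\<integral>p. (\<Sum>x\<in>I. indicator (cell n x) (h (base p)) * H p) \<partial>\<kappa>)"
    proof (rule Bochner_Integration.integral_cong[OF refl])
      fix p assume "p \<in> space \<kappa>"
      then have "h (base p) \<in> space \<Omega>" using measurable_space[OF h] base_space by (simp add: space_base)
      then show "indicator (A n \<inter> B) (h (base p)) * H p = (\<Sum>x\<in>I. indicator (cell n x) (h (base p)) * H p)"
        by (simp only: ind sum_distrib_right)
    qed
    also have "\<dots> = (\<Sum>x\<in>I. \<integral>p. indicator (cell n x) (h (base p)) * H p \<partial>\<kappa>)"
      by (rule Bochner_Integration.integral_sum) (intro int cell_sets h H H01)
    finally show ?thesis .
  qed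
  have obs01: "0 \<le> obs f g p \<and> obs f g p \<le> 1" for p using obs_range[OF f g] by blast
  have G01: "0 \<le> G p \<and> G p \<le> 1" for p unfolding G_def by (rule obs01)
  have msum: "(\<Sum>x\<in>I. measure \<rho> (cell n x)) \<le> 1" for n
  proof -
    have "(\<Sum>x\<in>I. measure \<rho> (cell n x)) = measure \<rho> (\<Union>x\<in>I. cell n x)"
    proof (rule rho.finite_measure_finite_Union[symmetric])
      show "disjoint_family_on (cell n) I" by (auto simp: disjoint_family_on_def cell_def)
      show "cell n ` I \<subseteq> sets \<rho>" using cell_sets by auto
    qed (rule fI)
    then show ?thesis by simp
  qed
  have est: "\<bar>(\<integral>p. indicator (A n \<inter> B) (base p) * obs f g p \<partial>\<kappa>) - (\<integral>p. indicator (A n \<inter> B) (base p) * G p \<partial>\<kappa>)\<bar>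
    \<le> e / 4 + (en n + (\<Sum>x\<in>I. d x n) + dG n)" for n
  proof -
    have i1: "(\<lambda>b. b) \<in> measurable \<Omega> \<Omega>" by simp
    have "\<bar>(\<integral>p. indicator (A n \<inter> B) (base p) * obs f g p \<partial>\<kappa>) - (\<integral>p. indicator (A n \<inter> B) (rot (-\<delta> n) (base p)) * G p \<partial>\<kappa>)\<bar>
      = \<bar>\<Sum>x\<in>I. (\<integral>p. indicator (cell n x) (base p) * obs f g p \<partial>\<kappa>) - (\<integral>p. indicator (cell n x) (rot (-\<delta> n) (base p)) * G p \<partial>\<kappa>)\<bar>"
      using split[of "\<lambda>b. b" "obs f g" n] split[of "rot (-\<delta> n)" G n] obs01 G01
      by (simp add: sum_subtractf)
    also have "\<dots> \<le> (\<Sum>x\<in>I. (2 * (L + L') * \<eta> + en n) * measure \<rho> (cell n x) + d x n)"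
      by (rule order.trans[OF sum_abs]) (intro sum_mono cell_est)
    also have "\<dots> = (2 * (L + L') * \<eta> + en n) * (\<Sum>x\<in>I. measure \<rho> (cell n x)) + (\<Sum>x\<in>I. d x n)"
      by (simp add: sum.distrib sum_distrib_left)
    also have "\<dots> \<le> (2 * (L + L') * \<eta> + en n) * 1 + (\<Sum>x\<in>I. d x n)"
      using L \<eta> en_ge[of n] msum[of n] by (intro add_right_mono mult_left_mono) auto
    finally have 1: "\<bar>(\<integral>p. indicator (A n \<inter> B) (base p) * obs f g p \<partial>\<kappa>) - (\<integral>p. indicator (A n \<inter> B) (rot (-\<delta> n) (base p)) * G p \<partial>\<kappa>)\<bar>
      \<le> e / 4 + en n + (\<Sum>x\<in>I. d x n)" using L\<eta> by simp
    \<comment> \<open>The cell estimates leave the base set shifted by \<open>\<delta> n\<close> on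
      the side of G. One more use of the deviation bound, now for G itself, moves it back.\<close>
    define E where "E = {b \<in> space \<Omega>. rot (-\<delta> n) b \<in> A n \<inter> B}"
    have Em [measurable]: "E \<in> sets \<Omega>" unfolding E_def by measurable
    have "(\<integral>p. indicator E (rot (\<delta> n) (base p)) * G p \<partial>\<kappa>) = (\<integral>p. indicator (A n \<inter> B) (base p) * G p \<partial>\<kappa>)"
    proof (rule Bochner_Integration.integral_cong[OF refl])
      fix p assume "p \<in> space \<kappa>"
      then have "rot (\<delta> n) (base p) \<in> E \<longleftrightarrow> base p \<in> A n \<inter> B"
        using rot_space base_space by (simp add: E_def rot_add space_base)
      then show "indicator E (rot (\<delta> n) (base p)) * G p = indicator (A n \<inter> B) (base p) * G p"
        by (simp add: indicator_def)
    qed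
    moreover have "(\<integral>p. indicator E (base p) * G p \<partial>\<kappa>) = (\<integral>p. indicator (A n \<inter> B) (rot (-\<delta> n) (base p)) * G p \<partial>\<kappa>)"
      using base_space by (intro Bochner_Integration.integral_cong[OF refl]) (auto simp: E_def space_base indicator_def)
    ultimately show ?thesis using 1 dG[OF Em, of n] by linarith
  qed
  have "(\<lambda>n. en n + (\<Sum>x\<in>I. d x n) + dG n) \<longlonglongrightarrow> 0 + (\<Sum>x\<in>I. 0) + 0"
    by (intro tendsto_add tendsto_sum en0 d0 dG0)
  then have "eventually (\<lambda>n. en n + (\<Sum>x\<in>I. d x n) + dG n < e / 4) sequentially"
    using e by (intro order_tendstoD(2)) auto
  then obtain n0 where n0: "\<And>n. n \<ge> n0 \<Longrightarrow> en n + (\<Sum>x\<in>I. d x n) + dG n < e / 4"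
    by (auto simp: eventually_sequentially)
  have "norm ((\<integral>p. indicator (A n \<inter> B) (base p) * obs f g p \<partial>\<kappa>) - (\<integral>p. indicator (A n \<inter> B) (base p) * obs f g (fib v v' p) \<partial>\<kappa>) - 0) < e" if "n \<ge> n0" for n
    using est[of n, unfolded G_def] n0[OF that] e by simp
  then show "\<exists>n0. \<forall>n\<ge>n0. norm ((\<integral>p. indicator (A n \<inter> B) (base p) * obs f g p \<partial>\<kappa>) - (\<integral>p. indicator (A n \<inter> B) (base p) * obs f g (fib v v' p) \<partial>\<kappa>) - 0) < e"
    by blast
qed

end

section \<open>From Lipschitz observables to measurable sets and to invariance of the
  joining\<close>

context flow_joining
begin

lemma distr_fibre_flow:
  "distr \<kappa> \<nu> (\<lambda>p. snd (fst (fib t u p))) = \<nu>" "distr \<kappa> \<nu> (\<lambda>p. snd (snd (fib t u p))) = \<nu>"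
proof -
  have y: "(\<lambda>p. snd (fst p)) \<in> measurable \<kappa> \<nu>" "(\<lambda>p. snd (snd p)) \<in> measurable \<kappa> \<nu>" by measurable
  have "distr (distr \<kappa> \<nu> (\<lambda>p. snd (fst p))) \<nu> (S t) = distr \<kappa> \<nu> (S t \<circ> (\<lambda>p. snd (fst p)))"
    "distr (distr \<kappa> \<nu> (\<lambda>p. snd (snd p))) \<nu> (S u) = distr \<kappa> \<nu> (S u \<circ> (\<lambda>p. snd (snd p)))"
    by (rule distr_distr[OF S_meas y(1)], rule distr_distr[OF S_meas y(2)])
  then show "distr \<kappa> \<nu> (\<lambda>p. snd (fst (fib t u p))) = \<nu>" "distr \<kappa> \<nu> (\<lambda>p. snd (snd (fib t u p))) = \<nu>"
    by (simp_all add: fibre_marginals S_distr fib_def comp_def)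
qed

lemma lip_approx:
  assumes C: "C \<in> sets \<nu>" and e: "0 < e"
  shows "\<exists>f L. lip f L \<and> (\<integral>y. \<bar>f y - indicator C y\<bar> \<partial>\<nu>) < e"
proof (rule lipschitz_approx[OF C e])
  fix f L
  assume "f \<in> borel_measurable \<nu>" "\<And>y. 0 \<le> f y" "\<And>y. f y \<le> 1" "0 \<le> L"
    "\<And>y u. y \<in> space \<nu> \<Longrightarrow> \<bar>f (S u y) - f y\<bar> \<le> L * \<bar>u\<bar>"
    "(\<integral>y. \<bar>f y - indicator C y\<bar> \<partial>\<nu>) < e"
  then show ?thesis by (intro exI[of _ f] exI[of _ L]) (simp add: lip_def)
qed

text \<open>Each fibre coordinate has law \<nu> after any fibre motion, so the error is controlled
  by the two L1 distances under \<nu>. It depends neither on the times t and u nor on the base set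
  E.\<close>

lemma obs_approx:
  assumes f: "lip f L" and g: "lip g L'" and C [measurable]: "C \<in> sets \<nu>" and D [measurable]: "D \<in> sets \<nu>"
    and fe: "(\<integral>y. \<bar>f y - indicator C y\<bar> \<partial>\<nu>) < e" and ge: "(\<integral>y. \<bar>g y - indicator D y\<bar> \<partial>\<nu>) < e"
    and E [measurable]: "E \<in> sets \<Omega>"
  shows "\<bar>(\<integral>p. indicator E (base p) * obs (indicator C) (indicator D) (fib t u p) \<partial>\<kappa>)
    - (\<integral>p. indicator E (base p) * obs f g (fib t u p) \<partial>\<kappa>)\<bar> \<le> 2 * e"
proof -
  have fm [measurable]: "f \<in> borel_measurable \<nu>" and gm [measurable]: "g \<in> borel_measurable \<nu>" using f g by (auto simp: lip_def)
  have f01: "0 \<le> f y" "f y \<le> 1" "0 \<le> g y" "g y \<le> 1" for y using f g by (auto simp: lip_def)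
  define y where "y p = snd (fst (fib t u p))" for p
  define y' where "y' p = snd (snd (fib t u p))" for p
  have ym [measurable]: "y \<in> measurable \<kappa> \<nu>" "y' \<in> measurable \<kappa> \<nu>"
  proof -
    have "(\<lambda>p. snd (fst p)) \<in> measurable \<kappa> \<nu>" "(\<lambda>p. snd (snd p)) \<in> measurable \<kappa> \<nu>" by measurable
    then show "y \<in> measurable \<kappa> \<nu>" "y' \<in> measurable \<kappa> \<nu>"
      unfolding y_def y'_def by (auto intro: measurable_compose[OF fib_measurable])
  qed
  have i1: "integrable \<kappa> (\<lambda>p. indicator E (base p) * obs (indicator C) (indicator D) (fib t u p))"
  proof (rule integrable_01)
    have [measurable]: "obs (indicator C) (indicator D) \<in> borel_measurable \<kappa>" by (rule obs_measurable) auto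
    show "(\<lambda>p. indicator E (base p) * obs (indicator C) (indicator D) (fib t u p)) \<in> borel_measurable \<kappa>"
      by measurable
  qed (auto simp: indicator_def obs_def)
  have i2: "integrable \<kappa> (\<lambda>p. indicator E (base p) * obs f g (fib t u p))"
    by (rule integrable_01) (use obs_range[OF f g] in \<open>auto simp: indicator_def\<close>)
  have j: "integrable \<kappa> (\<lambda>p. \<bar>f (y p) - indicator C (y p)\<bar>)" "integrable \<kappa> (\<lambda>p. \<bar>g (y' p) - indicator D (y' p)\<bar>)"
  proof -
    have "\<bar>f z - indicator C z\<bar> \<le> 1" "\<bar>g z - indicator D z\<bar> \<le> 1" for z
      using f01[of z] by (auto simp: indicator_def)
    moreover have "(\<lambda>z. \<bar>f z - indicator C z\<bar>) \<in> borel_measurable \<nu>" "(\<lambda>z. \<bar>g z - indicator D z\<bar>) \<in> borel_measurable \<nu>"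
      by measurable
    ultimately show "integrable \<kappa> (\<lambda>p. \<bar>f (y p) - indicator C (y p)\<bar>)" "integrable \<kappa> (\<lambda>p. \<bar>g (y' p) - indicator D (y' p)\<bar>)"
      by (auto intro!: integrable_01 measurable_compose[OF ym(1)] measurable_compose[OF ym(2)])
  qed
  have "\<bar>(\<integral>p. indicator E (base p) * obs (indicator C) (indicator D) (fib t u p) \<partial>\<kappa>)
    - (\<integral>p. indicator E (base p) * obs f g (fib t u p) \<partial>\<kappa>)\<bar>
    \<le> (\<integral>p. \<bar>f (y p) - indicator C (y p)\<bar> + \<bar>g (y' p) - indicator D (y' p)\<bar> \<partial>\<kappa>)"
    unfolding Bochner_Integration.integral_diff[OF i1 i2, symmetric]
  proof (rule order.trans[OF integral_abs_bound integral_mono])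
    fix p
    have "\<bar>indicator C (y p) * indicator D (y' p) - f (y p) * g (y' p)\<bar>
      \<le> \<bar>indicator C (y p) - f (y p)\<bar> + \<bar>indicator D (y' p) - g (y' p)\<bar>"
      by (rule abs_mult_diff_le) (use f01 in auto)
    then show "\<bar>indicator E (base p) * obs (indicator C) (indicator D) (fib t u p) - indicator E (base p) * obs f g (fib t u p)\<bar>
      \<le> \<bar>f (y p) - indicator C (y p)\<bar> + \<bar>g (y' p) - indicator D (y' p)\<bar>"
      by (auto simp: obs_def y_def y'_def indicator_def abs_minus_commute split: if_splits)
  qed (use i1 i2 j in auto)
  also have "\<dots> = (\<integral>p. \<bar>f (y p) - indicator C (y p)\<bar> \<partial>\<kappa>) + (\<integral>p. \<bar>g (y' p) - indicator D (y' p)\<bar> \<partial>\<kappa>)"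
    by (rule Bochner_Integration.integral_add[OF j])
  also have "(\<integral>p. \<bar>f (y p) - indicator C (y p)\<bar> \<partial>\<kappa>) = (\<integral>z. \<bar>f z - indicator C z\<bar> \<partial>distr \<kappa> \<nu> y)"
    by (rule integral_distr[OF ym(1), symmetric]) measurable
  also have "(\<integral>p. \<bar>g (y' p) - indicator D (y' p)\<bar> \<partial>\<kappa>) = (\<integral>z. \<bar>g z - indicator D z\<bar> \<partial>distr \<kappa> \<nu> y')"
    by (rule integral_distr[OF ym(2), symmetric]) measurable
  finally show ?thesis using fe ge
    by (simp add: y_def[abs_def] y'_def[abs_def] distr_fibre_flow)
qed

lemma sets_kappa_generator:
  "sets \<kappa> = sigma_sets (space \<kappa>) {(a \<times> C) \<times> (a' \<times> C') | a C a' C'. a \<in> sets circle_measure \<and> C \<in> sets \<nu> \<and> a' \<in> sets circle_measure \<and> C' \<in> sets \<nu>}"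
proof -
  let ?M = "\<M>"
  let ?E = "{a \<times> C | a C. a \<in> sets circle_measure \<and> C \<in> sets \<nu>}"
  have E1: "?E \<subseteq> Pow (space ?M)"
  proof
    fix X assume "X \<in> ?E"
    then have "X \<in> sets ?M" by auto
    then show "X \<in> Pow (space ?M)" using sets.sets_into_space by blast
  qed
  have E2: "sets ?M = sigma_sets (space ?M) ?E"
    by (simp add: sets_pair_measure space_pair_measure)
  have "space ?M = {0..<1} \<times> space \<nu>" by (simp add: space_pair_measure)
  moreover have "{0..<1} \<in> sets circle_measure" "space \<nu> \<in> sets \<nu>" by (auto simp: sets_circle_iff)
  ultimately have sp: "space ?M \<in> ?E" by blast
  have "sets (?M \<Otimes>\<^sub>M ?M) = sets (sigma (space ?M \<times> space ?M) {a \<times> b | a b. a \<in> ?E \<and> b \<in> ?E})"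
    by (rule sets_pair_eq[OF E1 E2 _ _ _ E1 E2, where Ca="{space ?M}" and Cb="{space ?M}"]) (use sp in auto)
  also have "\<dots> = sigma_sets (space ?M \<times> space ?M) {a \<times> b | a b. a \<in> ?E \<and> b \<in> ?E}"
    using E1 by (intro sets_measure_of) blast
  also have "{a \<times> b | a b. a \<in> ?E \<and> b \<in> ?E}
    = {(a \<times> C) \<times> (a' \<times> C') | a C a' C'. a \<in> sets circle_measure \<and> C \<in> sets \<nu> \<and> a' \<in> sets circle_measure \<and> C' \<in> sets \<nu>}"
    by blast
  also have "space ?M \<times> space ?M = space \<kappa>"
    by (simp add: space_kappa space_pair_measure)
  finally show ?thesis by (simp only: sets_kappa)
qed

end

context jump_sequence
begin

definition hit :: "nat \<Rightarrow> ((real \<times> 'b) \<times> (real \<times> 'b)) set \<Rightarrow> real" where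
  "hit n P = measure \<kappa> {p \<in> space \<kappa>. base p \<in> A n \<and> p \<in> P}"

definition hit' :: "nat \<Rightarrow> ((real \<times> 'b) \<times> (real \<times> 'b)) set \<Rightarrow> real" where
  "hit' n P = measure \<kappa> {p \<in> space \<kappa>. base p \<in> A n \<and> fib v v' p \<in> P}"

text \<open>The base sides of the rectangle are absorbed into the fixed base set B of
  \<open>lip_mismatch_tendsto_0\<close>, and the fibre sides are replaced by Lipschitz observables
  at a cost independent of n.\<close>

lemma hit_rectangle:
  assumes a: "a \<in> sets circle_measure" "a' \<in> sets circle_measure" and Y [measurable]: "Y \<in> sets \<nu>" "Y' \<in> sets \<nu>"
  shows "(\<lambda>n. hit n ((a \<times> Y) \<times> (a' \<times> Y')) - hit' n ((a \<times> Y) \<times> (a' \<times> Y'))) \<longlonglongrightarrow> 0"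
proof (rule LIMSEQ_I)
  fix e :: real assume e: "0 < e"
  have Bm [measurable]: "a \<times> a' \<in> sets \<Omega>" using a by simp
  obtain f L where f: "lip f L" and fe: "(\<integral>y. \<bar>f y - indicator Y y\<bar> \<partial>\<nu>) < e / 8"
    using lip_approx[OF Y(1), of "e / 8"] e by auto
  obtain g L' where g: "lip g L'" and ge: "(\<integral>y. \<bar>g y - indicator Y' y\<bar> \<partial>\<nu>) < e / 8"
    using lip_approx[OF Y(2), of "e / 8"] e by auto
  have h: "hit n ((a \<times> Y) \<times> (a' \<times> Y')) = (\<integral>p. indicator (A n \<inter> a \<times> a') (base p) * obs (indicator Y) (indicator Y') (fib 0 0 p) \<partial>\<kappa>)" for n
  proof -
    have "(\<integral>p. indicator (A n \<inter> a \<times> a') (base p) * obs (indicator Y) (indicator Y') (fib 0 0 p) \<partial>\<kappa>)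
      = (\<integral>p. indicator {p \<in> space \<kappa>. base p \<in> A n \<and> p \<in> (a \<times> Y) \<times> (a' \<times> Y')} p \<partial>\<kappa>)"
      by (rule Bochner_Integration.integral_cong[OF refl]) (auto simp: obs_def base_def indicator_def)
    then show ?thesis by (simp add: hit_def Int_absorb2 subset_eq)
  qed
  have h': "hit' n ((a \<times> Y) \<times> (a' \<times> Y')) = (\<integral>p. indicator (A n \<inter> a \<times> a') (base p) * obs (indicator Y) (indicator Y') (fib v v' p) \<partial>\<kappa>)" for n
  proof -
    have "(\<integral>p. indicator (A n \<inter> a \<times> a') (base p) * obs (indicator Y) (indicator Y') (fib v v' p) \<partial>\<kappa>)
      = (\<integral>p. indicator {p \<in> space \<kappa>. base p \<in> A n \<and> fib v v' p \<in> (a \<times> Y) \<times> (a' \<times> Y')} p \<partial>\<kappa>)"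
      by (rule Bochner_Integration.integral_cong[OF refl]) (auto simp: obs_def base_def fib_def indicator_def)
    then show ?thesis by (simp add: hit'_def Int_absorb2 subset_eq)
  qed
  have c: "(\<integral>p. indicator E (base p) * obs f g (fib 0 0 p) \<partial>\<kappa>) = (\<integral>p. indicator E (base p) * obs f g p \<partial>\<kappa>)" for E
    by (rule Bochner_Integration.integral_cong[OF refl]) simp
  have AB: "A n \<inter> a \<times> a' \<in> sets \<Omega>" for n using A_sets Bm by blast
  obtain n0 where n0: "\<And>n. n \<ge> n0 \<Longrightarrow> \<bar>(\<integral>p. indicator (A n \<inter> a \<times> a') (base p) * obs f g p \<partial>\<kappa>)
    - (\<integral>p. indicator (A n \<inter> a \<times> a') (base p) * obs f g (fib v v' p) \<partial>\<kappa>)\<bar> < e / 4"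
    using LIMSEQ_D[OF lip_mismatch_tendsto_0[OF f g Bm], of "e / 4"] e by auto
  have "norm (hit n ((a \<times> Y) \<times> (a' \<times> Y')) - hit' n ((a \<times> Y) \<times> (a' \<times> Y')) - 0) < e" if "n \<ge> n0" for n
    using n0[OF that] obs_approx[OF f g Y fe ge AB, of n 0 0] obs_approx[OF f g Y fe ge AB, of n v v'] e
    unfolding h h' c by (simp add: abs_if split: if_splits)
  then show "\<exists>n0. \<forall>n\<ge>n0. norm (hit n ((a \<times> Y) \<times> (a' \<times> Y')) - hit' n ((a \<times> Y) \<times> (a' \<times> Y')) - 0) < e" by blast
qed

text \<open>A Dynkin argument starting from rectangles. The sets \<open>A n\<close> vary, so for a
  disjoint union the tail must be small uniformly in n: \<open>hit n\<close> of the tail is at most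
  its \<kappa>-measure, \<open>hit' n\<close> at most the \<kappa>-measure of its preimage under the
  fibre motion, and one index makes both small.\<close>

lemma hit_tendsto:
  assumes "P \<in> sets \<kappa>"
  shows "(\<lambda>n. hit n P - hit' n P) \<longlonglongrightarrow> 0"
proof -
  let ?G = "{(a \<times> C) \<times> (a' \<times> C') | a C a' C'. a \<in> sets circle_measure \<and> C \<in> sets \<nu> \<and> a' \<in> sets circle_measure \<and> C' \<in> sets \<nu>}"
  have "Int_stable ?G"
  proof (rule Int_stableI)
    fix X Y assume "X \<in> ?G" "Y \<in> ?G"
    then obtain a C a' C' b D b' D' where X: "X = (a \<times> C) \<times> (a' \<times> C')" and Y: "Y = (b \<times> D) \<times> (b' \<times> D')"
      and s: "a \<in> sets circle_measure" "a' \<in> sets circle_measure" "b \<in> sets circle_measure" "b' \<in> sets circle_measure"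
        "C \<in> sets \<nu>" "C' \<in> sets \<nu>" "D \<in> sets \<nu>" "D' \<in> sets \<nu>" by blast
    have "X \<inter> Y = ((a \<inter> b) \<times> (C \<inter> D)) \<times> ((a' \<inter> b') \<times> (C' \<inter> D'))" by (auto simp: X Y)
    then show "X \<inter> Y \<in> ?G" using s by blast
  qed
  moreover have "?G \<subseteq> Pow (space \<kappa>)"
  proof -
    have "c \<subseteq> {0..<1}" if "c \<in> sets circle_measure" for c using that by (simp add: sets_circle_iff)
    then show ?thesis unfolding space_kappa using sets.sets_into_space[of _ \<nu>] by blast
  qed
  moreover have "P \<in> sigma_sets (space \<kappa>) ?G" using assms sets_kappa_generator by simp
  ultimately show ?thesis
  proof (induction rule: sigma_sets_induct_disjoint)
    case (basic P)
    then show ?case using hit_rectangle by blast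
  next
    case empty
    then show ?case by (simp add: hit_def hit'_def)
  next
    case (compl P)
    have Pm [measurable]: "P \<in> sets \<kappa>" using compl(1) sets_kappa_generator by simp
    have "hit n (space \<kappa> - P) = measure \<kappa> {p \<in> space \<kappa>. base p \<in> A n} - hit n P" for n
    proof -
      have "hit n (space \<kappa> - P) = measure \<kappa> ({p \<in> space \<kappa>. base p \<in> A n} - {p \<in> space \<kappa>. base p \<in> A n \<and> p \<in> P})"
        unfolding hit_def by (rule arg_cong[where f="measure \<kappa>"]) auto
      then show ?thesis unfolding hit_def by (subst (asm) K.finite_measure_Diff) auto
    qed
    moreover have "hit' n (space \<kappa> - P) = measure \<kappa> {p \<in> space \<kappa>. base p \<in> A n} - hit' n P" for n
    proof -
      have "hit' n (space \<kappa> - P) = measure \<kappa> ({p \<in> space \<kappa>. base p \<in> A n} - {p \<in> space \<kappa>. base p \<in> A n \<and> fib v v' p \<in> P})"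
        unfolding hit'_def using measurable_space[OF fib_measurable] by (intro arg_cong[where f="measure \<kappa>"]) auto
      then show ?thesis unfolding hit'_def by (subst (asm) K.finite_measure_Diff) auto
    qed
    ultimately have "hit n (space \<kappa> - P) - hit' n (space \<kappa> - P) = - (hit n P - hit' n P)" for n by simp
    then show ?case using tendsto_minus[OF compl(2)] by simp
  next
    case (union F)
    have Fm [measurable]: "F i \<in> sets \<kappa>" for i using union(2) sets_kappa_generator by auto
    show ?case
    proof (rule LIMSEQ_I)
      fix e :: real assume e: "0 < e"
      define U where "U k = (\<Union>i<k. F i)" for k
      have Um [measurable]: "U k \<in> sets \<kappa>" for k unfolding U_def by measurable
      define T where "T k = (\<Union>i. F i) - U k" for k
      have Tm [measurable]: "T k \<in> sets \<kappa>" for k unfolding T_def by measurable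
      have dT: "decseq T" unfolding decseq_def T_def U_def by (auto intro: less_le_trans)
      have T0: "(\<Inter>k. T k) = {}" by (auto simp: T_def U_def)
      have t1: "(\<lambda>k. measure \<kappa> (T k)) \<longlonglongrightarrow> 0"
        using K.finite_Lim_measure_decseq[of T] dT T0 Tm by (simp add: image_subset_iff)
      have t2: "(\<lambda>k. measure \<kappa> (fib v v' -` T k \<inter> space \<kappa>)) \<longlonglongrightarrow> 0"
      proof -
        have "decseq (\<lambda>k. fib v v' -` T k \<inter> space \<kappa>)" using dT unfolding decseq_def by blast
        moreover have "(\<Inter>k. fib v v' -` T k \<inter> space \<kappa>) = {}" using T0 by auto
        moreover have "range (\<lambda>k. fib v v' -` T k \<inter> space \<kappa>) \<subseteq> sets \<kappa>" using Tm by (auto intro: measurable_sets)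
        ultimately show ?thesis using K.finite_Lim_measure_decseq[of "\<lambda>k. fib v v' -` T k \<inter> space \<kappa>"] by simp
      qed
      from tendsto_add[OF t1 t2] have "eventually (\<lambda>k. measure \<kappa> (T k) + measure \<kappa> (fib v v' -` T k \<inter> space \<kappa>) < e / 2) sequentially"
        using e by (intro order_tendstoD(2)) auto
      then obtain k where k: "measure \<kappa> (T k) + measure \<kappa> (fib v v' -` T k \<inter> space \<kappa>) < e / 2"
        by (auto simp: eventually_sequentially)
      have hadd: "hit n (X \<union> Y) = hit n X + hit n Y" "hit' n (X \<union> Y) = hit' n X + hit' n Y"
        if [measurable]: "X \<in> sets \<kappa>" "Y \<in> sets \<kappa>" and d: "X \<inter> Y = {}" for n X Y
      proof -
        have "hit n (X \<union> Y) = measure \<kappa> ({p \<in> space \<kappa>. base p \<in> A n \<and> p \<in> X} \<union> {p \<in> space \<kappa>. base p \<in> A n \<and> p \<in> Y})"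
          unfolding hit_def by (rule arg_cong[where f="measure \<kappa>"]) auto
        also have "\<dots> = hit n X + hit n Y" unfolding hit_def
          by (rule K.finite_measure_Union) (use d in auto)
        finally show "hit n (X \<union> Y) = hit n X + hit n Y" .
        have "hit' n (X \<union> Y) = measure \<kappa> ({p \<in> space \<kappa>. base p \<in> A n \<and> fib v v' p \<in> X} \<union> {p \<in> space \<kappa>. base p \<in> A n \<and> fib v v' p \<in> Y})"
          unfolding hit'_def by (rule arg_cong[where f="measure \<kappa>"]) auto
        also have "\<dots> = hit' n X + hit' n Y" unfolding hit'_def
          by (rule K.finite_measure_Union) (use d in auto)
        finally show "hit' n (X \<union> Y) = hit' n X + hit' n Y" .
      qed
      have hU: "(\<lambda>n. hit n (U k) - hit' n (U k)) \<longlonglongrightarrow> 0" for k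
      proof (induction k)
        case 0
        then show ?case by (simp add: U_def hit_def hit'_def)
      next
        case (Suc k)
        have "F k \<inter> F i = {}" if "i < k" for i
          using disjoint_family_onD[OF union(1), of k i] that by simp
        then have dis: "F k \<inter> U k = {}" by (simp add: U_def Int_UN_distrib)
        have "U (Suc k) = F k \<union> U k" by (simp add: U_def lessThan_Suc)
        then have "hit n (U (Suc k)) - hit' n (U (Suc k)) = (hit n (F k) - hit' n (F k)) + (hit n (U k) - hit' n (U k))" for n
          using hadd[OF Fm Um dis] by simp
        then show ?case using tendsto_add[OF union(3) Suc] by simp
      qed
      obtain n0 where n0: "\<And>n. n \<ge> n0 \<Longrightarrow> \<bar>hit n (U k) - hit' n (U k)\<bar> < e / 2"
        using LIMSEQ_D[OF hU, of "e / 2" k] e by auto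
      have "norm (hit n (\<Union>i. F i) - hit' n (\<Union>i. F i) - 0) < e" if n: "n \<ge> n0" for n
      proof -
        have UT: "(\<Union>i. F i) = U k \<union> T k" by (auto simp: T_def U_def)
        have dis: "U k \<inter> T k = {}" by (auto simp: T_def)
        have "hit n (\<Union>i. F i) - hit' n (\<Union>i. F i) = (hit n (U k) - hit' n (U k)) + (hit n (T k) - hit' n (T k))"
          unfolding UT hadd[OF Um Tm dis] by simp
        moreover have "0 \<le> hit n (T k)" "hit n (T k) \<le> measure \<kappa> (T k)"
          unfolding hit_def by (auto intro: K.finite_measure_mono)
        moreover have "0 \<le> hit' n (T k)" "hit' n (T k) \<le> measure \<kappa> (fib v v' -` T k \<inter> space \<kappa>)"
          unfolding hit'_def by (auto intro!: K.finite_measure_mono measurable_sets[OF fib_measurable Tm])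
        ultimately show ?thesis using n0[OF n] k by (simp add: abs_if split: if_splits)
      qed
      then show "\<exists>n0. \<forall>n\<ge>n0. norm (hit n (\<Union>i. F i) - hit' n (\<Union>i. F i) - 0) < e" by blast
    qed
  qed
qed

text \<open>If the image N of \<open>\<kappa>\<close> under the fibre motion differed from
  \<open>\<kappa>\<close>, some \<open>Q\<close>-invariant P would satisfy N P < \<kappa> P. Its
  preimage P' under the fibre motion is also invariant, so ergodicity gives \<kappa> P = 1 and
  \<kappa> P' = 0. Then \<open>hit n P\<close> is the full measure of \<open>A n\<close>, at least
  c, while \<open>hit' n P\<close> is 0, against \<open>hit_tendsto\<close>.\<close>

theorem jump_invariance:
  assumes c: "0 < c" and big: "\<And>n. c \<le> measure \<rho> (A n)"
  shows "distr \<kappa> \<kappa> (fib v v') = \<kappa>"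
proof (rule ccontr)
  assume ne: "distr \<kappa> \<kappa> (fib v v') \<noteq> \<kappa>"
  define N where "N = distr \<kappa> \<kappa> (fib v v')"
  have fN: "finite_measure N" unfolding N_def by (rule K.finite_measure_distr[OF fib_measurable])
  have fib_sp: "fib v v' p \<in> space \<kappa>" if "p \<in> space \<kappa>" for p using measurable_space[OF fib_measurable that] .
  have N_inv: "distr N N Q = N"
  proof -
    have "distr N N Q = distr N \<kappa> Q" by (rule distr_cong) (auto simp: N_def)
    also have "\<dots> = distr \<kappa> \<kappa> (Q \<circ> fib v v')" unfolding N_def by (rule distr_distr) auto
    also have "\<dots> = distr \<kappa> \<kappa> (fib v v' \<circ> Q)" by (rule distr_cong) (auto simp: fib_Q)
    also have "\<dots> = distr (distr \<kappa> \<kappa> Q) \<kappa> (fib v v')" by (rule distr_distr[symmetric]) auto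
    finally show ?thesis by (simp add: Q_distr N_def)
  qed
  have sN: "sets N = sets \<kappa>" by (simp add: N_def)
  have mass: "measure \<kappa> (space \<kappa>) = measure N (space \<kappa>)"
  proof -
    interpret N: prob_space N unfolding N_def by (rule K.prob_space_distr[OF fib_measurable])
    have "space N = space \<kappa>" by (simp add: N_def)
    then show ?thesis using N.prob_space K.prob_space by simp
  qed
  obtain P where P [measurable]: "P \<in> sets \<kappa>" and Pinv: "Q -` P \<inter> space \<kappa> = P" and lt: "measure N P < measure \<kappa> P"
    by (rule distinct_invariant_measures_invariant_set[OF K.finite_measure_axioms fN sN Q_measurable Q_distr N_inv mass])
      (use ne in \<open>auto simp: N_def\<close>)
  define P' where "P' = fib v v' -` P \<inter> space \<kappa>"
  have P'm: "P' \<in> sets \<kappa>" unfolding P'_def by measurable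
  have NP: "measure N P = measure \<kappa> P'" unfolding N_def P'_def by (rule measure_distr) auto
  have "Q -` P' \<inter> space \<kappa> = P'"
  proof -
    have *: "Q p \<in> P' \<longleftrightarrow> p \<in> P'" if p: "p \<in> space \<kappa>" for p
    proof -
      have "Q p \<in> P' \<longleftrightarrow> Q (fib v v' p) \<in> P"
        using p measurable_space[OF Q_measurable p] by (simp add: P'_def fib_Q)
      also have "\<dots> \<longleftrightarrow> fib v v' p \<in> P" using Pinv fib_sp[OF p] by blast
      finally show ?thesis using p by (simp add: P'_def)
    qed
    have "P' \<subseteq> space \<kappa>" by (auto simp: P'_def)
    then show ?thesis using * by blast
  qed
  then have "measure \<kappa> P' = 0 \<or> measure \<kappa> P' = 1" by (rule ergodic[OF P'm])
  then have P'0: "measure \<kappa> P' = 0" and P1: "measure \<kappa> P = 1"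
    using ergodic[OF P Pinv] lt NP K.prob_le_1[of P] by auto
  have "hit n P = measure \<rho> (A n)" for n
  proof -
    have "measure \<rho> (A n) = measure \<kappa> (base -` A n \<inter> space \<kappa>)"
      unfolding \<rho>_def by (rule measure_distr) auto
    also have "\<dots> = measure \<kappa> {p \<in> space \<kappa>. base p \<in> A n \<and> p \<in> P}"
    proof (rule K.finite_measure_eq_AE)
      show "AE p in \<kappa>. p \<in> base -` A n \<inter> space \<kappa> \<longleftrightarrow> p \<in> {p \<in> space \<kappa>. base p \<in> A n \<and> p \<in> P}"
        using K.AE_prob_1[OF P1] by eventually_elim auto
    qed auto
    finally show ?thesis by (simp add: hit_def)
  qed
  moreover have "hit' n P = 0" for n
  proof -
    have "hit' n P \<le> measure \<kappa> P'"
      unfolding hit'_def by (rule K.finite_measure_mono) (auto simp: P'_def P'm[unfolded P'_def])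
    then show ?thesis using P'0 by (simp add: hit'_def order_antisym)
  qed
  ultimately have "(\<lambda>n. measure \<rho> (A n)) \<longlonglongrightarrow> 0" using hit_tendsto[OF P] by simp
  then have "c \<le> 0" by (rule LIMSEQ_le_const) (use big in blast)
  then show False using c by simp
qed

end

section \<open>Jumps of the sawtooth cocycle\<close>

lemma measure_circle_visit:
  assumes "0 \<le> d" "d \<le> 1"
  shows "measure circle_measure {x \<in> {0..<1}. 1 - d \<le> frac (x + u)} = d"
proof -
  have B: "{1 - d..<1} \<in> sets circle_measure" using assms by (auto simp: sets_circle_iff)
  have "{x \<in> {0..<1}. 1 - d \<le> frac (x + u)} = (\<lambda>x. frac (x + u)) -` {1 - d..<1} \<inter> space circle_measure"
    by (auto simp: frac_lt_1)
  also have "measure circle_measure \<dots> = measure circle_measure {1 - d..<1}"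
    by (rule measure_vimage_invariant[OF rotation_measurable distr_rotation B])
  also have "\<dots> = d"
    using assms by (subst measure_def, subst emeasure_circle) auto
  finally show ?thesis .
qed

lemma visit_set_measurable [measurable]: "{x \<in> {0..<1}. 1 - d \<le> frac (x + u)} \<in> sets circle_measure"
  unfolding sets_circle_iff by auto

context flow_joining
begin

text \<open>The smallness of \<epsilon> enters twice, through q \<delta> \<le> 2 \<epsilon>. From 2
  r^2 \<epsilon> \<le> c follows r \<delta> \<le> c / (r q), so an orbit piece of length r q crosses
  at most one jump in the first coordinate; from 2 r \<epsilon> < 1 follows r \<delta> < 1, as the
  exact jump count requires.\<close>

lemma small_jump_invariance:
  assumes irr: "\<alpha> \<notin> \<rat>" and c: "0 < c"
    and bad: "\<And>(q::int) p::int. 1 \<le> q \<Longrightarrow> c / of_int q \<le> \<bar>of_int q * \<alpha> - of_int p\<bar>"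
    and rs: "s < r" and \<epsilon>: "0 < \<epsilon>" "2 * (real r)\<^sup>2 * \<epsilon> \<le> c" "2 * real r * \<epsilon> < 1"
  shows "distr \<kappa> \<kappa> (fib ((real r)\<^sup>2 * \<epsilon> - 1) ((real s)\<^sup>2 * \<epsilon>)) = \<kappa>"
proof -
  have r1: "1 \<le> real r" using rs by simp
  have \<epsilon>1: "\<epsilon> \<le> 1"
  proof -
    have "1 * \<epsilon> \<le> 2 * real r * \<epsilon>" using r1 \<epsilon>(1) by (intro mult_right_mono) auto
    then show ?thesis using \<epsilon>(3) by simp
  qed
  \<comment> \<open>First q is taken among the good denominators, then Kronecker's theorem finds a
    multiple of \<alpha> whose fractional part is \<epsilon>/q up to a relative error 1/(n+2). So q
    \<delta> tends to \<epsilon>, and the 2 in n+2 keeps q \<delta> above \<epsilon>/2 already for n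
    = 0.\<close>
  have "\<exists>q k. n < q \<and> (\<forall>x. \<bar>birkhoff \<alpha> q x\<bar> \<le> 4) \<and> \<bar>frac (real k * \<alpha>) - \<epsilon> / real q\<bar> < \<epsilon> / real q / real (n + 2)" for n
  proof -
    obtain p :: int and q :: nat where q: "n < q" "coprime p (int q)" "\<bar>real q * \<alpha> - of_int p\<bar> \<le> 1 / real q"
      by (rule large_coprime_approximants[OF irr])
    have q0: "0 < q" using q by simp
    have b: "\<bar>birkhoff \<alpha> q x\<bar> \<le> 4" for x by (rule Denjoy_Koksma_sawtooth[OF q(2) q0 q(3)])
    have "\<epsilon> / real q \<le> 1" using \<epsilon>1 q0 \<epsilon> by (simp add: divide_le_eq)
    then obtain k where "\<bar>frac (real k * \<alpha>) - \<epsilon> / real q\<bar> < \<epsilon> / real q / real (n + 2)"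
      using Kronecker_approx_1_explicit[OF irr, of "\<epsilon> / real q" "\<epsilon> / real q / real (n + 2)"] \<epsilon> q0 by auto
    then show ?thesis using q(1) b by blast
  qed
  then obtain q k where q: "\<And>n. n < q n" and bk: "\<And>n x. \<bar>birkhoff \<alpha> (q n) x\<bar> \<le> 4"
    and kd: "\<And>n. \<bar>frac (real (k n) * \<alpha>) - \<epsilon> / real (q n)\<bar> < \<epsilon> / real (q n) / real (n + 2)" by metis
  define \<delta> where "\<delta> n = frac (real (k n) * \<alpha>)" for n
  have q0: "0 < real (q n)" for n using q[of n] by simp
  have qd: "\<bar>real (q n) * \<delta> n - \<epsilon>\<bar> < \<epsilon> / real (n + 2)" for n
  proof -
    have "\<bar>real (q n) * \<delta> n - \<epsilon>\<bar> = real (q n) * \<bar>\<delta> n - \<epsilon> / real (q n)\<bar>"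
    proof -
      have "real (q n) * \<delta> n - \<epsilon> = real (q n) * (\<delta> n - \<epsilon> / real (q n))"
        using q0[of n] by (simp add: right_diff_distrib)
      then show ?thesis by (simp add: abs_mult)
    qed
    also have "\<dots> < real (q n) * (\<epsilon> / real (q n) / real (n + 2))"
      using kd[of n] q0[of n] by (intro mult_strict_left_mono) (auto simp: \<delta>_def)
    finally show ?thesis using q0[of n] by simp
  qed
  have half: "\<epsilon> / real (n + 2) \<le> \<epsilon> / 2" for n using \<epsilon> by (intro divide_left_mono) auto
  have qd_lo: "\<epsilon> / 2 \<le> real (q n) * \<delta> n" and qd_hi: "real (q n) * \<delta> n \<le> 2 * \<epsilon>" for n
    using qd[of n] half[of n] \<epsilon>(1) unfolding abs_less_iff by linarith+
  have \<delta>0: "0 \<le> \<delta> n" for n by (simp add: \<delta>_def frac_ge_0)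
  have \<delta>_hi: "\<delta> n \<le> 2 * \<epsilon>" for n
  proof -
    have "1 * \<delta> n \<le> real (q n) * \<delta> n" using q[of n] \<delta>0[of n] by (intro mult_right_mono) auto
    then show ?thesis using qd_hi[of n] by simp
  qed
  have r\<delta>: "real r * \<delta> n < 1" for n
  proof -
    have "real r * \<delta> n \<le> real r * (2 * \<epsilon>)" using \<delta>_hi[of n] by (intro mult_left_mono) auto
    then show ?thesis using \<epsilon>(3) by simp
  qed
  have s\<delta>: "real s * \<delta> n < 1" for n
  proof -
    have "real s * \<delta> n \<le> real r * \<delta> n" using rs \<delta>0[of n] by (intro mult_right_mono) auto
    then show ?thesis using r\<delta>[of n] by simp
  qed
  \<comment> \<open>These are the times at which the orbit of x crosses an integer when x moves by m
    \<delta>. For m = r they concern the first base coordinate, for m = s the second.\<close>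
  define hits where "hits m n x = {i. i < m * q n \<and> 1 - real m * \<delta> n \<le> frac (x + real i * \<alpha>)}" for m n x
  have single: "card (hits r n x) = 1" if "hits r n x \<noteq> {}" for n x
  proof -
    have "real r * \<delta> n \<le> c / real (r * q n)"
    proof -
      have "real r * \<delta> n * real (r * q n) = (real r)\<^sup>2 * (real (q n) * \<delta> n)" by (simp add: power2_eq_square)
      also have "\<dots> \<le> (real r)\<^sup>2 * (2 * \<epsilon>)" using qd_hi[of n] by (intro mult_left_mono) auto
      also have "\<dots> \<le> c" using \<epsilon>(2) by simp
      finally show ?thesis using q0[of n] r1 by (simp add: pos_le_divide_eq)
    qed
    then have "i = j" if "i \<in> hits r n x" "j \<in> hits r n x" for i j
      using that badly_approximable_single_visit[OF bad c, of "real r * \<delta> n" "r * q n" i x j] by (simp add: hits_def)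
    then show ?thesis using that by (metis is_singletonI' is_singleton_altdef)
  qed
  define X where "X n = {x \<in> {0..<1}. hits r n x \<noteq> {}}" for n
  define Y where "Y n = {x \<in> {0..<1}. hits s n x \<noteq> {}}" for n
  define Z where "Z m n i = {x \<in> {0..<1}. 1 - real m * \<delta> n \<le> frac (x + real i * \<alpha>)}" for m n i
  have Zs [measurable]: "Z m n i \<in> sets circle_measure" for m n i unfolding Z_def by measurable
  have XZ: "X n = (\<Union>i<r * q n. Z r n i)" and YZ: "Y n = (\<Union>i<s * q n. Z s n i)" for n
    by (auto simp: X_def Y_def Z_def hits_def)
  have Xs [measurable]: "X n \<in> sets circle_measure" and Ys [measurable]: "Y n \<in> sets circle_measure" for n
    unfolding XZ YZ by measurable
  \<comment> \<open>By the single visit property the r q arcs are disjoint, so the measure is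
    exactly the sum of their lengths. From \<open>Y n\<close> only an upper bound is wanted, and a
    union bound gives it.\<close>
  have Xm: "measure circle_measure (X n) = (real r)\<^sup>2 * (real (q n) * \<delta> n)" for n
  proof -
    have "measure circle_measure (X n) = (\<Sum>i<r * q n. measure circle_measure (Z r n i))"
      unfolding XZ
    proof (rule circle.finite_measure_finite_Union)
      show "disjoint_family_on (Z r n) {..<r * q n}"
        unfolding disjoint_family_on_def
      proof (intro ballI impI)
        fix i j assume ij: "i \<in> {..<r * q n}" "j \<in> {..<r * q n}" "i \<noteq> j"
        have False if x: "x \<in> Z r n i" "x \<in> Z r n j" for x
        proof -
          have "{i, j} \<subseteq> hits r n x" using x ij by (auto simp: Z_def hits_def)
          moreover have "finite (hits r n x)" by (simp add: hits_def)
          ultimately have "card {i, j} \<le> 1" using single[of n x] by (metis card_mono insert_not_empty subset_empty)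
          then show False using ij by simp
        qed
        then show "Z r n i \<inter> Z r n j = {}" by blast
      qed
    qed (use Zs in auto)
    also have "\<dots> = (\<Sum>i<r * q n. real r * \<delta> n)"
      unfolding Z_def using r\<delta>[of n] \<delta>0[of n] by (intro sum.cong refl measure_circle_visit) auto
    finally show ?thesis by (simp add: power2_eq_square mult_ac)
  qed
  have Ym: "measure circle_measure (Y n) \<le> (real s)\<^sup>2 * (real (q n) * \<delta> n)" for n
  proof -
    have "measure circle_measure (Y n) \<le> (\<Sum>i<s * q n. measure circle_measure (Z s n i))"
      unfolding YZ by (rule measure_UNION_le) auto
    also have "\<dots> = (\<Sum>i<s * q n. real s * \<delta> n)"
      unfolding Z_def using s\<delta>[of n] \<delta>0[of n] by (intro sum.cong refl measure_circle_visit) auto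
    finally show ?thesis by (simp add: power2_eq_square mult_ac)
  qed
  \<comment> \<open>On this set exactly one jump is crossed in the first coordinate and none in the
    second, so the cocycle changes there by the constants r^2 q \<delta> - 1 and s^2 q
    \<delta>.\<close>
  define A where "A n = {b \<in> space \<rho>. fst b \<in> X n} - {b \<in> space \<rho>. snd b \<in> Y n}" for n
  have slice: "{b \<in> space \<rho>. fst b \<in> U} \<in> sets \<rho>" "{b \<in> space \<rho>. snd b \<in> U} \<in> sets \<rho>"
    if [measurable]: "U \<in> sets circle_measure" for U by measurable
  have As: "A n \<in> sets \<Omega>" for n
    using slice(1)[OF Xs, of n] slice(2)[OF Ys, of n] unfolding A_def by auto
  have \<delta>_lim: "\<delta> \<longlonglongrightarrow> 0"
  proof (rule tendsto_sandwich[OF _ _ tendsto_const])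
    show "(\<lambda>n. 2 * \<epsilon> * (1 / real (Suc n))) \<longlonglongrightarrow> 0"
      using tendsto_mult_left[OF LIMSEQ_inverse_real_of_nat, of "2 * \<epsilon>"] by (simp add: inverse_eq_divide)
    have "\<delta> n \<le> 2 * \<epsilon> * (1 / real (Suc n))" for n
    proof -
      have "real (Suc n) * \<delta> n \<le> real (q n) * \<delta> n" using q[of n] \<delta>0[of n] by (intro mult_right_mono) auto
      then have "real (Suc n) * \<delta> n \<le> 2 * \<epsilon>" using qd_hi[of n] by linarith
      then show ?thesis by (simp add: pos_le_divide_eq mult.commute)
    qed
    then show "\<forall>\<^sub>F n in sequentially. \<delta> n \<le> 2 * \<epsilon> * (1 / real (Suc n))" by simp
  qed (use \<delta>0 in simp)
  have qd_lim: "(\<lambda>n. real (q n) * \<delta> n) \<longlonglongrightarrow> \<epsilon>"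
  proof (rule LIM_zero_cancel, rule Lim_null_comparison)
    show "\<forall>\<^sub>F n in sequentially. norm (real (q n) * \<delta> n - \<epsilon>) \<le> \<epsilon> / real (n + 2)"
      using qd by (intro always_eventually allI) (simp add: less_imp_le)
    show "(\<lambda>n. \<epsilon> / real (n + 2)) \<longlonglongrightarrow> 0"
      using LIMSEQ_ignore_initial_segment[OF lim_const_over_n[of \<epsilon>], of 2] by simp
  qed
  have bk_le: "\<bar>birkhoff \<alpha> (m * q n) x\<bar> \<le> 4 * real r" if "m \<le> r" for m n x
  proof -
    have "\<bar>birkhoff \<alpha> (m * q n) x\<bar> \<le> real m * 4" by (rule birkhoff_mult_bound[OF bk])
    then show ?thesis using that by simp
  qed
  have shift: "birkhoff \<alpha> (m * q n) (x + real m * \<delta> n) = birkhoff \<alpha> (m * q n) x + ((real m)\<^sup>2 * (real (q n) * \<delta> n) - real (card (hits m n x)))"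
    if "real m * \<delta> n < 1" for m n x
    using birkhoff_shift[of "real m * \<delta> n" \<alpha> "m * q n" x] that \<delta>0[of n]
    by (simp add: hits_def power2_eq_square algebra_simps)
  interpret jump_sequence \<nu> S \<alpha> r s \<kappa> q k \<delta> A "\<lambda>n. (real r)\<^sup>2 * (real (q n) * \<delta> n) - 1" "\<lambda>n. (real s)\<^sup>2 * (real (q n) * \<delta> n)"
    "(real r)\<^sup>2 * \<epsilon> - 1" "(real s)\<^sup>2 * \<epsilon>" "4 * real r"
  proof
    show "\<delta> n - real (k n) * \<alpha> \<in> \<int>" for n by (simp add: \<delta>_def frac_def)
    show "\<delta> \<longlonglongrightarrow> 0" by (rule \<delta>_lim)
    show "A n \<in> sets \<Omega>" for n by (rule As)
    show "\<bar>birkhoff \<alpha> (r * q n) (fst b)\<bar> \<le> 4 * real r" for n b by (rule bk_le) simp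
    show "\<bar>birkhoff \<alpha> (s * q n) (snd b)\<bar> \<le> 4 * real r" for n b by (rule bk_le) (use rs in simp)
    show "birkhoff \<alpha> (r * q n) (fst b + real r * \<delta> n) = birkhoff \<alpha> (r * q n) (fst b) + ((real r)\<^sup>2 * (real (q n) * \<delta> n) - 1)"
      if "b \<in> A n" for n b
      unfolding shift[OF r\<delta>] using that single[of n "fst b"] by (auto simp: A_def X_def)
    show "birkhoff \<alpha> (s * q n) (snd b + real s * \<delta> n) = birkhoff \<alpha> (s * q n) (snd b) + (real s)\<^sup>2 * (real (q n) * \<delta> n)"
      if "b \<in> A n" for n b
      unfolding shift[OF s\<delta>] using that by (auto simp: A_def Y_def)
    show "(\<lambda>n. (real r)\<^sup>2 * (real (q n) * \<delta> n) - 1) \<longlonglongrightarrow> (real r)\<^sup>2 * \<epsilon> - 1"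
      by (intro tendsto_intros qd_lim)
    show "(\<lambda>n. (real s)\<^sup>2 * (real (q n) * \<delta> n)) \<longlonglongrightarrow> (real s)\<^sup>2 * \<epsilon>"
      by (intro tendsto_intros qd_lim)
  qed
  have sq: "(real s)\<^sup>2 < (real r)\<^sup>2" using rs by (intro power_strict_mono) auto
  show ?thesis
  proof (rule jump_invariance)
    \<comment> \<open>The lower bound for the measure of \<open>A n\<close> is the measure of
      \<open>X n\<close> minus that of \<open>Y n\<close>, at least (r^2 - s^2) q \<delta>, combined
      with q \<delta> \<ge> \<epsilon>/2. Its positivity is where s < r is decisive.\<close>
    show "0 < ((real r)\<^sup>2 - (real s)\<^sup>2) * (\<epsilon> / 2)" using sq \<epsilon> by simp
    fix n
    have "((real r)\<^sup>2 - (real s)\<^sup>2) * (\<epsilon> / 2) \<le> ((real r)\<^sup>2 - (real s)\<^sup>2) * (real (q n) * \<delta> n)"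
      using sq qd_lo[of n] by (intro mult_left_mono) linarith+
    also have "\<dots> \<le> measure circle_measure (X n) - measure circle_measure (Y n)"
      using Xm[of n] Ym[of n] by (simp add: left_diff_distrib)
    also have "\<dots> = measure \<rho> {b \<in> space \<rho>. fst b \<in> X n} - measure \<rho> {b \<in> space \<rho>. snd b \<in> Y n}"
      by (simp only: rho_measure_fst[OF Xs] rho_measure_snd[OF Ys])
    also have "\<dots> \<le> measure \<rho> (A n)"
    proof -
      have "measure \<rho> {b \<in> space \<rho>. fst b \<in> X n} \<le> measure \<rho> (A n \<union> {b \<in> space \<rho>. snd b \<in> Y n})"
      proof (rule rho.finite_measure_mono)
        have "A n \<in> sets \<rho>" using As by simp
        then show "A n \<union> {b \<in> space \<rho>. snd b \<in> Y n} \<in> sets \<rho>" by (rule sets.Un) (rule slice(2)[OF Ys])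
      qed (auto simp: A_def)
      also have "\<dots> \<le> measure \<rho> (A n) + measure \<rho> {b \<in> space \<rho>. snd b \<in> Y n}"
      proof (rule measure_Un_le)
        show "A n \<in> sets \<rho>" using As by simp
      qed (rule slice(2)[OF Ys])
      finally show ?thesis by simp
    qed
    finally show "((real r)\<^sup>2 - (real s)\<^sup>2) * (\<epsilon> / 2) \<le> measure \<rho> (A n)" .
  qed
qed

section \<open>The group of invariant time vectors\<close>

lemma fib_invariance_add:
  assumes "distr \<kappa> \<kappa> (fib t u) = \<kappa>" "distr \<kappa> \<kappa> (fib t' u') = \<kappa>"
  shows "distr \<kappa> \<kappa> (fib (t + t') (u + u')) = \<kappa>"
proof -
  have "distr \<kappa> \<kappa> (fib (t + t') (u + u')) = distr \<kappa> \<kappa> (fib t u \<circ> fib t' u')"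
    by (rule distr_cong) (auto simp: fib_fib)
  also have "\<dots> = distr (distr \<kappa> \<kappa> (fib t' u')) \<kappa> (fib t u)"
    by (rule distr_distr[symmetric]) auto
  finally show ?thesis using assms by simp
qed

lemma fib_invariance_minus:
  assumes "distr \<kappa> \<kappa> (fib t u) = \<kappa>"
  shows "distr \<kappa> \<kappa> (fib (- t) (- u)) = \<kappa>"
proof -
  have "distr \<kappa> \<kappa> (fib (- t) (- u)) = distr (distr \<kappa> \<kappa> (fib t u)) \<kappa> (fib (- t) (- u))"
    by (simp add: assms)
  also have "\<dots> = distr \<kappa> \<kappa> (fib (- t) (- u) \<circ> fib t u)" by (rule distr_distr) auto
  also have "\<dots> = distr \<kappa> \<kappa> (\<lambda>p. p)" by (rule distr_cong) (auto simp: fib_fib)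
  finally show ?thesis by simp
qed

lemma fib_invariance_mult:
  assumes "distr \<kappa> \<kappa> (fib t u) = \<kappa>"
  shows "distr \<kappa> \<kappa> (fib (real m * t) (real m * u)) = \<kappa>"
proof (induction m)
  case 0
  have "distr \<kappa> \<kappa> (fib 0 0) = distr \<kappa> \<kappa> (\<lambda>p. p)" by (rule distr_cong) auto
  then show ?case by simp
next
  case (Suc m)
  then show ?case using fib_invariance_add[OF assms Suc] by (simp add: algebra_simps)
qed

lemma rational_fibre_invariance:
  assumes irr: "\<alpha> \<notin> \<rat>" and bd: "bounded_partial_quotients \<alpha>" and rs: "s < r"
  shows "distr \<kappa> \<kappa> (fib (- 1) 0) = \<kappa>" "distr \<kappa> \<kappa> (fib 0 ((real s)\<^sup>2 / (real r)\<^sup>2)) = \<kappa>"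
proof -
  obtain c where c: "0 < c" and bad: "\<And>(q::int) p::int. 1 \<le> q \<Longrightarrow> c / of_int q \<le> \<bar>of_int q * \<alpha> - of_int p\<bar>"
    using bounded_partial_quotients_badly_approximable[OF irr bd] by blast
  have r1: "1 \<le> real r" using rs by simp
  obtain m :: nat where m: "max (2 / c) 2 < real m" using reals_Archimedean2 by blast
  \<comment> \<open>With r^2 \<epsilon> = 1/m the m-fold multiple of (r^2 \<epsilon>, s^2
    \<epsilon>) is (1, s^2/r^2), and adding (-1, 0) leaves a vector in the second fibre alone with a
    rational entry. The conditions m > 2/c and m > 2 supply the two smallness requirements on
    \<epsilon>.\<close>
  define \<epsilon> where "\<epsilon> = 1 / ((real r)\<^sup>2 * real m)"
  have m0: "0 < real m" "2 < real m" "2 / c < real m" using m by auto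
  have \<epsilon>: "0 < \<epsilon>" using m0 r1 by (simp add: \<epsilon>_def)
  have e1: "(real r)\<^sup>2 * \<epsilon> = 1 / real m" using r1 by (simp add: \<epsilon>_def)
  have e2: "2 * (real r)\<^sup>2 * \<epsilon> \<le> c"
  proof -
    have "2 / c * c \<le> real m * c" using m0 c by (intro mult_right_mono) auto
    then have "2 / real m \<le> c" using m0 c by (simp add: divide_le_eq mult.commute)
    then show ?thesis using e1 by (simp add: mult.assoc)
  qed
  have e3: "2 * real r * \<epsilon> < 1"
  proof -
    have "2 * real r * \<epsilon> \<le> 2 * (real r)\<^sup>2 * \<epsilon>"
      using r1 \<epsilon> by (intro mult_right_mono mult_left_mono) (auto simp: power2_eq_square)
    also have "\<dots> = 2 / real m" using e1 by (simp add: mult.assoc)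
    also have "\<dots> < 1" using m0 by simp
    finally show ?thesis .
  qed
  have i1: "distr \<kappa> \<kappa> (fib ((real r)\<^sup>2 * \<epsilon> - 1) ((real s)\<^sup>2 * \<epsilon>)) = \<kappa>"
    by (rule small_jump_invariance[OF irr c bad rs \<epsilon> e2 e3])
  have i2: "distr \<kappa> \<kappa> (fib ((real r)\<^sup>2 * (\<epsilon> / 2) - 1) ((real s)\<^sup>2 * (\<epsilon> / 2))) = \<kappa>"
    by (rule small_jump_invariance[OF irr c bad rs]) (use \<epsilon> e2 e3 c in auto)
  \<comment> \<open>Twice the time vector for \<open>\<epsilon> / 2\<close> minus the one for \<open>\<epsilon>\<close> is \<open>(- 1, 0)\<close>.\<close>
  note i3 = fib_invariance_add[OF fib_invariance_mult[OF i2, of 2] fib_invariance_minus[OF i1]]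
  show one: "distr \<kappa> \<kappa> (fib (- 1) 0) = \<kappa>" using i3 by (simp add: algebra_simps)
  have "distr \<kappa> \<kappa> (fib ((real r)\<^sup>2 * \<epsilon>) ((real s)\<^sup>2 * \<epsilon>)) = \<kappa>"
    using fib_invariance_add[OF i1 fib_invariance_minus[OF one]] by simp
  note i4 = fib_invariance_add[OF fib_invariance_mult[OF this, of m] one]
  have "real m * ((real r)\<^sup>2 * \<epsilon>) = 1" using e1 m0 by simp
  moreover have "real m * ((real s)\<^sup>2 * \<epsilon>) = (real s)\<^sup>2 / (real r)\<^sup>2" using m0 by (simp add: \<epsilon>_def)
  ultimately show "distr \<kappa> \<kappa> (fib 0 ((real s)\<^sup>2 / (real r)\<^sup>2)) = \<kappa>" using i4 by simp
qed

end

text \<open>Independence is proved for the first fibre coordinate and jumps are analysed for s < r.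
  Exchanging the factors covers the second coordinate and the opposite order.\<close>

lemma ergodic_joinings_swap:
  assumes \<kappa>: "\<kappa> \<in> ergodic_joinings M R r s" and R [measurable]: "R \<in> measurable M M"
  shows "distr \<kappa> (M \<Otimes>\<^sub>M M) (\<lambda>p. (snd p, fst p)) \<in> ergodic_joinings M R s r"
proof -
  define sw where "sw p = (snd p, fst p)" for p :: "'a \<times> 'a"
  define Q where "Q = (\<lambda>(p, q). ((R ^^ r) p, (R ^^ s) q))"
  define Q' where "Q' = (\<lambda>(p, q). ((R ^^ s) p, (R ^^ r) q))"
  define \<kappa>' where "\<kappa>' = distr \<kappa> (M \<Otimes>\<^sub>M M) sw"
  have sets [measurable_cong]: "sets \<kappa> = sets (M \<Otimes>\<^sub>M M)" and "prob_space \<kappa>"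
    and m1: "distr \<kappa> M fst = M" and m2: "distr \<kappa> M snd = M" and Qinv: "distr \<kappa> \<kappa> Q = \<kappa>"
    and erg: "\<And>A. A \<in> sets \<kappa> \<Longrightarrow> Q -` A \<inter> space \<kappa> = A \<Longrightarrow> measure \<kappa> A = 0 \<or> measure \<kappa> A = 1"
    using \<kappa> unfolding ergodic_joinings_def Q_def by blast+
  interpret prob_space \<kappa> by fact
  have sp: "space \<kappa> = space M \<times> space M"
    using sets_eq_imp_space_eq[OF sets] by (simp add: space_pair_measure)
  have [measurable]: "R ^^ n \<in> measurable M M" for n
    by (induction n) (auto intro: measurable_comp R simp: id_def)
  have swm [measurable]: "sw \<in> measurable \<kappa> (M \<Otimes>\<^sub>M M)" unfolding sw_def by measurable
  have Qm [measurable]: "Q \<in> measurable \<kappa> \<kappa>" unfolding Q_def by measurable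
  have Q'm [measurable]: "Q' \<in> measurable (M \<Otimes>\<^sub>M M) (M \<Otimes>\<^sub>M M)" unfolding Q'_def by measurable
  have s': "sets \<kappa>' = sets (M \<Otimes>\<^sub>M M)" "space \<kappa>' = space M \<times> space M"
    by (auto simp: \<kappa>'_def space_pair_measure)
  have p': "prob_space \<kappa>'" unfolding \<kappa>'_def by (rule prob_space_distr[OF swm])
  have "distr \<kappa>' M fst = distr \<kappa> M (fst \<circ> sw)" "distr \<kappa>' M snd = distr \<kappa> M (snd \<circ> sw)"
    unfolding \<kappa>'_def by (rule distr_distr; measurable)+
  then have mm: "distr \<kappa>' M fst = M" "distr \<kappa>' M snd = M"
    using m1 m2 by (simp_all add: sw_def comp_def)
  have Qsw: "Q' (sw p) = sw (Q p)" for p by (simp add: Q_def Q'_def sw_def split_beta)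
  have "distr \<kappa>' \<kappa>' Q' = distr \<kappa>' (M \<Otimes>\<^sub>M M) Q'" by (rule distr_cong) (auto simp: s')
  also have "\<dots> = distr \<kappa> (M \<Otimes>\<^sub>M M) (Q' \<circ> sw)" unfolding \<kappa>'_def by (rule distr_distr) auto
  also have "\<dots> = distr \<kappa> (M \<Otimes>\<^sub>M M) (sw \<circ> Q)" by (rule distr_cong) (auto simp: Qsw)
  also have "\<dots> = distr (distr \<kappa> \<kappa> Q) (M \<Otimes>\<^sub>M M) sw" by (rule distr_distr[symmetric]) auto
  finally have inv': "distr \<kappa>' \<kappa>' Q' = \<kappa>'" by (simp add: Qinv \<kappa>'_def)
  have erg': "measure \<kappa>' A = 0 \<or> measure \<kappa>' A = 1" if A: "A \<in> sets \<kappa>'" "Q' -` A \<inter> space \<kappa>' = A" for A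
  proof -
    have Am [measurable]: "A \<in> sets (M \<Otimes>\<^sub>M M)" using A s' by simp
    define B where "B = sw -` A \<inter> space \<kappa>"
    have Bm: "B \<in> sets \<kappa>" unfolding B_def by measurable
    have swsp: "sw p \<in> space \<kappa>'" if "p \<in> space \<kappa>" for p using that by (auto simp: s' sp sw_def)
    have "Q p \<in> B \<longleftrightarrow> p \<in> B" if p: "p \<in> space \<kappa>" for p
    proof -
      have "Q p \<in> B \<longleftrightarrow> Q' (sw p) \<in> A" using measurable_space[OF Qm p] by (simp add: B_def Qsw)
      also have "\<dots> \<longleftrightarrow> sw p \<in> A" using A(2) swsp[OF p] by blast
      finally show ?thesis using p by (simp add: B_def)
    qed
    moreover have "B \<subseteq> space \<kappa>" by (auto simp: B_def)
    ultimately have "Q -` B \<inter> space \<kappa> = B" by blast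
    moreover have "measure \<kappa>' A = measure \<kappa> B"
      unfolding \<kappa>'_def B_def by (rule measure_distr) auto
    ultimately show ?thesis using erg[OF Bm] by simp
  qed
  have "\<kappa>' \<in> ergodic_joinings M R s r"
    using s' p' mm inv' erg' unfolding ergodic_joinings_def Q'_def by blast
  then show ?thesis unfolding \<kappa>'_def sw_def .
qed

section \<open>Averaging over both fibres\<close>

context prob_flow
begin

lemma fibre_integral:
  fixes F :: "real \<times> 'b \<Rightarrow> complex"
  assumes F [measurable]: "F \<in> borel_measurable \<M>" and b: "\<And>z. norm (F z) \<le> B"
  shows "(\<lambda>x. \<integral>y. F (x, y) \<partial>\<nu>) \<in> borel_measurable circle_measure" "norm (\<integral>y. F (x, y) \<partial>\<nu>) \<le> B"
proof -
  show "(\<lambda>x. \<integral>y. F (x, y) \<partial>\<nu>) \<in> borel_measurable circle_measure"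
    by (rule borel_measurable_lebesgue_integral) simp
  show "norm (\<integral>y. F (x, y) \<partial>\<nu>) \<le> B"
  proof (cases "integrable \<nu> (\<lambda>y. F (x, y))")
    case True
    have "norm (\<integral>y. F (x, y) \<partial>\<nu>) \<le> (\<integral>y. B \<partial>\<nu>)"
      by (rule order.trans[OF integral_norm_bound integral_mono]) (use True b in auto)
    then show ?thesis by (simp add: prob_space)
  next
    \<comment> \<open>This happens only for x outside [0, 1), where measurability of F says nothing
      about the section. The integral is then 0 by default and the bound still holds.\<close>
    case False
    have "0 \<le> B" using b norm_ge_zero order.trans by blast
    then show ?thesis using False by (simp add: not_integrable_integral_eq)
  qed
qed

end

context flow_joining
begin

lemma swap_joining:
  "flow_joining \<nu> S \<alpha> s r (distr \<kappa> (\<M> \<Otimes>\<^sub>M \<M>) (\<lambda>p. (snd p, fst p)))"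
  by (intro flow_joining.intro flow_joining_axioms.intro prob_flow_axioms ergodic_joinings_swap[OF joining skew_measurable])

lemma integral_swap:
  fixes F G :: "real \<times> 'b \<Rightarrow> complex"
  assumes [measurable]: "F \<in> borel_measurable \<M>" "G \<in> borel_measurable \<M>"
  shows "(\<integral>p. G (fst p) * F (snd p) \<partial>distr \<kappa> (\<M> \<Otimes>\<^sub>M \<M>) (\<lambda>p. (snd p, fst p)))
    = (\<integral>p. F (fst p) * G (snd p) \<partial>\<kappa>)"
  by (subst integral_distr) (auto simp: mult.commute)

lemma integrable_bounded_product:
  fixes F G :: "real \<times> 'b \<Rightarrow> complex"
  assumes [measurable]: "F \<in> borel_measurable \<M>" "G \<in> borel_measurable \<M>"
    and b: "\<And>z. norm (F z) \<le> B" "\<And>z. norm (G z) \<le> C"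
  shows "integrable \<kappa> (\<lambda>p. F (fst p) * G (snd p))"
proof (rule K.integrable_const_bound[where B="B * C"])
  have "0 \<le> B" using b(1) norm_ge_zero order.trans by blast
  then show "AE p in \<kappa>. norm (F (fst p) * G (snd p)) \<le> B * C"
    using b by (intro AE_I2) (auto simp: norm_mult intro!: mult_mono)
qed measurable

lemma average_fst:
  fixes F G :: "real \<times> 'b \<Rightarrow> complex"
  assumes noeig: "\<forall>t. t \<in> \<rat> \<longrightarrow> \<not> flow_eigenvalue_L2_0 \<nu> S t"
    and \<tau>: "\<tau> \<in> \<rat>" "\<tau> \<noteq> 0" and inv: "distr \<kappa> \<kappa> (fib \<tau> 0) = \<kappa>"
    and F [measurable]: "F \<in> borel_measurable \<M>" and G [measurable]: "G \<in> borel_measurable \<M>"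
    and b: "\<And>z. norm (F z) \<le> B" "\<And>z. norm (G z) \<le> C"
  shows "(\<integral>p. F (fst p) * G (snd p) \<partial>\<kappa>) = (\<integral>p. (\<integral>y. F (fst (fst p), y) \<partial>\<nu>) * G (snd p) \<partial>\<kappa>)"
proof (rule integral_fibre_average[where T="S \<tau>"])
  show "prob_space \<kappa>" "prob_space \<nu>" by (rule K.prob_space_axioms, rule prob_space_axioms)
  have "distr \<kappa> \<kappa> (\<lambda>p. ((fst (fst p), S \<tau> (snd (fst p))), snd p)) = distr \<kappa> \<kappa> (fib \<tau> 0)"
    by (rule distr_cong) (auto simp: fib_def space_kappa)
  then show "distr \<kappa> \<kappa> (\<lambda>p. ((fst (fst p), S \<tau> (snd (fst p))), snd p)) = \<kappa>" using inv by simp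
  show "integrable \<kappa> (\<lambda>p. F (fst p) * G (snd p))" by (rule integrable_bounded_product[OF F G b])
  show "measure \<nu> P = 0 \<or> measure \<nu> P = 1" if "P \<in> sets \<nu>" "S \<tau> -` P \<inter> space \<nu> = P" for P
    by (rule time_map_ergodic[OF noeig \<tau> that])
qed (auto simp: sets_kappa fibre_marginals S_distr)

text \<open>The invariant vector (-1, 0) allows averaging over the first fibre through the ergodic
  time -1 map. After the exchange of coordinates, (0, s^2/r^2) does the same for the second fibre,
  with the first function already replaced by its average; s > 0 makes that time nonzero.\<close>

lemma average_both_ordered:
  fixes F G :: "real \<times> 'b \<Rightarrow> complex"
  assumes irr: "\<alpha> \<notin> \<rat>" and bd: "bounded_partial_quotients \<alpha>" and rs: "0 < s" "s < r"
    and noeig: "\<forall>t. t \<in> \<rat> \<longrightarrow> \<not> flow_eigenvalue_L2_0 \<nu> S t"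
    and F [measurable]: "F \<in> borel_measurable \<M>" and G [measurable]: "G \<in> borel_measurable \<M>"
    and b: "\<And>z. norm (F z) \<le> B" "\<And>z. norm (G z) \<le> C"
  shows "(\<integral>p. F (fst p) * G (snd p) \<partial>\<kappa>) = (\<integral>p. (\<integral>y. F (fst (fst p), y) \<partial>\<nu>) * (\<integral>y. G (fst (snd p), y) \<partial>\<nu>) \<partial>\<kappa>)"
proof -
  define F0 where "F0 z = (\<integral>y. F (fst z, y) \<partial>\<nu>)" for z :: "real \<times> 'b"
  define G0 where "G0 z = (\<integral>y. G (fst z, y) \<partial>\<nu>)" for z :: "real \<times> 'b"
  have F0m [measurable]: "F0 \<in> borel_measurable \<M>"
    unfolding F0_def by (rule measurable_compose[OF measurable_fst fibre_integral(1)[OF F b(1)]])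
  have G0m [measurable]: "G0 \<in> borel_measurable \<M>"
    unfolding G0_def by (rule measurable_compose[OF measurable_fst fibre_integral(1)[OF G b(2)]])
  have F0b: "norm (F0 z) \<le> B" for z unfolding F0_def by (rule fibre_integral(2)[OF F b(1)])
  have 1: "(\<integral>p. F (fst p) * G (snd p) \<partial>\<kappa>) = (\<integral>p. F0 (fst p) * G (snd p) \<partial>\<kappa>)"
    unfolding F0_def
    by (rule average_fst[OF noeig _ _ rational_fibre_invariance(1)[OF irr bd rs(2)] F G b]) auto
  define \<kappa>' where "\<kappa>' = distr \<kappa> (\<M> \<Otimes>\<^sub>M \<M>) (\<lambda>p. (snd p, fst p))"
  interpret sw: flow_joining \<nu> S \<alpha> s r \<kappa>' unfolding \<kappa>'_def by (rule swap_joining)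
  define \<tau> where "\<tau> = (real s)\<^sup>2 / (real r)\<^sup>2"
  have \<tau>: "\<tau> \<in> \<rat>" "\<tau> \<noteq> 0" using rs by (auto simp: \<tau>_def)
  have inv': "distr \<kappa>' \<kappa>' (sw.fib \<tau> 0) = \<kappa>'"
  proof -
    let ?MM = "\<M> \<Otimes>\<^sub>M \<M>"
    have swm: "(\<lambda>p. (snd p, fst p)) \<in> measurable \<kappa> ?MM" by measurable
    have swm': "(\<lambda>p. (snd p, fst p)) \<in> measurable \<kappa> \<kappa>'" using swm by (simp add: \<kappa>'_def)
    have e: "\<kappa>' = distr \<kappa> \<kappa>' (\<lambda>p. (snd p, fst p))"
    proof -
      have "distr \<kappa> ?MM (\<lambda>p. (snd p, fst p)) = distr \<kappa> \<kappa>' (\<lambda>p. (snd p, fst p))"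
        by (rule distr_cong) (auto simp: \<kappa>'_def)
      then show ?thesis by (simp add: \<kappa>'_def)
    qed
    have "distr \<kappa>' \<kappa>' (sw.fib \<tau> 0) = distr (distr \<kappa> \<kappa>' (\<lambda>p. (snd p, fst p))) \<kappa>' (sw.fib \<tau> 0)"
      using e by simp
    also have "\<dots> = distr \<kappa> \<kappa>' (sw.fib \<tau> 0 \<circ> (\<lambda>p. (snd p, fst p)))"
      by (rule distr_distr[OF sw.fib_measurable swm'])
    also have "\<dots> = distr \<kappa> \<kappa>' ((\<lambda>p. (snd p, fst p)) \<circ> fib 0 \<tau>)"
      by (rule distr_cong) (auto simp: fib_def sw.fib_def)
    also have "\<dots> = distr (distr \<kappa> \<kappa> (fib 0 \<tau>)) \<kappa>' (\<lambda>p. (snd p, fst p))"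
      by (rule distr_distr[OF swm' fib_measurable, symmetric])
    also have "distr \<kappa> \<kappa> (fib 0 \<tau>) = \<kappa>" unfolding \<tau>_def by (rule rational_fibre_invariance(2)[OF irr bd rs(2)])
    finally show ?thesis using e by simp
  qed
  have "(\<integral>p. F0 (fst p) * G (snd p) \<partial>\<kappa>) = (\<integral>p. G (fst p) * F0 (snd p) \<partial>\<kappa>')"
    unfolding \<kappa>'_def by (rule integral_swap[symmetric]) auto
  also have "\<dots> = (\<integral>p. G0 (fst p) * F0 (snd p) \<partial>\<kappa>')"
    unfolding G0_def by (rule sw.average_fst[OF noeig \<tau> inv' G F0m b(2) F0b])
  also have "\<dots> = (\<integral>p. F0 (fst p) * G0 (snd p) \<partial>\<kappa>)"
    unfolding \<kappa>'_def by (rule integral_swap) auto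
  finally show ?thesis using 1 by (simp add: F0_def G0_def)
qed

lemma average_both:
  fixes F G :: "real \<times> 'b \<Rightarrow> complex"
  assumes irr: "\<alpha> \<notin> \<rat>" and bd: "bounded_partial_quotients \<alpha>" and rs: "0 < s" "0 < r" "s \<noteq> r"
    and noeig: "\<forall>t. t \<in> \<rat> \<longrightarrow> \<not> flow_eigenvalue_L2_0 \<nu> S t"
    and F [measurable]: "F \<in> borel_measurable \<M>" and G [measurable]: "G \<in> borel_measurable \<M>"
    and b: "\<And>z. norm (F z) \<le> B" "\<And>z. norm (G z) \<le> C"
  shows "(\<integral>p. F (fst p) * G (snd p) \<partial>\<kappa>) = (\<integral>p. (\<integral>y. F (fst (fst p), y) \<partial>\<nu>) * (\<integral>y. G (fst (snd p), y) \<partial>\<nu>) \<partial>\<kappa>)"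
proof (cases "s < r")
  case True
  then show ?thesis using average_both_ordered[OF irr bd rs(1) True noeig F G b] by simp
next
  case False
  then have rs': "r < s" using rs by simp
  define \<kappa>' where "\<kappa>' = distr \<kappa> (\<M> \<Otimes>\<^sub>M \<M>) (\<lambda>p. (snd p, fst p))"
  interpret sw: flow_joining \<nu> S \<alpha> s r \<kappa>' unfolding \<kappa>'_def by (rule swap_joining)
  define F0 where "F0 z = (\<integral>y. F (fst z, y) \<partial>\<nu>)" for z :: "real \<times> 'b"
  define G0 where "G0 z = (\<integral>y. G (fst z, y) \<partial>\<nu>)" for z :: "real \<times> 'b"
  have F0m: "F0 \<in> borel_measurable \<M>"
    unfolding F0_def by (rule measurable_compose[OF measurable_fst fibre_integral(1)[OF F b(1)]])
  have G0m: "G0 \<in> borel_measurable \<M>"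
    unfolding G0_def by (rule measurable_compose[OF measurable_fst fibre_integral(1)[OF G b(2)]])
  have "(\<integral>p. F (fst p) * G (snd p) \<partial>\<kappa>) = (\<integral>p. G (fst p) * F (snd p) \<partial>\<kappa>')"
    unfolding \<kappa>'_def by (rule integral_swap[OF F G, symmetric])
  also have "\<dots> = (\<integral>p. G0 (fst p) * F0 (snd p) \<partial>\<kappa>')"
    unfolding F0_def G0_def by (rule sw.average_both_ordered[OF irr bd rs(2) rs' noeig G F b(2,1)])
  also have "\<dots> = (\<integral>p. F0 (fst p) * G0 (snd p) \<partial>\<kappa>)"
    unfolding \<kappa>'_def by (rule integral_swap[OF F0m G0m])
  finally show ?thesis by (simp add: F0_def G0_def)
qed

end

section \<open>Characters on the base and conclusion\<close>

context flow_joining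
begin

lemma marginal_integral:
  fixes h :: "real \<Rightarrow> 'c::{banach, second_countable_topology}"
  assumes [measurable]: "h \<in> borel_measurable circle_measure"
  shows "(\<integral>p. h (fst (fst p)) \<partial>\<kappa>) = (\<integral>x. h x \<partial>circle_measure)"
    "(\<integral>p. h (fst (snd p)) \<partial>\<kappa>) = (\<integral>x. h x \<partial>circle_measure)"
proof -
  have *: "distr \<kappa> circle_measure (\<lambda>p. fst (fst p)) = circle_measure" "distr \<kappa> circle_measure (\<lambda>p. fst (snd p)) = circle_measure"
  proof -
    have "distr \<rho> circle_measure fst = distr \<kappa> circle_measure (fst \<circ> base)"
      "distr \<rho> circle_measure snd = distr \<kappa> circle_measure (snd \<circ> base)"
      unfolding \<rho>_def by (rule distr_distr; auto)+
    then show "distr \<kappa> circle_measure (\<lambda>p. fst (fst p)) = circle_measure" "distr \<kappa> circle_measure (\<lambda>p. fst (snd p)) = circle_measure"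
      by (simp_all add: rho_marginals base_def comp_def)
  qed
  have m: "(\<lambda>p. fst (fst p)) \<in> measurable \<kappa> circle_measure" "(\<lambda>p. fst (snd p)) \<in> measurable \<kappa> circle_measure"
    by measurable
  show "(\<integral>p. h (fst (fst p)) \<partial>\<kappa>) = (\<integral>x. h x \<partial>circle_measure)"
    using integral_distr[OF m(1) assms] by (simp add: *)
  show "(\<integral>p. h (fst (snd p)) \<partial>\<kappa>) = (\<integral>x. h x \<partial>circle_measure)"
    using integral_distr[OF m(2) assms] by (simp add: *)
qed

text \<open>The product character is an eigenfunction of \<open>Q\<close> with eigenvalue cis (2 pi
  (m r + n s) \<alpha>). Irrationality of \<alpha> makes this different from 1, so an invariant
  measure integrates the character to 0.\<close>

lemma char_integral_0:
  fixes m n :: int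
  assumes irr: "\<alpha> \<notin> \<rat>" and ne: "m * int r + n * int s \<noteq> 0"
  shows "(\<integral>p. cis (2 * pi * of_int m * fst (fst p)) * cis (2 * pi * of_int n * fst (snd p)) \<partial>\<kappa>) = 0"
proof -
  let ?h = "\<lambda>p. cis (2 * pi * of_int m * fst (fst p)) * cis (2 * pi * of_int n * fst (snd p))"
  define \<beta> where "\<beta> = of_int (m * int r + n * int s) * \<alpha>"
  have cm [measurable]: "(\<lambda>t. cis (2 * pi * of_int m * t)) \<in> borel_measurable circle_measure" for m
    by (intro borel_measurable_circle trig_poly_measurable trig_poly.char)
  have h: "?h \<in> borel_measurable \<kappa>"
  proof (rule borel_measurable_times)
    have m: "(\<lambda>p. fst (fst p)) \<in> measurable \<kappa> circle_measure" "(\<lambda>p. fst (snd p)) \<in> measurable \<kappa> circle_measure"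
      by measurable
    show "(\<lambda>p. cis (2 * pi * of_int m * fst (fst p))) \<in> borel_measurable \<kappa>"
      by (rule measurable_compose[OF m(1) cm])
    show "(\<lambda>p. cis (2 * pi * of_int n * fst (snd p))) \<in> borel_measurable \<kappa>"
      by (rule measurable_compose[OF m(2) cm])
  qed
  have "(\<integral>p. ?h p \<partial>\<kappa>) = (\<integral>p. ?h (Q p) \<partial>\<kappa>)"
    using integral_distr[OF Q_measurable h] by (simp add: Q_distr)
  also have "\<dots> = (\<integral>p. cis (2 * pi * \<beta>) * ?h p \<partial>\<kappa>)"
  proof (rule Bochner_Integration.integral_cong[OF refl])
    fix p assume p: "p \<in> space \<kappa>"
    have b: "fst (fst (Q p)) = frac (fst (fst p) + real r * \<alpha>)" "fst (snd (Q p)) = frac (fst (snd p) + real s * \<alpha>)"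
      using Q_funpow_eq[OF p, of 1] by (auto simp: rot_def base_def)
    show "?h (Q p) = cis (2 * pi * \<beta>) * ?h p"
      unfolding b cis_int_frac by (simp add: cis_mult \<beta>_def algebra_simps)
  qed
  also have "\<dots> = cis (2 * pi * \<beta>) * (\<integral>p. ?h p \<partial>\<kappa>)" by simp
  finally have "(\<integral>p. ?h p \<partial>\<kappa>) * (cis (2 * pi * \<beta>) - 1) = 0" by (simp add: algebra_simps)
  moreover have "cis (2 * pi * \<beta>) \<noteq> 1"
  proof
    assume "cis (2 * pi * \<beta>) = 1"
    then have "cos (2 * pi * \<beta>) = 1" by (metis cis.simps(1) one_complex.simps(1))
    then obtain k :: int where "2 * pi * \<beta> = of_int k * 2 * pi"
      using cos_one_2pi_int by blast
    then have "of_int (m * int r + n * int s) * \<alpha> = of_int k" by (simp add: \<beta>_def)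
    then have "\<alpha> = of_int k / of_int (m * int r + n * int s)"
      using ne by (simp add: eq_divide_eq mult.commute del: of_int_add of_int_mult)
    then have "\<alpha> \<in> \<rat>" by simp
    then show False using irr by simp
  qed
  ultimately show ?thesis by simp
qed

end

text \<open>For characters of degrees m and n the threshold |m| + |n| works: m r + n s = 0 with
  distinct primes r, s forces r to divide n, and |n| < r then gives n = 0 and m = 0. Bilinearity
  does the rest. The threshold depends on the two polynomials but on no joining.\<close>

lemma trig_poly_joining_integral:
  assumes irr: "\<alpha> \<notin> \<rat>" and P: "trig_poly P" and P': "trig_poly P'"
  shows "\<exists>D. \<forall>r s \<kappa>. prime r \<and> prime s \<and> r \<noteq> s \<and> D < r \<and> D < s \<and> flow_joining \<nu> S \<alpha> r s \<kappa> \<longrightarrow>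
    (\<integral>p. P (fst (fst p)) * P' (fst (snd p)) \<partial>\<kappa>) = (\<integral>x. P x \<partial>circle_measure) * (\<integral>x. P' x \<partial>circle_measure)"
proof -
  define ok where "ok D P P' \<longleftrightarrow> (\<forall>r s \<kappa>. prime r \<and> prime s \<and> r \<noteq> s \<and> D < r \<and> D < s \<and> flow_joining \<nu> S \<alpha> r s \<kappa> \<longrightarrow>
    (\<integral>p. P (fst (fst p)) * P' (fst (snd p)) \<partial>\<kappa>) = (\<integral>x. P x \<partial>circle_measure) * (\<integral>x. P' x \<partial>circle_measure))"
    for D :: nat and P P' :: "real \<Rightarrow> complex"
  have int: "integrable \<kappa> (\<lambda>p. P (fst (fst p)) * P' (fst (snd p)))"
    if "flow_joining \<nu> S \<alpha> r s \<kappa>" and P: "trig_poly P" and P': "trig_poly P'" for r s \<kappa> P P'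
  proof -
    interpret flow_joining \<nu> S \<alpha> r s \<kappa> by fact
    obtain B C where b: "\<And>x. norm (P x) \<le> B" "\<And>x. norm (P' x) \<le> C"
      using trig_poly_bounded[OF P] trig_poly_bounded[OF P'] by blast
    have "(\<lambda>z. P (fst z)) \<in> borel_measurable \<M>" "(\<lambda>z. P' (fst z)) \<in> borel_measurable \<M>"
      by (rule measurable_compose[OF measurable_fst borel_measurable_circle[OF trig_poly_measurable[OF P]]],
          rule measurable_compose[OF measurable_fst borel_measurable_circle[OF trig_poly_measurable[OF P']]])
    then show ?thesis by (rule integrable_bounded_product) (rule b)+
  qed
  have char_char: "\<exists>D. ok D (\<lambda>x. cis (2 * pi * of_int m * x)) (\<lambda>x. cis (2 * pi * of_int n * x))" for m n :: int
  proof (intro exI[of _ "nat (\<bar>m\<bar> + \<bar>n\<bar>)"])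
    show "ok (nat (\<bar>m\<bar> + \<bar>n\<bar>)) (\<lambda>x. cis (2 * pi * of_int m * x)) (\<lambda>x. cis (2 * pi * of_int n * x))"
      unfolding ok_def
    proof (intro allI impI, elim conjE)
      fix r s \<kappa> assume pr: "prime r" "prime s" "r \<noteq> s" and D: "nat (\<bar>m\<bar> + \<bar>n\<bar>) < r" "nat (\<bar>m\<bar> + \<bar>n\<bar>) < s"
        and J: "flow_joining \<nu> S \<alpha> r s \<kappa>"
      interpret flow_joining \<nu> S \<alpha> r s \<kappa> by fact
      show "(\<integral>p. cis (2 * pi * of_int m * fst (fst p)) * cis (2 * pi * of_int n * fst (snd p)) \<partial>\<kappa>)
        = (\<integral>x. cis (2 * pi * of_int m * x) \<partial>circle_measure) * (\<integral>x. cis (2 * pi * of_int n * x) \<partial>circle_measure)"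
      proof (cases "m = 0 \<and> n = 0")
        case True
        then show ?thesis by (simp add: K.prob_space circle.prob_space[simplified])
      next
        case False
        have "m * int r + n * int s \<noteq> 0"
        proof
          assume z: "m * int r + n * int s = 0"
          have "int r dvd n * int s"
          proof -
            have "n * int s = int r * (- m)" using z by (simp add: algebra_simps)
            then show ?thesis by simp
          qed
          moreover have "coprime (int r) (int s)" using pr by (simp add: primes_coprime)
          ultimately have "int r dvd n" by (simp add: coprime_dvd_mult_left_iff)
          moreover have "\<bar>n\<bar> < int r" using D by linarith
          ultimately have "n = 0" using dvd_imp_le_int[of n "int r"] by auto
          then have "m = 0" using z pr(1) by (auto simp: prime_gt_0_nat)
          then show False using False \<open>n = 0\<close> by simp
        qed
        then have "(\<integral>p. cis (2 * pi * of_int m * fst (fst p)) * cis (2 * pi * of_int n * fst (snd p)) \<partial>\<kappa>) = 0"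
          by (rule char_integral_0[OF irr])
        then show ?thesis using False circle_integral_char[of m] circle_integral_char[of n] by auto
      qed
    qed
  qed
  have char_any: "\<exists>D. ok D (\<lambda>x. cis (2 * pi * of_int m * x)) P'" if "trig_poly P'" for m P'
    using that
  proof (induction rule: trig_poly.induct)
    case (char n)
    then show ?case by (rule char_char)
  next
    case (add P Q)
    then obtain D E where DE: "ok D (\<lambda>x. cis (2 * pi * of_int m * x)) P" "ok E (\<lambda>x. cis (2 * pi * of_int m * x)) Q" by blast
    have "ok (max D E) (\<lambda>x. cis (2 * pi * of_int m * x)) (\<lambda>x. P x + Q x)"
      unfolding ok_def
    proof (intro allI impI, elim conjE)
      fix r s \<kappa> assume a: "prime r" "prime s" "r \<noteq> s" "max D E < r" "max D E < s" "flow_joining \<nu> S \<alpha> r s \<kappa>"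
      note i = int[OF a(6) trig_poly.char[of m] add(1)] int[OF a(6) trig_poly.char[of m] add(2)]
      have "(\<integral>p. cis (2 * pi * of_int m * fst (fst p)) * P (fst (snd p)) \<partial>\<kappa>) = (\<integral>x. cis (2 * pi * of_int m * x) \<partial>circle_measure) * (\<integral>x. P x \<partial>circle_measure)"
        "(\<integral>p. cis (2 * pi * of_int m * fst (fst p)) * Q (fst (snd p)) \<partial>\<kappa>) = (\<integral>x. cis (2 * pi * of_int m * x) \<partial>circle_measure) * (\<integral>x. Q x \<partial>circle_measure)"
        using DE a unfolding ok_def by auto
      then show "(\<integral>p. cis (2 * pi * of_int m * fst (fst p)) * (P (fst (snd p)) + Q (fst (snd p))) \<partial>\<kappa>)
        = (\<integral>x. cis (2 * pi * of_int m * x) \<partial>circle_measure) * (\<integral>x. P x + Q x \<partial>circle_measure)"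
        using i trig_poly_integrable[OF add(1)] trig_poly_integrable[OF add(2)] by (simp add: distrib_left)
    qed
    then show ?case by blast
  next
    case (cmult P c)
    then obtain D where D: "ok D (\<lambda>x. cis (2 * pi * of_int m * x)) P" by blast
    have "ok D (\<lambda>x. cis (2 * pi * of_int m * x)) (\<lambda>x. c * P x)"
      using D unfolding ok_def by (simp add: mult.left_commute[of _ c])
    then show ?case by blast
  qed
  have "\<exists>D. ok D P P'" using P
  proof (induction rule: trig_poly.induct)
    case (char m)
    then show ?case by (rule char_any[OF P'])
  next
    case (add P Q)
    then obtain D E where DE: "ok D P P'" "ok E Q P'" by blast
    have "ok (max D E) (\<lambda>x. P x + Q x) P'"
      unfolding ok_def
    proof (intro allI impI, elim conjE)
      fix r s \<kappa> assume a: "prime r" "prime s" "r \<noteq> s" "max D E < r" "max D E < s" "flow_joining \<nu> S \<alpha> r s \<kappa>"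
      note i = int[OF a(6) add(1) P'] int[OF a(6) add(2) P']
      have "(\<integral>p. P (fst (fst p)) * P' (fst (snd p)) \<partial>\<kappa>) = (\<integral>x. P x \<partial>circle_measure) * (\<integral>x. P' x \<partial>circle_measure)"
        "(\<integral>p. Q (fst (fst p)) * P' (fst (snd p)) \<partial>\<kappa>) = (\<integral>x. Q x \<partial>circle_measure) * (\<integral>x. P' x \<partial>circle_measure)"
        using DE a unfolding ok_def by auto
      then show "(\<integral>p. (P (fst (fst p)) + Q (fst (fst p))) * P' (fst (snd p)) \<partial>\<kappa>)
        = (\<integral>x. P x + Q x \<partial>circle_measure) * (\<integral>x. P' x \<partial>circle_measure)"
        using i trig_poly_integrable[OF add(1)] trig_poly_integrable[OF add(2)] by (simp add: distrib_right)
    qed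
    then show ?case by blast
  next
    case (cmult P c)
    then obtain D where D: "ok D P P'" by blast
    have "ok D (\<lambda>x. c * P x) P'"
      using D unfolding ok_def by (simp add: mult.assoc)
    then show ?case by blast
  qed
  then show ?thesis unfolding ok_def .
qed

lemma base_joining_small:
  fixes u v :: "real \<Rightarrow> complex"
  assumes irr: "\<alpha> \<notin> \<rat>" and u [measurable]: "u \<in> borel_measurable circle_measure" and v [measurable]: "v \<in> borel_measurable circle_measure"
    and ub: "\<And>x. norm (u x) \<le> B" and vb: "\<And>x. norm (v x) \<le> C" and u0: "(\<integral>x. u x \<partial>circle_measure) = 0" and e: "0 < e"
  shows "\<exists>D. \<forall>r s \<kappa>. prime r \<and> prime s \<and> r \<noteq> s \<and> D < r \<and> D < s \<and> flow_joining \<nu> S \<alpha> r s \<kappa> \<longrightarrow>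
    norm (\<integral>p. u (fst (fst p)) * v (fst (snd p)) \<partial>\<kappa>) \<le> e"
proof -
  have C0: "0 \<le> C" using vb norm_ge_zero order.trans by blast
  have iu: "integrable circle_measure u" by (rule circle.integrable_const_bound[where B=B]) (use ub in auto)
  have iv: "integrable circle_measure v" by (rule circle.integrable_const_bound[where B=C]) (use vb in auto)
  \<comment> \<open>The error has three parts, each at most e/3: C e1 for replacing u by P, B' e2
    for replacing v by P', and (C + 1) e1 for the product of the two means, since u has mean 0 and
    thus P has mean at most e1.\<close>
  define e1 where "e1 = e / (3 * (C + 1))"
  have e1: "0 < e1" using e C0 by (simp add: e1_def)
  obtain P where P: "trig_poly P" and Pe: "(\<integral>x. norm (u x - P x) \<partial>circle_measure) < e1"
    using trig_approx_integrable[OF iu] e1 unfolding trig_approx_def by blast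
  obtain B' where PB: "\<And>x. norm (P x) \<le> B'" using trig_poly_bounded[OF P] by blast
  have B'0: "0 \<le> B'" using PB norm_ge_zero order.trans by blast
  \<comment> \<open>The second polynomial is chosen after the first, because its accuracy must beat
    the supremum bound B' of P. The minimum with 1 keeps the mean of P' below C + 1.\<close>
  define e2 where "e2 = min 1 (e / (3 * (B' + 1)))"
  have e2: "0 < e2" using e B'0 by (simp add: e2_def)
  obtain P' where P': "trig_poly P'" and Pe': "(\<integral>x. norm (v x - P' x) \<partial>circle_measure) < e2"
    using trig_approx_integrable[OF iv] e2 unfolding trig_approx_def by blast
  obtain C' where PC: "\<And>x. norm (P' x) \<le> C'" using trig_poly_bounded[OF P'] by blast
  note iP = trig_poly_integrable[OF P] and iP' = trig_poly_integrable[OF P']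
  have Pm [measurable]: "P \<in> borel_measurable circle_measure" and Pm' [measurable]: "P' \<in> borel_measurable circle_measure"
    using borel_measurable_circle[OF trig_poly_measurable] P P' by auto
  have nP: "norm (\<integral>x. P x \<partial>circle_measure) \<le> e1"
  proof -
    have "(\<integral>x. P x \<partial>circle_measure) = - (\<integral>x. u x - P x \<partial>circle_measure)" using iu iP u0 by simp
    then have "norm (\<integral>x. P x \<partial>circle_measure) \<le> (\<integral>x. norm (u x - P x) \<partial>circle_measure)"
      by (simp only: norm_minus_cancel integral_norm_bound)
    then show ?thesis using Pe by simp
  qed
  have nP': "norm (\<integral>x. P' x \<partial>circle_measure) \<le> C + 1"
  proof -
    have "norm (\<integral>x. P' x \<partial>circle_measure) = norm ((\<integral>x. v x \<partial>circle_measure) - (\<integral>x. v x - P' x \<partial>circle_measure))"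
      using iv iP' by simp
    also have "\<dots> \<le> norm (\<integral>x. v x \<partial>circle_measure) + norm (\<integral>x. v x - P' x \<partial>circle_measure)" by (rule norm_triangle_ineq4)
    also have "norm (\<integral>x. v x - P' x \<partial>circle_measure) \<le> 1"
    proof -
      have "e2 \<le> 1" by (simp add: e2_def)
      then show ?thesis using integral_norm_bound[of circle_measure "\<lambda>x. v x - P' x"] Pe' by linarith
    qed
    also have "norm (\<integral>x. v x \<partial>circle_measure) \<le> (\<integral>x. C \<partial>circle_measure)"
      by (rule order.trans[OF integral_norm_bound integral_mono]) (use iv vb in auto)
    finally show ?thesis by (simp add: circle.prob_space[simplified])
  qed
  obtain D where D: "\<And>r s \<kappa>. prime r \<Longrightarrow> prime s \<Longrightarrow> r \<noteq> s \<Longrightarrow> D < r \<Longrightarrow> D < s \<Longrightarrow> flow_joining \<nu> S \<alpha> r s \<kappa> \<Longrightarrow>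
    (\<integral>p. P (fst (fst p)) * P' (fst (snd p)) \<partial>\<kappa>) = (\<integral>x. P x \<partial>circle_measure) * (\<integral>x. P' x \<partial>circle_measure)"
    using trig_poly_joining_integral[OF irr P P'] by blast
  have "norm (\<integral>p. u (fst (fst p)) * v (fst (snd p)) \<partial>\<kappa>) \<le> e"
    if a: "prime r" "prime s" "r \<noteq> s" "D < r" "D < s" and J: "flow_joining \<nu> S \<alpha> r s \<kappa>" for r s \<kappa>
  proof -
    interpret flow_joining \<nu> S \<alpha> r s \<kappa> by fact
    have lift: "(\<lambda>z. h (fst z)) \<in> borel_measurable \<M>" if "h \<in> borel_measurable circle_measure" for h :: "real \<Rightarrow> complex"
      by (rule measurable_compose[OF measurable_fst that])
    have mb: "(\<lambda>p. fst (fst p)) \<in> measurable \<kappa> circle_measure" "(\<lambda>p. fst (snd p)) \<in> measurable \<kappa> circle_measure"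
      by measurable
    define x where "x p = fst (fst p)" for p :: "(real \<times> 'a) \<times> (real \<times> 'a)"
    define x' where "x' p = fst (snd p)" for p :: "(real \<times> 'a) \<times> (real \<times> 'a)"
    have i1: "integrable \<kappa> (\<lambda>p. u (x p) * v (x' p))" unfolding x_def x'_def
      by (rule integrable_bounded_product[OF lift[OF u] lift[OF v]]) (rule ub vb)+
    have i2: "integrable \<kappa> (\<lambda>p. P (x p) * v (x' p))" unfolding x_def x'_def
      by (rule integrable_bounded_product[OF lift[OF Pm] lift[OF v]]) (rule PB vb)+
    have i3: "integrable \<kappa> (\<lambda>p. P (x p) * P' (x' p))" unfolding x_def x'_def
      by (rule integrable_bounded_product[OF lift[OF Pm] lift[OF Pm']]) (rule PB PC)+
    have j1: "integrable \<kappa> (\<lambda>p. norm (u (x p) - P (x p)))"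
    proof (rule K.integrable_const_bound[where B="B + B'"])
      show "AE p in \<kappa>. norm (norm (u (x p) - P (x p))) \<le> B + B'"
        using ub PB by (intro AE_I2) (auto intro: norm_triangle_le_diff[OF add_mono])
      show "(\<lambda>p. norm (u (x p) - P (x p))) \<in> borel_measurable \<kappa>"
        unfolding x_def by (rule measurable_compose[OF mb(1)]) measurable
    qed
    have j2: "integrable \<kappa> (\<lambda>p. norm (v (x' p) - P' (x' p)))"
    proof (rule K.integrable_const_bound[where B="C + C'"])
      show "AE p in \<kappa>. norm (norm (v (x' p) - P' (x' p))) \<le> C + C'"
        using vb PC by (intro AE_I2) (auto intro: norm_triangle_le_diff[OF add_mono])
      show "(\<lambda>p. norm (v (x' p) - P' (x' p))) \<in> borel_measurable \<kappa>"
        unfolding x'_def by (rule measurable_compose[OF mb(2)]) measurable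
    qed
    have s1: "norm (\<integral>p. u (x p) * v (x' p) - P (x p) * v (x' p) \<partial>\<kappa>) \<le> C * e1"
    proof -
      have "norm (\<integral>p. u (x p) * v (x' p) - P (x p) * v (x' p) \<partial>\<kappa>) \<le> (\<integral>p. C * norm (u (x p) - P (x p)) \<partial>\<kappa>)"
      proof (rule order.trans[OF integral_norm_bound integral_mono])
        fix p
        have "norm (u (x p) * v (x' p) - P (x p) * v (x' p)) = norm (u (x p) - P (x p)) * norm (v (x' p))"
          by (simp add: norm_mult[symmetric] left_diff_distrib)
        also have "\<dots> \<le> norm (u (x p) - P (x p)) * C" using vb by (intro mult_left_mono) auto
        finally show "norm (u (x p) * v (x' p) - P (x p) * v (x' p)) \<le> C * norm (u (x p) - P (x p))" by (simp add: mult.commute)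
      qed (use i1 i2 j1 in auto)
      also have "\<dots> = C * (\<integral>p. norm (u (x p) - P (x p)) \<partial>\<kappa>)" by simp
      also have "(\<integral>p. norm (u (x p) - P (x p)) \<partial>\<kappa>) = (\<integral>x. norm (u x - P x) \<partial>circle_measure)"
        unfolding x_def by (rule marginal_integral(1)) measurable
      also have "C * \<dots> \<le> C * e1" using Pe C0 by (intro mult_left_mono) auto
      finally show ?thesis .
    qed
    have s2: "norm (\<integral>p. P (x p) * v (x' p) - P (x p) * P' (x' p) \<partial>\<kappa>) \<le> B' * e2"
    proof -
      have "norm (\<integral>p. P (x p) * v (x' p) - P (x p) * P' (x' p) \<partial>\<kappa>) \<le> (\<integral>p. B' * norm (v (x' p) - P' (x' p)) \<partial>\<kappa>)"
      proof (rule order.trans[OF integral_norm_bound integral_mono])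
        fix p
        have "norm (P (x p) * v (x' p) - P (x p) * P' (x' p)) = norm (P (x p)) * norm (v (x' p) - P' (x' p))"
          by (simp add: norm_mult[symmetric] right_diff_distrib)
        also have "\<dots> \<le> B' * norm (v (x' p) - P' (x' p))" using PB by (intro mult_right_mono) auto
        finally show "norm (P (x p) * v (x' p) - P (x p) * P' (x' p)) \<le> B' * norm (v (x' p) - P' (x' p))" .
      qed (use i2 i3 j2 in auto)
      also have "\<dots> = B' * (\<integral>p. norm (v (x' p) - P' (x' p)) \<partial>\<kappa>)" by simp
      also have "(\<integral>p. norm (v (x' p) - P' (x' p)) \<partial>\<kappa>) = (\<integral>x. norm (v x - P' x) \<partial>circle_measure)"
        unfolding x'_def by (rule marginal_integral(2)) measurable
      also have "B' * \<dots> \<le> B' * e2" using Pe' B'0 by (intro mult_left_mono) auto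
      finally show ?thesis .
    qed
    have s3: "norm (\<integral>p. P (x p) * P' (x' p) \<partial>\<kappa>) \<le> e1 * (C + 1)"
      unfolding x_def x'_def D[OF a J] norm_mult using nP nP' e1 by (intro mult_mono) auto
    have eq: "(\<integral>p. u (x p) * v (x' p) \<partial>\<kappa>) = (\<integral>p. u (x p) * v (x' p) - P (x p) * v (x' p) \<partial>\<kappa>)
      + ((\<integral>p. P (x p) * v (x' p) - P (x p) * P' (x' p) \<partial>\<kappa>) + (\<integral>p. P (x p) * P' (x' p) \<partial>\<kappa>))"
      using i1 i2 i3 by simp
    have "norm (\<integral>p. u (x p) * v (x' p) \<partial>\<kappa>) \<le> C * e1 + (B' * e2 + e1 * (C + 1))"
      unfolding eq by (intro norm_triangle_mono s1 s2 s3)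
    also have "\<dots> \<le> e"
    proof -
      have third: "c * (e / (3 * c)) = e / 3" if "0 < c" for c using that by simp
      have t1: "(C + 1) * e1 = e / 3" unfolding e1_def by (rule third) (use C0 in simp)
      then have "C * e1 \<le> e / 3" using e1 by (simp add: distrib_right)
      moreover have "B' * e2 \<le> e / 3"
      proof -
        have "B' * e2 \<le> (B' + 1) * (e / (3 * (B' + 1)))" using B'0 e2 e by (intro mult_mono) (auto simp: e2_def)
        also have "\<dots> = e / 3" by (rule third) (use B'0 in simp)
        finally show ?thesis .
      qed
      ultimately show ?thesis using t1 by (simp add: mult.commute)
    qed
    finally show ?thesis by (simp add: x_def x'_def)
  qed
  then show ?thesis by blast
qed

text \<open>Truncation disturbs the mean, so the lost mean \<open>c n\<close> is added back as a
  constant. It tends to 0, hence the L2 error stays small, and mean zero survives the passage to a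
  bounded function.\<close>

lemma (in prob_space) bounded_L2_approx:
  fixes F :: "'a \<Rightarrow> complex"
  assumes F [measurable]: "F \<in> borel_measurable M" and F2: "integrable M (\<lambda>x. (cmod (F x))\<^sup>2)" and \<eta>: "0 < \<eta>"
  shows "\<exists>F' K. F' \<in> borel_measurable M \<and> (\<forall>x. cmod (F' x) \<le> K) \<and>
    integrable M (\<lambda>x. (cmod (F x - F' x))\<^sup>2) \<and> (\<integral>x. (cmod (F x - F' x))\<^sup>2 \<partial>M) < \<eta> \<and> (\<integral>x. F' x \<partial>M) = (\<integral>x. F x \<partial>M)"
proof -
  have iF: "integrable M F"
  proof (rule Bochner_Integration.integrable_bound[where f="\<lambda>x. 1 + (cmod (F x))\<^sup>2"])
    have "cmod (F x) \<le> 1 + (cmod (F x))\<^sup>2" for x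
    proof -
      have "0 \<le> (cmod (F x) - 1 / 2)\<^sup>2" by simp
      then show ?thesis by (simp add: power2_eq_square algebra_simps)
    qed
    then show "AE x in M. cmod (F x) \<le> norm (1 + (cmod (F x))\<^sup>2)" by (intro AE_I2) simp
  qed (use F2 in auto)
  define T where "T n x = (if cmod (F x) \<le> real n then F x else 0)" for n :: nat and x
  have Tm [measurable]: "T n \<in> borel_measurable M" for n unfolding T_def by measurable
  have Tlim: "(\<lambda>n. T n x) \<longlonglongrightarrow> F x" for x
  proof (rule tendsto_eventually)
    obtain n0 :: nat where "cmod (F x) \<le> real n0" using real_arch_simple by blast
    then have "\<forall>n\<ge>n0. T n x = F x" by (auto simp: T_def)
    then show "eventually (\<lambda>n. T n x = F x) sequentially" by (auto simp: eventually_sequentially)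
  qed
  have TF: "cmod (T n x) \<le> cmod (F x)" "cmod (F x - T n x) \<le> cmod (F x)" for n x by (auto simp: T_def)
  have iT: "integrable M (T n)" for n
    by (rule Bochner_Integration.integrable_bound[OF iF]) (auto intro: AE_I2 TF)
  define c where "c n = (\<integral>x. F x \<partial>M) - (\<integral>x. T n x \<partial>M)" for n
  have "(\<lambda>n. \<integral>x. T n x \<partial>M) \<longlonglongrightarrow> (\<integral>x. F x \<partial>M)"
    by (rule integral_dominated_convergence[where w="\<lambda>x. cmod (F x)"]) (use iF Tlim TF in auto)
  then have "(\<lambda>n. (\<integral>x. F x \<partial>M) - (\<integral>x. T n x \<partial>M)) \<longlonglongrightarrow> (\<integral>x. F x \<partial>M) - (\<integral>x. F x \<partial>M)"
    by (intro tendsto_diff tendsto_const)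
  then have c0: "c \<longlonglongrightarrow> 0" by (simp add: c_def[abs_def])
  have sq: "(\<lambda>n. \<integral>x. (cmod (F x - T n x))\<^sup>2 \<partial>M) \<longlonglongrightarrow> (\<integral>x. 0 \<partial>M)"
  proof (rule integral_dominated_convergence[where w="\<lambda>x. (cmod (F x))\<^sup>2"])
    show "AE x in M. (\<lambda>n. (cmod (F x - T n x))\<^sup>2) \<longlonglongrightarrow> 0"
    proof (rule AE_I2)
      fix x
      have "(\<lambda>n. (cmod (F x - T n x))\<^sup>2) \<longlonglongrightarrow> (cmod (F x - F x))\<^sup>2"
        by (intro tendsto_power tendsto_norm tendsto_diff tendsto_const Tlim)
      then show "(\<lambda>n. (cmod (F x - T n x))\<^sup>2) \<longlonglongrightarrow> 0" by simp
    qed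
    show "AE x in M. norm ((cmod (F x - T n x))\<^sup>2) \<le> (cmod (F x))\<^sup>2" for n
      using TF(2) by (intro AE_I2) (simp add: power_mono)
  qed (use F2 in auto)
  have "(\<lambda>n. 2 * (\<integral>x. (cmod (F x - T n x))\<^sup>2 \<partial>M) + 2 * (cmod (c n))\<^sup>2) \<longlonglongrightarrow> 2 * 0 + 2 * (cmod 0)\<^sup>2"
    using sq by (intro tendsto_add tendsto_mult tendsto_const tendsto_power tendsto_norm c0) simp
  then have "eventually (\<lambda>n. 2 * (\<integral>x. (cmod (F x - T n x))\<^sup>2 \<partial>M) + 2 * (cmod (c n))\<^sup>2 < \<eta>) sequentially"
    using \<eta> by (intro order_tendstoD(2)) auto
  then obtain n where n: "2 * (\<integral>x. (cmod (F x - T n x))\<^sup>2 \<partial>M) + 2 * (cmod (c n))\<^sup>2 < \<eta>"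
    by (auto simp: eventually_sequentially)
  define F' where "F' x = T n x + c n" for x
  have F'm [measurable]: "F' \<in> borel_measurable M" unfolding F'_def by measurable
  have iFT: "integrable M (\<lambda>x. (cmod (F x - T n x))\<^sup>2)"
    by (rule Bochner_Integration.integrable_bound[OF F2]) (auto intro!: AE_I2 power_mono TF)
  have pt: "(cmod (F x - F' x))\<^sup>2 \<le> 2 * (cmod (F x - T n x))\<^sup>2 + 2 * (cmod (c n))\<^sup>2" for x
  proof -
    have "cmod (F x - F' x) \<le> cmod (F x - T n x) + cmod (c n)"
      unfolding F'_def diff_add_eq_diff_diff_swap using norm_triangle_ineq4[of "F x - T n x" "c n"] by (simp add: algebra_simps)
    then have "(cmod (F x - F' x))\<^sup>2 \<le> (cmod (F x - T n x) + cmod (c n))\<^sup>2" by (intro power_mono) auto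
    also have "\<dots> \<le> 2 * (cmod (F x - T n x))\<^sup>2 + 2 * (cmod (c n))\<^sup>2"
      using zero_le_power2[of "cmod (F x - T n x) - cmod (c n)"] by (simp add: power2_eq_square algebra_simps)
    finally show ?thesis .
  qed
  have ib: "integrable M (\<lambda>x. 2 * (cmod (F x - T n x))\<^sup>2 + 2 * (cmod (c n))\<^sup>2)" using iFT by simp
  have iFF: "integrable M (\<lambda>x. (cmod (F x - F' x))\<^sup>2)"
    by (rule Bochner_Integration.integrable_bound[OF ib]) (use pt in \<open>auto intro!: AE_I2\<close>)
  have "(\<integral>x. (cmod (F x - F' x))\<^sup>2 \<partial>M) \<le> (\<integral>x. 2 * (cmod (F x - T n x))\<^sup>2 + 2 * (cmod (c n))\<^sup>2 \<partial>M)"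
    by (rule integral_mono[OF iFF ib pt])
  also have "\<dots> = 2 * (\<integral>x. (cmod (F x - T n x))\<^sup>2 \<partial>M) + 2 * (cmod (c n))\<^sup>2"
    using iFT by (simp add: prob_space)
  finally have lt: "(\<integral>x. (cmod (F x - F' x))\<^sup>2 \<partial>M) < \<eta>" using n by simp
  have mean: "(\<integral>x. F' x \<partial>M) = (\<integral>x. F x \<partial>M)"
    unfolding F'_def using iT[of n] by (simp add: prob_space c_def)
  have bd: "cmod (F' x) \<le> real n + cmod (c n)" for x
    unfolding F'_def by (intro norm_triangle_mono) (auto simp: T_def)
  show ?thesis using F'm bd iFF lt mean by blast
qed

context flow_joining
begin

text \<open>A weighted form of a b \<le> t a^2 + b^2 / t stands in for the Cauchy-Schwarz
  inequality, with t left free for the application. The right-hand side involves only the marginals,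
  so the estimate is uniform over all joinings.\<close>

lemma L2_product:
  fixes F G :: "real \<times> 'b \<Rightarrow> complex"
  assumes F [measurable]: "F \<in> borel_measurable \<M>" and G [measurable]: "G \<in> borel_measurable \<M>"
    and F2: "integrable \<M> (\<lambda>z. (cmod (F z))\<^sup>2)" and G2: "integrable \<M> (\<lambda>z. (cmod (G z))\<^sup>2)"
  shows "integrable \<kappa> (\<lambda>p. F (fst p) * G (snd p))"
    and "0 < t \<Longrightarrow> norm (\<integral>p. F (fst p) * G (snd p) \<partial>\<kappa>)
      \<le> t * (\<integral>z. (cmod (F z))\<^sup>2 \<partial>\<M>) + (\<integral>z. (cmod (G z))\<^sup>2 \<partial>\<M>) / t"
proof -
  let ?M = "\<M>"
  have m: "fst \<in> measurable \<kappa> ?M" "snd \<in> measurable \<kappa> ?M" by measurable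
  have Fi: "integrable \<kappa> (\<lambda>p. (cmod (F (fst p)))\<^sup>2)" "(\<integral>p. (cmod (F (fst p)))\<^sup>2 \<partial>\<kappa>) = (\<integral>z. (cmod (F z))\<^sup>2 \<partial>?M)"
    using integrable_distr[OF m(1), of "\<lambda>z. (cmod (F z))\<^sup>2"] integral_distr[OF m(1), of "\<lambda>z. (cmod (F z))\<^sup>2"] F2
    by (simp_all add: marginals)
  have Gi: "integrable \<kappa> (\<lambda>p. (cmod (G (snd p)))\<^sup>2)" "(\<integral>p. (cmod (G (snd p)))\<^sup>2 \<partial>\<kappa>) = (\<integral>z. (cmod (G z))\<^sup>2 \<partial>?M)"
    using integrable_distr[OF m(2), of "\<lambda>z. (cmod (G z))\<^sup>2"] integral_distr[OF m(2), of "\<lambda>z. (cmod (G z))\<^sup>2"] G2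
    by (simp_all add: marginals)
  have amgm: "a * b \<le> t * a\<^sup>2 + b\<^sup>2 / t" if t: "0 < t" and ab: "0 \<le> a" "0 \<le> b" for a b t :: real
  proof -
    have "0 \<le> (t * a - b)\<^sup>2 + t * (a * b)" using t ab by simp
    then have "t * (a * b) \<le> t * (t * a\<^sup>2) + b\<^sup>2" using t by (simp add: power2_eq_square algebra_simps)
    then have "a * b \<le> (t * (t * a\<^sup>2) + b\<^sup>2) / t" using t by (simp add: pos_le_divide_eq mult.commute)
    then show ?thesis using t by (simp add: add_divide_distrib)
  qed
  show i: "integrable \<kappa> (\<lambda>p. F (fst p) * G (snd p))"
  proof (rule Bochner_Integration.integrable_bound)
    show "integrable \<kappa> (\<lambda>p. (cmod (F (fst p)))\<^sup>2 + (cmod (G (snd p)))\<^sup>2)" using Fi Gi by simp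
    show "AE p in \<kappa>. norm (F (fst p) * G (snd p)) \<le> norm ((cmod (F (fst p)))\<^sup>2 + (cmod (G (snd p)))\<^sup>2)"
      using amgm[of 1] by (intro AE_I2) (simp add: norm_mult)
  qed measurable
  assume t: "0 < t"
  have "norm (\<integral>p. F (fst p) * G (snd p) \<partial>\<kappa>) \<le> (\<integral>p. t * (cmod (F (fst p)))\<^sup>2 + (cmod (G (snd p)))\<^sup>2 / t \<partial>\<kappa>)"
  proof (rule order.trans[OF integral_norm_bound integral_mono])
    show "integrable \<kappa> (\<lambda>p. norm (F (fst p) * G (snd p)))" using i by (rule integrable_norm)
    show "integrable \<kappa> (\<lambda>p. t * (cmod (F (fst p)))\<^sup>2 + (cmod (G (snd p)))\<^sup>2 / t)" using Fi Gi by simp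
    show "norm (F (fst p) * G (snd p)) \<le> t * (cmod (F (fst p)))\<^sup>2 + (cmod (G (snd p)))\<^sup>2 / t" for p
      unfolding norm_mult by (rule amgm[OF t]) auto
  qed
  also have "\<dots> = t * (\<integral>z. (cmod (F z))\<^sup>2 \<partial>?M) + (\<integral>z. (cmod (G z))\<^sup>2 \<partial>?M) / t"
    using Fi Gi by simp
  finally show "norm (\<integral>p. F (fst p) * G (snd p) \<partial>\<kappa>) \<le> t * (\<integral>z. (cmod (F z))\<^sup>2 \<partial>?M) + (\<integral>z. (cmod (G z))\<^sup>2 \<partial>?M) / t" .
qed

end

text \<open>Both functions are replaced by bounded ones at a cost that the marginals control. For
  bounded functions the integral reduces to fibre means, which are functions on the circle, and for
  these the correlation is small once both primes exceed a threshold not depending on the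
  joining.\<close>

theorem theorem7:
  fixes \<alpha> :: real and \<nu> :: "'b measure" and S :: "real \<Rightarrow> 'b \<Rightarrow> 'b"
  assumes "\<alpha> \<notin> \<rat>"
    and "bounded_partial_quotients \<alpha>"
    and "standard_prob_space \<nu>"
    and "ergodic_flow \<nu> S"
    and "\<forall>t. t \<in> \<rat> \<longrightarrow> \<not> flow_eigenvalue_L2_0 \<nu> S t"
  shows "AOP (circle_measure \<Otimes>\<^sub>M \<nu>)
           (\<lambda>(x, y). (frac (x + \<alpha>), S (frac x - 1 / 2) y))"
proof -
  note irr = assms(1) and bd = assms(2) and noeig = assms(5)
  interpret flow: prob_flow \<nu> S
    using assms(3,4) by (intro prob_flow.intro prob_flow_axioms.intro)
      (auto simp: standard_prob_space_def ergodic_flow_def)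
  interpret M: pair_prob_space circle_measure \<nu> ..
  let ?M = "circle_measure \<Otimes>\<^sub>M \<nu>"
  have R: "(\<lambda>(x, y). (frac (x + \<alpha>), S (frac x - 1 / 2) y)) = skew \<alpha> S" by (simp add: skew_def)
  show ?thesis unfolding R AOP_def
  proof (intro ballI allI impI)
    fix F G :: "real \<times> 'b \<Rightarrow> complex" and \<epsilon> :: real
    assume FL: "F \<in> L2_0 ?M" and GL: "G \<in> L2_0 ?M" and \<epsilon>: "0 < \<epsilon>"
    have F [measurable]: "F \<in> borel_measurable ?M" and F2: "integrable ?M (\<lambda>z. (cmod (F z))\<^sup>2)" and F0: "(\<integral>z. F z \<partial>?M) = 0"
      using FL by (auto simp: L2_0_def)
    have G [measurable]: "G \<in> borel_measurable ?M" and G2: "integrable ?M (\<lambda>z. (cmod (G z))\<^sup>2)"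
      using GL by (auto simp: L2_0_def)
    define a where "a = (\<integral>z. (cmod (G z))\<^sup>2 \<partial>?M) + 1"
    have a: "0 < a" "(\<integral>z. (cmod (G z))\<^sup>2 \<partial>?M) \<le> a" by (auto simp: a_def add_nonneg_pos)
    \<comment> \<open>The tolerance matches the weight t = 8 a / \<epsilon> used below: both terms
      of the product estimate are then at most \<epsilon>/8.\<close>
    obtain F' K where F' [measurable]: "F' \<in> borel_measurable ?M" and F'b: "\<And>z. cmod (F' z) \<le> K"
      and F'2: "integrable ?M (\<lambda>z. (cmod (F z - F' z))\<^sup>2)"
      and F'e: "(\<integral>z. (cmod (F z - F' z))\<^sup>2 \<partial>?M) < \<epsilon>\<^sup>2 / (64 * a)" and F'0: "(\<integral>z. F' z \<partial>?M) = 0"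
      using M.bounded_L2_approx[OF F F2, of "\<epsilon>\<^sup>2 / (64 * a)"] \<epsilon> a F0 by auto
    have F'i2: "integrable ?M (\<lambda>z. (cmod (F' z))\<^sup>2)"
      by (rule M.integrable_const_bound[where B="K\<^sup>2"]) (use F'b in \<open>auto intro!: power_mono\<close>)
    define a' where "a' = (\<integral>z. (cmod (F' z))\<^sup>2 \<partial>?M) + 1"
    have a': "0 < a'" "(\<integral>z. (cmod (F' z))\<^sup>2 \<partial>?M) \<le> a'" by (auto simp: a'_def add_nonneg_pos)
    \<comment> \<open>G' is chosen after F', since its tolerance is measured against the L2 norm of
      F'. With the weight \<epsilon> / (8 a') both terms are again at most \<epsilon>/8.\<close>
    obtain G' K' where G' [measurable]: "G' \<in> borel_measurable ?M" and G'b: "\<And>z. cmod (G' z) \<le> K'"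
      and G'2: "integrable ?M (\<lambda>z. (cmod (G z - G' z))\<^sup>2)"
      and G'e: "(\<integral>z. (cmod (G z - G' z))\<^sup>2 \<partial>?M) < \<epsilon>\<^sup>2 / (64 * a')"
      using M.bounded_L2_approx[OF G G2, of "\<epsilon>\<^sup>2 / (64 * a')"] \<epsilon> a' by auto
    have G'i2: "integrable ?M (\<lambda>z. (cmod (G' z))\<^sup>2)"
      by (rule M.integrable_const_bound[where B="K'\<^sup>2"]) (use G'b in \<open>auto intro!: power_mono\<close>)
    define u where "u x = (\<integral>y. F' (x, y) \<partial>\<nu>)" for x
    define v where "v x = (\<integral>y. G' (x, y) \<partial>\<nu>)" for x
    have iF': "integrable ?M F'" by (rule M.integrable_const_bound[where B=K]) (use F'b in auto)
    have u0: "(\<integral>x. u x \<partial>circle_measure) = 0"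
      unfolding u_def using M.integral_fst'[OF iF'] F'0 by simp
    have um: "u \<in> borel_measurable circle_measure" unfolding u_def
      by (rule flow.borel_measurable_lebesgue_integral) simp
    have vm: "v \<in> borel_measurable circle_measure" unfolding v_def
      by (rule flow.borel_measurable_lebesgue_integral) simp
    have ub: "cmod (u x) \<le> K" for x unfolding u_def by (rule flow.fibre_integral(2)[OF F' F'b])
    have vb: "cmod (v x) \<le> K'" for x unfolding v_def by (rule flow.fibre_integral(2)[OF G' G'b])
    have "0 < \<epsilon> / 2" using \<epsilon> by simp
    from base_joining_small[OF irr um vm ub vb u0 this, of \<nu> S]
    obtain D where D: "\<And>r s \<kappa>. prime r \<Longrightarrow> prime s \<Longrightarrow> r \<noteq> s \<Longrightarrow> D < r \<Longrightarrow> D < s \<Longrightarrow> flow_joining \<nu> S \<alpha> r s \<kappa> \<Longrightarrow>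
      norm (\<integral>p. u (fst (fst p)) * v (fst (snd p)) \<partial>\<kappa>) \<le> \<epsilon> / 2" by blast
    \<comment> \<open>\<open>Suc D\<close> converts the strict bounds D < r and D < s into the
      non-strict ones in \<open>AOP\<close>. The error budget is \<epsilon>/4 + \<epsilon>/4 for the
      two replacements and \<epsilon>/2 for the base.\<close>
    have "cmod (\<integral>z. F (fst z) * G (snd z) \<partial>\<kappa>) \<le> \<epsilon>"
      if rs: "prime r" "prime s" "r \<noteq> s" "Suc D \<le> r" "Suc D \<le> s" and \<kappa>: "\<kappa> \<in> ergodic_joinings ?M (skew \<alpha> S) r s" for r s \<kappa>
    proof -
      interpret flow_joining \<nu> S \<alpha> r s \<kappa>
        by (intro flow_joining.intro flow.prob_flow_axioms flow_joining_axioms.intro \<kappa>)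
      have FF: "(\<lambda>z. F z - F' z) \<in> borel_measurable ?M" and GG: "(\<lambda>z. G z - G' z) \<in> borel_measurable ?M" by measurable
      note i1 = L2_product[OF FF G F'2 G2] and i2 = L2_product[OF F' GG F'i2 G'2] and i3 = L2_product(1)[OF F' G' F'i2 G'i2]
      have "norm (\<integral>p. (F (fst p) - F' (fst p)) * G (snd p) \<partial>\<kappa>)
          \<le> 8 * a / \<epsilon> * (\<integral>z. (cmod (F z - F' z))\<^sup>2 \<partial>?M) + (\<integral>z. (cmod (G z))\<^sup>2 \<partial>?M) / (8 * a / \<epsilon>)"
        by (rule i1(2)) (use a \<epsilon> in simp)
      also have "\<dots> \<le> 8 * a / \<epsilon> * (\<epsilon>\<^sup>2 / (64 * a)) + a / (8 * a / \<epsilon>)"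
        using F'e a \<epsilon> by (intro add_mono mult_left_mono divide_right_mono) auto
      also have "\<dots> = \<epsilon> / 4" using a \<epsilon> by (simp add: power2_eq_square)
      finally have e1: "norm (\<integral>p. (F (fst p) - F' (fst p)) * G (snd p) \<partial>\<kappa>) \<le> \<epsilon> / 4" .
      have "norm (\<integral>p. F' (fst p) * (G (snd p) - G' (snd p)) \<partial>\<kappa>)
          \<le> \<epsilon> / (8 * a') * (\<integral>z. (cmod (F' z))\<^sup>2 \<partial>?M) + (\<integral>z. (cmod (G z - G' z))\<^sup>2 \<partial>?M) / (\<epsilon> / (8 * a'))"
        by (rule i2(2)) (use a' \<epsilon> in simp)
      also have "\<dots> \<le> \<epsilon> / (8 * a') * a' + (\<epsilon>\<^sup>2 / (64 * a')) / (\<epsilon> / (8 * a'))"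
        using G'e a' \<epsilon> by (intro add_mono mult_left_mono divide_right_mono) auto
      also have "\<dots> = \<epsilon> / 4" using a' \<epsilon> by (simp add: power2_eq_square)
      finally have e2: "norm (\<integral>p. F' (fst p) * (G (snd p) - G' (snd p)) \<partial>\<kappa>) \<le> \<epsilon> / 4" .
      have "(\<integral>p. F' (fst p) * G' (snd p) \<partial>\<kappa>) = (\<integral>p. u (fst (fst p)) * v (fst (snd p)) \<partial>\<kappa>)"
        unfolding u_def v_def
        by (rule average_both[OF irr bd _ _ _ noeig F' G' F'b G'b]) (use rs in \<open>auto simp: prime_gt_0_nat\<close>)
      then have e3: "norm (\<integral>p. F' (fst p) * G' (snd p) \<partial>\<kappa>) \<le> \<epsilon> / 2"
        using D[of r s \<kappa>] rs flow_joining_axioms by simp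
      have "(\<integral>p. F (fst p) * G (snd p) \<partial>\<kappa>) = (\<integral>p. (F (fst p) - F' (fst p)) * G (snd p) + (F' (fst p) * (G (snd p) - G' (snd p)) + F' (fst p) * G' (snd p)) \<partial>\<kappa>)"
        by (simp add: algebra_simps)
      also have "\<dots> = (\<integral>p. (F (fst p) - F' (fst p)) * G (snd p) \<partial>\<kappa>) + ((\<integral>p. F' (fst p) * (G (snd p) - G' (snd p)) \<partial>\<kappa>) + (\<integral>p. F' (fst p) * G' (snd p) \<partial>\<kappa>))"
        using i1(1) i2(1) i3 by (subst Bochner_Integration.integral_add, simp, simp)+ simp
      finally have eq: "(\<integral>p. F (fst p) * G (snd p) \<partial>\<kappa>) = \<dots>" .
      have "norm (\<integral>p. F (fst p) * G (snd p) \<partial>\<kappa>) \<le> \<epsilon> / 4 + (\<epsilon> / 4 + \<epsilon> / 2)"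
        unfolding eq by (intro norm_triangle_mono e1 e2 e3)
      then show ?thesis by simp
    qed
    then show "\<exists>N. \<forall>r s. prime r \<and> prime s \<and> r \<noteq> s \<and> N \<le> r \<and> N \<le> s \<longrightarrow>
        (\<forall>\<kappa>\<in>ergodic_joinings ?M (skew \<alpha> S) r s. cmod (\<integral>z. F (fst z) * G (snd z) \<partial>\<kappa>) \<le> \<epsilon>)"
      by blast
  qed
qed

end
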